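(* Let $p,q\ge 1$, $n=p+q$, let $Q=(j_1,\ldots,j_N)$ be a word in $\{1,\ldots,n-1\}$ and let $J=(\beta_1,\ldots,\beta_N)$ be a subword of $Q$. Let $uB$ be a $T$-fixed point of $Y_{+\cdots+-\cdots-}$. The $T$-weights of the tangent space of $\mathcal{BEM}^{Y_{+\cdots+-\cdots-},Q}$ at the point $p_{(uB,J)}$ are $$u\cdot(-\mathrm{inv}(w))\ \cup\ u\cdot\{s_{\beta_N}\cdot(-\alpha_{j_N}),\ s_{\beta_N}s_{\beta_{N-1}}\cdot(-\alpha_{j_{N-1}}),\ \ldots,\ s_{\beta_N}\cdots s_{\beta_1}\cdot(-\alpha_{j_1})\},$$ where $w=[p,p-1,\ldots,1,n,n-1,\ldots,p+1]$ in one-line notation.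
   Context: Setting: $G=GL_n(\mathbb C)$, $n=p+q$, $K=GL_p\times GL_q$ embedded block-diagonally, $B$ the upper triangular Borel subgroup, $T$ the diagonal torus. The simple roots are $\alpha_i=e_i-e_{i+1}$ ($1\le i\le n-1$), the Weyl group is $\mathfrak S_n$ acting on $\mathbb R^n$ by permuting coordinates ($\sigma\cdot e_i=e_{\sigma(i)}$), $s_i$ is the transposition $(i\ i+1)$, and $P_i=B\cup Bs_iB$. $Y_{+\cdots+-\cdots-}$ ($p$ pluses followed by $q$ minuses) is the closed $K$-orbit on $G/B$ consisting of complete flags $F_1\subset\cdots\subset F_{n-1}$ with $F_p=\langle e_1,\ldots,e_p\rangle$. Its $T$-fixed points are the $uB$ with $u\in\mathfrak S_p\times\mathfrak S_q$. For a closed $K$-orbit $Y_0$, $\mathcal{BEM}^{Y_0,Q}$ is the set of $(x_{N+1},\ldots,x_1)\in Y_0\times(G/B)^N$ such that $x_{i+1}$ and $x_i$ have the same image in $G/P_{j_i}$ for $i=1,\ldots,N$, with diagonal action of $K\supseteq T$. A subword of $Q$ is a list $(\beta_1,\ldots,\beta_N)$ with $\beta_i\in\{-,j_i\}$; $s_-:=\mathrm{id}$. The $T$-fixed point $p_{(uB,J)}$ is $(uB,us_{\beta_N}B,us_{\beta_N}s_{\beta_{N-1}}B,\ldots,us_{\beta_N}\cdots s_{\beta_1}B)$. For a reduced expression $w=s_{i_1}\cdots s_{i_\ell}$, $\mathrm{inv}(w):=\{\alpha_{i_1},s_{i_1}(\alpha_{i_2}),\ldots,s_{i_1}\cdots s_{i_{\ell-1}}(\alpha_{i_\ell})\}$.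 The $T$-weights of the tangent space at a $T$-fixed point are the eigenvalues (weights in $\mathfrak t^*\cong\mathbb R^n$) of the induced linear $T$-action. *)

theory Defs
  imports
    "HOL-Algebra.Left_Coset"
    "HOL-Algebra.AbelCoset"
    "HOL-Combinatorics.Permutations"
    "Jordan_Normal_Form.VS_Connect"
begin

section \<open>Permutations and roots\<close>

text \<open>
  Permutations act on \<open>{1..n}\<close>, and vectors of $\mathbb R^n$ are functions \<open>nat \<Rightarrow> real\<close> that are
  supported on \<open>{1..n}\<close>.  Matrices of the library are indexed from 0, so the standard basis vector
  $e_i$ corresponds to row and column \<open>i - 1\<close>.
\<close>

definition simple_refl :: "nat \<Rightarrow> nat \<Rightarrow> nat" where
  "simple_refl i = Transposition.transpose i (i + 1)"

definition simple_root :: "nat \<Rightarrow> nat \<Rightarrow> real" where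
  "simple_root i = (\<lambda>k. (if k = i then 1 else 0) - (if k = i + 1 then 1 else 0))"

text \<open>The action determined by $\sigma\cdot e_i = e_{\sigma(i)}$.\<close>

definition perm_act :: "(nat \<Rightarrow> nat) \<Rightarrow> (nat \<Rightarrow> real) \<Rightarrow> (nat \<Rightarrow> real)" where
  "perm_act \<sigma> v = v \<circ> inv_into UNIV \<sigma>"

definition one_line :: "nat list \<Rightarrow> nat \<Rightarrow> nat" where
  "one_line xs i = (if i \<in> {1..length xs} then xs ! (i - 1) else i)"

definition word_prod :: "nat list \<Rightarrow> nat \<Rightarrow> nat" where
  "word_prod ws = foldr (\<lambda>i f. simple_refl i \<circ> f) ws id"

definition reduced_expression :: "nat \<Rightarrow> (nat \<Rightarrow> nat) \<Rightarrow> nat list \<Rightarrow> bool" where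
  "reduced_expression n w ws \<longleftrightarrow>
     set ws \<subseteq> {1..n - 1} \<and> word_prod ws = w \<and>
     (\<forall>ws'. set ws' \<subseteq> {1..n - 1} \<and> word_prod ws' = w \<longrightarrow> length ws \<le> length ws')"

text \<open>The set does not depend on the reduced expression that is chosen.\<close>

definition inv_roots :: "nat \<Rightarrow> (nat \<Rightarrow> nat) \<Rightarrow> (nat \<Rightarrow> real) set" where
  "inv_roots n w =
     (let ws = (SOME ws. reduced_expression n w ws)
      in {perm_act (word_prod (take k ws)) (simple_root (ws ! k)) | k. k < length ws})"

section \<open>The general linear group, flags and cosets\<close>

definition GL :: "nat \<Rightarrow> complex mat monoid" where
  "GL n = units_of (ring_mat TYPE(complex) n ())"

definition upper_borel :: "nat \<Rightarrow> complex mat set" where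
  "upper_borel n = {b \<in> carrier (GL n). upper_triangular b}"

definition torus :: "nat \<Rightarrow> complex mat set" where
  "torus n = {t \<in> carrier (GL n). diagonal_mat t}"

definition perm_mat :: "nat \<Rightarrow> (nat \<Rightarrow> nat) \<Rightarrow> complex mat" where
  "perm_mat n \<sigma> = mat n n (\<lambda>(i, j). if i + 1 = \<sigma> (j + 1) then 1 else 0)"

definition min_parabolic :: "nat \<Rightarrow> nat \<Rightarrow> complex mat set" where
  "min_parabolic n i =
     upper_borel n \<union>
     (upper_borel n <#>\<^bsub>GL n\<^esub> (perm_mat n (simple_refl i) <#\<^bsub>GL n\<^esub> upper_borel n))"

definition flag_var :: "nat \<Rightarrow> complex mat set set" where
  "flag_var n = lcosets\<^bsub>GL n\<^esub> upper_borel n"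

definition perm_flag :: "nat \<Rightarrow> (nat \<Rightarrow> nat) \<Rightarrow> complex mat set" where
  "perm_flag n \<sigma> = perm_mat n \<sigma> <#\<^bsub>GL n\<^esub> upper_borel n"

abbreviation complex_span :: "nat \<Rightarrow> complex vec set \<Rightarrow> complex vec set" where
  "complex_span n \<equiv> LinearCombinations.module.span class_ring (module_vec TYPE(complex) n)"

text \<open>
  The coset $gB$ is the complete flag whose $i$-th space is the span of the first $i$ columns of
  \<open>g\<close>.  The orbit $Y_{+\cdots+-\cdots-}$ is cut out by $F_p = \langle e_1,\dots,e_p\rangle$.
\<close>

definition flag_space :: "nat \<Rightarrow> complex mat \<Rightarrow> nat \<Rightarrow> complex vec set" where
  "flag_space n g i = complex_span n (col g ` {..<i})"

definition closed_orbit :: "nat \<Rightarrow> nat \<Rightarrow> complex mat set set" where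
  "closed_orbit p q =
     {g <#\<^bsub>GL (p + q)\<^esub> upper_borel (p + q) | g. g \<in> carrier (GL (p + q)) \<and>
        flag_space (p + q) g p = complex_span (p + q) (unit_vec (p + q) ` {..<p})}"

definition torus_fixed :: "nat \<Rightarrow> complex mat set set \<Rightarrow> complex mat set set" where
  "torus_fixed n Y = {x \<in> Y. \<forall>t\<in>torus n. t <#\<^bsub>GL n\<^esub> x = x}"

section \<open>Barbasch-Evens-Magyar varieties\<close>

text \<open>
  A point $(x_{N+1},\dots,x_1)$ is the extensional function \<open>i \<mapsto> x\<^sub>i\<close> on \<open>{1..N + 1}\<close>.
  The word entry $j_i$ is \<open>Q ! (i - 1)\<close>.  The image of a coset $x\in G/B$ in $G/P$ is $xP$.
\<close>

definition BEM :: "nat \<Rightarrow> complex mat set set \<Rightarrow> nat list \<Rightarrow> (nat \<Rightarrow> complex mat set) set" where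
  "BEM n Y Q =
     {x \<in> {1..length Q + 1} \<rightarrow>\<^sub>E flag_var n.
        x (length Q + 1) \<in> Y \<and>
        (\<forall>i\<in>{1..length Q}.
           x (i + 1) <#>\<^bsub>GL n\<^esub> min_parabolic n (Q ! (i - 1)) =
           x i <#>\<^bsub>GL n\<^esub> min_parabolic n (Q ! (i - 1)))}"

text \<open>In a subword, \<open>None\<close> stands for the entry $-$.\<close>

definition is_subword :: "nat option list \<Rightarrow> nat list \<Rightarrow> bool" where
  "is_subword J Q \<longleftrightarrow> list_all2 (\<lambda>\<beta> j. \<beta> = None \<or> \<beta> = Some j) J Q"

definition opt_refl :: "nat option \<Rightarrow> nat \<Rightarrow> nat" where
  "opt_refl \<beta> = (case \<beta> of None \<Rightarrow> id | Some j \<Rightarrow> simple_refl j)"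

text \<open>The product $s_{\beta_N}s_{\beta_{N-1}}\cdots s_{\beta_i}$ (the identity for $i=N+1$).\<close>

definition subword_prod :: "nat option list \<Rightarrow> nat \<Rightarrow> nat \<Rightarrow> nat" where
  "subword_prod J i = foldr (\<lambda>\<beta> f. f \<circ> opt_refl \<beta>) (drop (i - 1) J) id"

definition fixed_point :: "nat \<Rightarrow> (nat \<Rightarrow> nat) \<Rightarrow> nat option list \<Rightarrow> nat \<Rightarrow> complex mat set" where
  "fixed_point n u J = (\<lambda>i\<in>{1..length J + 1}. perm_flag n (u \<circ> subword_prod J i))"

section \<open>Tangent spaces\<close>

text \<open>
  The ambient vector space $M_n(\mathbb C)^m$.  The fields \<open>mult\<close> and \<open>one\<close> of a module record
  play no role.
\<close>

definition mat_tuples :: "nat \<Rightarrow> nat \<Rightarrow> (complex, nat \<Rightarrow> complex mat) module" where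
  "mat_tuples n m =
     \<lparr>carrier = {1..m} \<rightarrow>\<^sub>E carrier_mat n n,
      mult = (\<lambda>X Y. \<lambda>k\<in>{1..m}. X k * Y k),
      one = (\<lambda>k\<in>{1..m}. 1\<^sub>m n),
      zero = (\<lambda>k\<in>{1..m}. 0\<^sub>m n n),
      add = (\<lambda>X Y. \<lambda>k\<in>{1..m}. X k + Y k),
      smult = (\<lambda>c X. \<lambda>k\<in>{1..m}. c \<cdot>\<^sub>m X k)\<rparr>"

inductive_set poly_funs :: "nat \<Rightarrow> nat \<Rightarrow> ((nat \<Rightarrow> complex mat) \<Rightarrow> complex) set"
  for n m where
  const: "(\<lambda>X. c) \<in> poly_funs n m"
| coord: "k \<in> {1..m} \<Longrightarrow> i < n \<Longrightarrow> j < n \<Longrightarrow> (\<lambda>X. X k $$ (i, j)) \<in> poly_funs n m"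
| add: "f \<in> poly_funs n m \<Longrightarrow> g \<in> poly_funs n m \<Longrightarrow> (\<lambda>X. f X + g X) \<in> poly_funs n m"
| mult: "f \<in> poly_funs n m \<Longrightarrow> g \<in> poly_funs n m \<Longrightarrow> (\<lambda>X. f X * g X) \<in> poly_funs n m"

text \<open>
  The Zariski tangent space at \<open>g\<close> of a locally closed subset \<open>S\<close> of $M_n(\mathbb C)^m$: the
  common kernel of the differentials at \<open>g\<close> of all polynomials that vanish on \<open>S\<close>.
\<close>

definition zariski_tangent ::
  "nat \<Rightarrow> nat \<Rightarrow> (nat \<Rightarrow> complex mat) set \<Rightarrow> (nat \<Rightarrow> complex mat) \<Rightarrow> (nat \<Rightarrow> complex mat) set"
where
  "zariski_tangent n m S g =
     {X \<in> carrier (mat_tuples n m). \<forall>f\<in>poly_funs n m. (\<forall>h\<in>S. f h = 0) \<longrightarrow>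
        ((\<lambda>z. f (g \<oplus>\<^bsub>mat_tuples n m\<^esub> (z \<odot>\<^bsub>mat_tuples n m\<^esub> X))) has_field_derivative 0) (at 0)}"

text \<open>
  The tangent space at \<open>x\<close> of a subvariety \<open>Z\<close> of the homogeneous space $(G/B)^m$.  The orbit map
  $h\mapsto h\cdot x$ from $G^m$ to $(G/B)^m$ is a smooth surjection, so its differential at the
  identity identifies $T_xZ$ with the tangent space of the preimage of \<open>Z\<close> modulo the tangent
  space of the fibre, that is, of the stabilizer of \<open>x\<close>.  For $Z=(G/B)^m$ this is the usual
  identification of the tangent space of $G/B$ at $gB$ with $\mathfrak g/\mathrm{Ad}(g)\mathfrak b$.
\<close>

definition translate ::
  "nat \<Rightarrow> nat \<Rightarrow> (nat \<Rightarrow> complex mat) \<Rightarrow> (nat \<Rightarrow> complex mat set) \<Rightarrow> nat \<Rightarrow> complex mat set" where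
  "translate n m h x = (\<lambda>k\<in>{1..m}. h k <#\<^bsub>GL n\<^esub> x k)"

definition orbit_preimage ::
  "nat \<Rightarrow> nat \<Rightarrow> (nat \<Rightarrow> complex mat set) set \<Rightarrow> (nat \<Rightarrow> complex mat set) \<Rightarrow>
     (nat \<Rightarrow> complex mat) set" where
  "orbit_preimage n m Z x = {h \<in> {1..m} \<rightarrow>\<^sub>E carrier (GL n). translate n m h x \<in> Z}"

definition preimage_tangent ::
  "nat \<Rightarrow> nat \<Rightarrow> (nat \<Rightarrow> complex mat set) set \<Rightarrow> (nat \<Rightarrow> complex mat set) \<Rightarrow>
     (nat \<Rightarrow> complex mat) set" where
  "preimage_tangent n m Z x =
     zariski_tangent n m (orbit_preimage n m Z x) (\<lambda>k\<in>{1..m}. 1\<^sub>m n)"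

definition quot_module ::
  "('a, 'b, 'c) module_scheme \<Rightarrow> 'b set \<Rightarrow> 'b set \<Rightarrow> ('a, 'b set) module" where
  "quot_module M V W =
     \<lparr>carrier = A_RCOSETS (M\<lparr>carrier := V\<rparr>) W,
      mult = (\<lambda>A A'. W), one = W,
      zero = W,
      add = (\<lambda>A A'. set_add M A A'),
      smult = (\<lambda>c A. \<Union>X\<in>A. a_r_coset M W (c \<odot>\<^bsub>M\<^esub> X))\<rparr>"

definition tangent_space ::
  "nat \<Rightarrow> nat \<Rightarrow> (nat \<Rightarrow> complex mat set) set \<Rightarrow> (nat \<Rightarrow> complex mat set) \<Rightarrow>
     (complex, (nat \<Rightarrow> complex mat) set) module" where
  "tangent_space n m Z x =
     quot_module (mat_tuples n m) (preimage_tangent n m Z x) (preimage_tangent n m {x} x)"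

section \<open>Torus weights\<close>

text \<open>
  If \<open>x\<close> is fixed by the diagonal action of \<open>t\<close>, then $t\cdot(h\cdot x) = (tht^{-1})\cdot x$.
  Hence the differential of the action of \<open>t\<close> at \<open>x\<close> is induced by $X\mapsto tXt^{-1}$.
\<close>

definition torus_diff ::
  "nat \<Rightarrow> nat \<Rightarrow> complex mat \<Rightarrow> (nat \<Rightarrow> complex mat) set \<Rightarrow> (nat \<Rightarrow> complex mat) set" where
  "torus_diff n m t A = (\<lambda>X. \<lambda>k\<in>{1..m}. t * X k * inv\<^bsub>GL n\<^esub> t) ` A"

text \<open>The characters of the torus form the lattice $\mathbb Z^n\subset\mathbb R^n\cong\mathfrak t^*$.\<close>

definition weight_lattice :: "nat \<Rightarrow> (nat \<Rightarrow> real) set" where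
  "weight_lattice n = {l. (\<forall>k\<in>{1..n}. l k \<in> \<int>) \<and> (\<forall>k. k \<notin> {1..n} \<longrightarrow> l k = 0)}"

definition torus_char :: "nat \<Rightarrow> (nat \<Rightarrow> real) \<Rightarrow> complex mat \<Rightarrow> complex" where
  "torus_char n l t = (\<Prod>k = 1..n. t $$ (k - 1, k - 1) powi \<lfloor>l k\<rfloor>)"

definition weight_space ::
  "nat \<Rightarrow> nat \<Rightarrow> (nat \<Rightarrow> complex mat set) set \<Rightarrow> (nat \<Rightarrow> complex mat set) \<Rightarrow> (nat \<Rightarrow> real) \<Rightarrow>
     (nat \<Rightarrow> complex mat) set set" where
  "weight_space n m Z x l =
     {A \<in> carrier (tangent_space n m Z x). \<forall>t\<in>torus n.
        torus_diff n m t A = torus_char n l t \<odot>\<^bsub>tangent_space n m Z x\<^esub> A}"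

definition tangent_weights ::
  "nat \<Rightarrow> nat \<Rightarrow> (nat \<Rightarrow> complex mat set) set \<Rightarrow> (nat \<Rightarrow> complex mat set) \<Rightarrow>
     (nat \<Rightarrow> real) set" where
  "tangent_weights n m Z x =
     {l \<in> weight_lattice n. \<exists>A\<in>weight_space n m Z x l. A \<noteq> \<zero>\<^bsub>tangent_space n m Z x\<^esub>}"

definition weight_multiplicity ::
  "nat \<Rightarrow> nat \<Rightarrow> (nat \<Rightarrow> complex mat set) set \<Rightarrow> (nat \<Rightarrow> complex mat set) \<Rightarrow>
     (nat \<Rightarrow> real) \<Rightarrow> nat" where
  "weight_multiplicity n m Z x l =
     vectorspace.dim (class_ring :: complex ring)
       (tangent_space n m Z x \<lparr>carrier := weight_space n m Z x l\<rparr>)"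

end

theory Submission
  imports Defs
begin

text \<open>
Write \<open>N\<close> for the length of \<open>Q\<close>, \<open>m = N + 1\<close>, and let \<open>v\<^sub>k = u s\<^sub>\<beta>\<^sub>N \<dots> s\<^sub>\<beta>\<^sub>k\<close>, so that the \<open>k\<close>-th
component of the fixed point is the coset of the permutation matrix of \<open>v\<^sub>k\<close>.  Everything happens one
matrix entry at a time: all the subgroups involved are conjugates, by permutation matrices, of
stabilisers of coordinate flags, so they are described by the vanishing of certain entries, and the
torus acts on the entry in row \<open>c\<close> and column \<open>d\<close> through the character $e_c - e_d$.

Pulled back along the orbit map of \<open>G\<^sup>m\<close>, the variety becomes the set of tuples with
\<open>h\<^sub>m\<close> in the block parabolic and \<open>h\<^sub>k = h\<^sub>k\<^sub>+\<^sub>1 r\<^sub>k\<close> with \<open>r\<^sub>k\<close> in the conjugate by \<open>v\<^sub>k\<close> of the minimal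
parabolic of the letter \<open>j\<^sub>k\<close>.  Its tangent space at the identity consists of the tuples \<open>X\<close> with
\<open>X\<^sub>m\<close> in the Lie algebra of the first group and each \<open>X\<^sub>k - X\<^sub>k\<^sub>+\<^sub>1\<close> in that of the second
(\<open>zariski_tangent_chain_preimage\<close>).  One inclusion comes from the entries of \<open>adj(h\<^sub>k\<^sub>+\<^sub>1) h\<^sub>k\<close> outside
that Lie algebra, which are polynomials that vanish on the set; the other from the explicit curve
$h_k(z) = (1 + z D_m) \cdots (1 + z D_k)$ with \<open>D\<^sub>k = X\<^sub>k - X\<^sub>k\<^sub>+\<^sub>1\<close> and \<open>D\<^sub>m = X\<^sub>m\<close>, which lies in the
set for small \<open>z\<close> and has derivative \<open>X\<close> at \<open>0\<close>.  The stabiliser of the point is treated in the same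
way (\<open>zariski_tangent_stabilizer\<close>).

For a fixed position \<open>(c, d)\<close> the tangent vectors form a chain of numbers
\<open>X\<^sub>1, \<dots>, X\<^sub>m\<close>.  Passing to the quotient forgets \<open>X\<^sub>k\<close> whenever the position lies in the \<open>k\<close>-th Borel
algebra; of the remaining numbers, \<open>X\<^sub>k\<close> is tied to \<open>X\<^sub>k\<^sub>+\<^sub>1\<close> (or to \<open>0\<close>, when \<open>k = m\<close>) if the position
lies outside the \<open>k\<close>-th parabolic algebra.  Hence the free coordinates are exactly those for which the
position lies in the \<open>k\<close>-th parabolic algebra but not in the \<open>k\<close>-th Borel algebra, and the multiplicity
of a weight is the number of such triples \<open>(k, c, d)\<close> of that weight (\<open>weight_multiplicity_eq_card\<close>).

For \<open>k \<le> N\<close> the minimal parabolic algebra exceeds the Borel algebra by the single root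
$-\alpha_{j_k}$, which contributes \<open>v\<^sub>k\<close> applied to it (\<open>new_at_letter\<close>).  For \<open>k = m\<close> the block
parabolic exceeds the Borel algebra by the negative roots inside the two blocks.  The permutation \<open>w\<close>
reverses each block, so its inversions are precisely the pairs inside a block, and \<open>inv_roots\<close> is the
set of the corresponding positive roots because the roots read off a reduced word are the inversions
of its product (\<open>inv_roots_eq_inversions\<close>, \<open>new_at_top\<close>).
\<close>

section \<open>Roots and simple reflections\<close>

definition root_diff :: "nat \<Rightarrow> nat \<Rightarrow> nat \<Rightarrow> real" where
  "root_diff a b = (\<lambda>x. (if x = a then 1 else 0) - (if x = b then 1 else 0))"

lemma simple_root_eq: "simple_root i = root_diff i (Suc i)"
  by (simp add: simple_root_def root_diff_def)

lemma uminus_root_diff: "- root_diff a b = root_diff b a"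
  by (auto simp: root_diff_def)

lemma perm_act_root_diff: "bij \<sigma> \<Longrightarrow> perm_act \<sigma> (root_diff a b) = root_diff (\<sigma> a) (\<sigma> b)"
proof (rule ext)
  assume "bij \<sigma>"
  then have "inv_into UNIV \<sigma> x = c \<longleftrightarrow> x = \<sigma> c" for x c
    by (metis bij_inv_eq_iff)
  then show "perm_act \<sigma> (root_diff a b) x = root_diff (\<sigma> a) (\<sigma> b) x" for x
    by (simp add: perm_act_def root_diff_def)
qed

lemma root_diff_inject:
  "a \<noteq> b \<Longrightarrow> root_diff a b = root_diff c d \<longleftrightarrow> a = c \<and> b = d"
proof
  assume ab: "a \<noteq> b" and eq: "root_diff a b = root_diff c d"
  show "a = c \<and> b = d"
    using fun_cong[OF eq, of a] fun_cong[OF eq, of b] ab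
    by (auto simp: root_diff_def split: if_splits)
qed simp

lemma simple_refl_permutes: "1 \<le> i \<Longrightarrow> i < n \<Longrightarrow> simple_refl i permutes {1..n}"
  unfolding simple_refl_def by (rule permutes_swap_id) auto

lemma simple_refl_bij: "bij (simple_refl i)"
  by (simp add: simple_refl_def)

lemma simple_refl_twice: "simple_refl i (simple_refl i a) = a"
  by (simp add: simple_refl_def)

lemma simple_refl_involution: "simple_refl i \<circ> simple_refl i = id"
  by (rule ext) (simp add: simple_refl_twice)

lemma simple_refl_comp_cancel: "simple_refl i \<circ> (simple_refl i \<circ> w) = w"
  by (rule ext) (simp add: simple_refl_twice)

lemma inv_simple_refl: "inv_into UNIV (simple_refl i) = simple_refl i"
  by (rule inv_unique_comp) (rule simple_refl_involution)+

lemma inv_simple_refl_comp: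
  "bij w \<Longrightarrow> inv_into UNIV (simple_refl i \<circ> w) a = inv_into UNIV w (simple_refl i a)"
  using o_inv_distrib[OF simple_refl_bij[of i], of w] by (simp add: inv_simple_refl)

section \<open>Coordinates on a complex vector space\<close>

text \<open>
Coordinates that separate points and admit a dual family identify the structure with the functions
on \<open>E\<close>.  Since the axioms of a vector space can be verified on coordinates, only closure under
the operations has to be known in advance, which suits quotients whose operations are defined by
unions of cosets.
\<close>
lemma vectorspace_dim_by_coordinates:
  fixes M :: "(complex, 'b, 'm) module_scheme" and \<phi> :: "'b \<Rightarrow> 'e \<Rightarrow> complex"
  assumes finE: "finite E"
    and zero: "\<zero>\<^bsub>M\<^esub> \<in> carrier M" "\<And>e. e \<in> E \<Longrightarrow> \<phi> \<zero>\<^bsub>M\<^esub> e = 0"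
    and add: "\<And>x y. x \<in> carrier M \<Longrightarrow> y \<in> carrier M \<Longrightarrow> x \<oplus>\<^bsub>M\<^esub> y \<in> carrier M"
      "\<And>x y e. x \<in> carrier M \<Longrightarrow> y \<in> carrier M \<Longrightarrow> e \<in> E \<Longrightarrow> \<phi> (x \<oplus>\<^bsub>M\<^esub> y) e = \<phi> x e + \<phi> y e"
    and smult: "\<And>c x. x \<in> carrier M \<Longrightarrow> c \<odot>\<^bsub>M\<^esub> x \<in> carrier M"
      "\<And>c x e. x \<in> carrier M \<Longrightarrow> e \<in> E \<Longrightarrow> \<phi> (c \<odot>\<^bsub>M\<^esub> x) e = c * \<phi> x e"
    and inj: "\<And>x y. x \<in> carrier M \<Longrightarrow> y \<in> carrier M \<Longrightarrow> (\<And>e. e \<in> E \<Longrightarrow> \<phi> x e = \<phi> y e) \<Longrightarrow> x = y"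
    and dual: "\<And>e. e \<in> E \<Longrightarrow> b e \<in> carrier M"
      "\<And>e e'. e \<in> E \<Longrightarrow> e' \<in> E \<Longrightarrow> \<phi> (b e) e' = (if e' = e then 1 else 0)"
  shows "vectorspace class_ring M" and "vectorspace.dim class_ring M = card E"
proof -
  show vs: "vectorspace class_ring M"
  proof (rule vs_criteria)
    show "field (class_ring :: complex ring)" by (rule class_field.field_axioms)
    show "\<forall>v\<in>carrier M. \<exists>neg_v\<in>carrier M. v \<oplus>\<^bsub>M\<^esub> neg_v = \<zero>\<^bsub>M\<^esub>"
    proof
      fix v assume v: "v \<in> carrier M"
      have "v \<oplus>\<^bsub>M\<^esub> ((- 1) \<odot>\<^bsub>M\<^esub> v) = \<zero>\<^bsub>M\<^esub>"
        by (rule inj) (use v in \<open>auto simp: zero add smult\<close>)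
      then show "\<exists>neg_v\<in>carrier M. v \<oplus>\<^bsub>M\<^esub> neg_v = \<zero>\<^bsub>M\<^esub>" using smult(1)[OF v] by blast
    qed
  qed (auto simp: zero add smult algebra_simps intro!: inj)
  interpret vectorspace "class_ring :: complex ring" M by (rule vs)
  have binj: "inj_on b E"
    by (rule inj_onI) (metis dual(2) zero_neq_one)
  have bsub: "b ` E \<subseteq> carrier M" using dual(1) by auto
  have lc: "\<phi> (lincomb a A) e = (\<Sum>x\<in>A. a x * \<phi> x e)"
    if "finite A" "A \<subseteq> carrier M" "e \<in> E" for a A e
    using that
  proof (induction A rule: finite_induct)
    case empty
    then show ?case by (simp add: lincomb_def zero)
  next
    case (insert x F)
    have "lincomb a (insert x F) = a x \<odot>\<^bsub>M\<^esub> x \<oplus>\<^bsub>M\<^esub> lincomb a F"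
      unfolding lincomb_def using insert by (subst finsum_insert) (auto simp: smult)
    moreover have "lincomb a F \<in> carrier M" using insert by (intro lincomb_closed) auto
    ultimately show ?case using insert by (simp add: add smult)
  qed
  have lcb: "\<phi> (lincomb a (b ` E)) e = a (b e)" if "e \<in> E" for a e
  proof -
    have "\<phi> (lincomb a (b ` E)) e = (\<Sum>x\<in>E. a (b x) * \<phi> (b x) e)"
      using that finE bsub by (subst lc) (auto simp: sum.reindex[OF binj])
    also have "\<dots> = (\<Sum>x\<in>E. if x = e then a (b x) else 0)"
      by (rule sum.cong) (use that dual(2) in auto)
    also have "\<dots> = a (b e)" using finE that by simp
    finally show ?thesis .
  qed
  have "lin_indpt (b ` E)"
  proof (rule finite_lin_indpt2)
    show "\<forall>v\<in>b ` E. a v = \<zero>\<^bsub>class_ring\<^esub>"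
      if "lincomb a (b ` E) = \<zero>\<^bsub>M\<^esub>" for a
      using that lcb[of _ a] zero by auto
  qed (use finE bsub in auto)
  moreover have "span (b ` E) = carrier M"
  proof
    show "span (b ` E) \<subseteq> carrier M" using bsub by (rule span_is_subset2)
    show "carrier M \<subseteq> span (b ` E)"
    proof
      fix x assume x: "x \<in> carrier M"
      have "x = lincomb (\<lambda>y. \<phi> x (inv_into E b y)) (b ` E)"
      proof (rule inj)
        show "lincomb (\<lambda>y. \<phi> x (inv_into E b y)) (b ` E) \<in> carrier M"
          using bsub by (intro lincomb_closed) auto
      qed (auto simp: x lcb inv_into_f_f[OF binj])
      then show "x \<in> span (b ` E)" using finE unfolding span_def by auto
    qed
  qed
  ultimately have "basis (b ` E)" unfolding basis_def using bsub by auto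
  then have "dim = card (b ` E)" using finE by (intro dim_basis) auto
  then show "vectorspace.dim class_ring M = card E" using card_image[OF binj] by simp
qed

section \<open>Characters of the torus\<close>

lemma GL_carrier: "g \<in> carrier (GL n) \<longleftrightarrow> g \<in> carrier_mat n n \<and> det g \<noteq> 0"
  unfolding GL_def units_of_carrier
  using unit_imp_det_non_zero[of g n "()"] det_non_zero_imp_unit[of g n "()"]
  by (auto simp: Units_def ring_mat_simps)

lemma GL_mult [simp]: "x \<otimes>\<^bsub>GL n\<^esub> y = x * y"
  by (simp add: GL_def units_of_mult ring_mat_simps)

lemma GL_one [simp]: "\<one>\<^bsub>GL n\<^esub> = 1\<^sub>m n"
  by (simp add: GL_def units_of_one ring_mat_simps)

lemma group_GL: "group (GL n)"
proof -
  interpret ring "ring_mat TYPE(complex) n ()" by (rule ring_mat)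
  show ?thesis unfolding GL_def by (rule units_group)
qed


text \<open>
Matrix positions count from \<open>0\<close>, the coordinates of weights from \<open>1\<close>.
\<close>
definition entry_weight :: "nat \<Rightarrow> nat \<Rightarrow> nat \<Rightarrow> real" where
  "entry_weight c d = root_diff (Suc c) (Suc d)"

text \<open>
Conjugation by a diagonal matrix rescales each entry separately; this is what makes the whole
computation split into matrix positions.
\<close>
lemma torus_conj:
  assumes t: "t \<in> torus n" and X: "X \<in> carrier_mat n n"
  shows "t * X * inv\<^bsub>GL n\<^esub> t = mat n n (\<lambda>(c, d). t $$ (c, c) * X $$ (c, d) / t $$ (d, d))"
    and "\<And>c. c < n \<Longrightarrow> t $$ (c, c) \<noteq> 0"
proof -
  have tc: "t \<in> carrier_mat n n" "det t \<noteq> 0" "diagonal_mat t"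
    using t unfolding torus_def by (auto simp: GL_carrier)
  have "upper_triangular t"
    using tc unfolding diagonal_mat_def upper_triangular_def by auto
  then have "det t = prod_list (diag_mat t)" using det_upper_triangular tc by blast
  then show nz: "\<And>c. c < n \<Longrightarrow> t $$ (c, c) \<noteq> 0"
    using tc by (auto simp: diag_mat_def prod_list_zero_iff)
  define s where "s = mat n n (\<lambda>(c, d). if c = d then 1 / t $$ (c, c) else 0)"
  have s: "s \<in> carrier_mat n n" by (simp add: s_def)
  have teq: "t $$ (c, d) = 0" if "c < n" "d < n" "c \<noteq> d" for c d
    using tc that unfolding diagonal_mat_def by auto
  have right: "(A * s) $$ (c, d) = A $$ (c, d) / t $$ (d, d)"
    if "c < n" "d < n" "A \<in> carrier_mat n n" for c d A
  proof -
    have "(A * s) $$ (c, d) = (\<Sum>i<n. A $$ (c, i) * s $$ (i, d))"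
      using that s by (simp add: times_mat_def scalar_prod_def lessThan_atLeast0)
    also have "\<dots> = (\<Sum>i<n. if i = d then A $$ (c, i) / t $$ (d, d) else 0)"
      by (rule sum.cong) (use that in \<open>auto simp: s_def\<close>)
    finally show ?thesis using that by simp
  qed
  have left: "(t * A) $$ (c, d) = t $$ (c, c) * A $$ (c, d)"
    if "c < n" "d < n" "A \<in> carrier_mat n n" for c d A
  proof -
    have "(t * A) $$ (c, d) = (\<Sum>i<n. t $$ (c, i) * A $$ (i, d))"
      using that tc by (simp add: times_mat_def scalar_prod_def lessThan_atLeast0)
    also have "\<dots> = (\<Sum>i<n. if i = c then t $$ (c, c) * A $$ (c, d) else 0)"
      by (rule sum.cong) (use that in \<open>auto simp: teq\<close>)
    finally show ?thesis using that by simp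
  qed
  have ts: "t * s = 1\<^sub>m n"
    by (rule eq_matI) (use tc s nz in \<open>auto simp: right teq simp del: index_mult_mat(1)\<close>)
  have st: "s * t = 1\<^sub>m n" by (rule mat_mult_left_right_inverse[OF tc(1) s ts])
  have "det s \<noteq> 0" using det_mult[OF tc(1) s] ts by auto
  then have "inv\<^bsub>GL n\<^esub> t = s"
    using st s tc by (intro group.inv_equality[OF group_GL]) (auto simp: GL_carrier)
  then show "t * X * inv\<^bsub>GL n\<^esub> t = mat n n (\<lambda>(c, d). t $$ (c, c) * X $$ (c, d) / t $$ (d, d))"
    by (intro eq_matI) (use tc s X in \<open>auto simp: right left simp del: index_mult_mat(1)\<close>)
qed

lemma torus_char_entry_weight:
  assumes t: "t \<in> torus n" and "c < n" "d < n"
  shows "torus_char n (entry_weight c d) t = t $$ (c, c) / t $$ (d, d)"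
proof -
  have nz: "\<And>c. c < n \<Longrightarrow> t $$ (c, c) \<noteq> 0" by (rule torus_conj(2)[OF t zero_carrier_mat])
  have fl: "\<lfloor>entry_weight c d k\<rfloor> = (if k = c + 1 then 1 else 0) + (if k = d + 1 then - 1 else 0)" for k
    by (simp add: entry_weight_def root_diff_def)
  have "torus_char n (entry_weight c d) t =
      (\<Prod>k = 1..n. (if k = c + 1 then t $$ (c, c) else 1) * (if k = d + 1 then inverse (t $$ (d, d)) else 1))"
    unfolding torus_char_def
  proof (rule prod.cong)
    fix k assume k: "k \<in> {1..n}"
    then have "t $$ (k - 1, k - 1) \<noteq> 0" by (intro nz) auto
    then show "t $$ (k - 1, k - 1) powi \<lfloor>entry_weight c d k\<rfloor> =
       (if k = c + 1 then t $$ (c, c) else 1) * (if k = d + 1 then inverse (t $$ (d, d)) else 1)"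
      unfolding fl by (auto simp: power_int_minus)
  qed simp
  also have "\<dots> = t $$ (c, c) / t $$ (d, d)"
    unfolding prod.distrib using assms by (simp add: divide_inverse)
  finally show ?thesis .
qed

lemma entry_weight_in_lattice: "c < n \<Longrightarrow> d < n \<Longrightarrow> entry_weight c d \<in> weight_lattice n"
  by (auto simp: weight_lattice_def entry_weight_def root_diff_def)

text \<open>
Distinct characters differ in some coordinate \<open>x\<close>, and already the diagonal matrix with \<open>2\<close> in that
place and \<open>1\<close> elsewhere distinguishes them, since the powers of \<open>2\<close> are distinct.
\<close>
lemma torus_separates_characters:
  assumes l: "l \<in> weight_lattice n" "l' \<in> weight_lattice n" "l \<noteq> l'"
  obtains t where "t \<in> torus n" "torus_char n l t \<noteq> torus_char n l' t"
proof -
  obtain x where x: "l x \<noteq> l' x" using l(3) by (auto simp: fun_eq_iff)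
  have xn: "x \<in> {1..n}"
  proof (rule ccontr)
    assume "x \<notin> {1..n}"
    then have "l x = 0" "l' x = 0" using l unfolding weight_lattice_def by blast+
    then show False using x by simp
  qed
  define t where "t = mat n n (\<lambda>(c, d). if c = d then (if c + 1 = x then 2 else 1) else (0 :: complex))"
  have tc: "t \<in> carrier_mat n n" by (simp add: t_def)
  have "upper_triangular t" by (auto simp: t_def)
  then have "det t = prod_list (diag_mat t)" using det_upper_triangular tc by blast
  also have "\<dots> \<noteq> 0" by (auto simp: diag_mat_def prod_list_zero_iff t_def)
  finally have "t \<in> torus n"
    unfolding torus_def using tc by (auto simp: GL_carrier diagonal_mat_def t_def)
  moreover have ch: "torus_char n h t = 2 powi \<lfloor>h x\<rfloor>" for h :: "nat \<Rightarrow> real"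
  proof -
    have "torus_char n h t = (\<Prod>k = 1..n. if k = x then 2 powi \<lfloor>h x\<rfloor> else 1)"
      unfolding torus_char_def by (rule prod.cong) (auto simp: t_def)
    then show ?thesis using xn by simp
  qed
  have "\<lfloor>l x\<rfloor> \<noteq> \<lfloor>l' x\<rfloor>"
  proof -
    have "l x \<in> \<int>" "l' x \<in> \<int>" using xn l unfolding weight_lattice_def by blast+
    then show ?thesis using x by (auto elim!: Ints_cases)
  qed
  then have "norm (2 powi \<lfloor>l x\<rfloor> :: complex) \<noteq> norm (2 powi \<lfloor>l' x\<rfloor> :: complex)"
    using power_int_strict_increasing[of _ _ "2 :: real"]
    by (cases "\<lfloor>l x\<rfloor>" "\<lfloor>l' x\<rfloor>" rule: linorder_cases) (fastforce simp: norm_power_int)+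
  then have "torus_char n l t \<noteq> torus_char n l' t" unfolding ch by auto
  ultimately show thesis by (rule that)
qed

section \<open>Torus weights of an entrywise quotient\<close>

lemma mat_tuples_simps:
  "carrier (mat_tuples n m) = {1..m} \<rightarrow>\<^sub>E carrier_mat n n"
  "X \<oplus>\<^bsub>mat_tuples n m\<^esub> Y = (\<lambda>k\<in>{1..m}. X k + Y k)"
  "c \<odot>\<^bsub>mat_tuples n m\<^esub> X = (\<lambda>k\<in>{1..m}. c \<cdot>\<^sub>m X k)"
  by (simp_all add: mat_tuples_def)

lemma mat_tuples_dims:
  assumes "X \<in> carrier (mat_tuples n m)" "k \<in> {1..m}"
  shows "X k \<in> carrier_mat n n" "dim_row (X k) = n" "dim_col (X k) = n"
proof -
  show "X k \<in> carrier_mat n n"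
    using assms unfolding mat_tuples_simps by (rule PiE_mem)
  then show "dim_row (X k) = n" "dim_col (X k) = n" by auto
qed

text \<open>
The common shape of the tangent spaces in question.  \<open>Low k\<close> is the set of positions outside the Borel
algebra at the \<open>k\<close>-th component, and \<open>Out k\<close> the set of positions outside the \<open>k\<close>-th parabolic algebra.
The \<open>k\<close>-th parabolic algebra contains the Borel algebras of the \<open>k\<close>-th and of the next component,
whence the two inclusions; together they say that tuples vanishing on \<open>Low\<close> satisfy the chain conditions on \<open>Out\<close>.
\<close>
locale entrywise_quotient =
  fixes n m :: nat and Low Out :: "nat \<Rightarrow> (nat \<times> nat) set" and S :: "(nat \<Rightarrow> complex mat set) set"
    and x :: "nat \<Rightarrow> complex mat set"
  assumes Low_bound: "\<And>k. k \<in> {1..m} \<Longrightarrow> Low k \<subseteq> {..<n} \<times> {..<n}"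
    and Out_Low: "\<And>k. k \<in> {1..m} \<Longrightarrow> Out k \<subseteq> Low k"
    and Out_Low_Suc: "\<And>k. k \<in> {1..<m} \<Longrightarrow> Out k \<subseteq> Low (Suc k)"
    and V_eq: "preimage_tangent n m S x = {X \<in> carrier (mat_tuples n m). \<forall>k\<in>{1..m}. \<forall>e\<in>Out k.
        X k $$ e = (if k = m then 0 else X (Suc k) $$ e)}"
    and W_eq: "preimage_tangent n m {x} x =
        {X \<in> carrier (mat_tuples n m). \<forall>k\<in>{1..m}. \<forall>e\<in>Low k. X k $$ e = 0}"
begin

abbreviation "M \<equiv> mat_tuples n m"
abbreviation "V \<equiv> preimage_tangent n m S x"
abbreviation "W \<equiv> preimage_tangent n m {x} x"
abbreviation "T \<equiv> tangent_space n m S x"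

text \<open>
The coset of \<open>X\<close> modulo \<open>W\<close>: a class remembers exactly the entries at positions in \<open>Low\<close>.
\<close>
definition coset_of :: "(nat \<Rightarrow> complex mat) \<Rightarrow> (nat \<Rightarrow> complex mat) set" where
  "coset_of X = {Y \<in> carrier M. \<forall>k\<in>{1..m}. \<forall>e\<in>Low k. Y k $$ e = X k $$ e}"

text \<open>
The triples that survive in the quotient as free coordinates of weight \<open>l\<close>: at a position in
\<open>Low k\<close> the entry is not killed by \<open>W\<close>, and outside \<open>Out k\<close> it is not tied to the next component.
\<close>
definition new_entries :: "(nat \<Rightarrow> real) \<Rightarrow> (nat \<times> nat \<times> nat) set" where
  "new_entries l = {(k, c, d). k \<in> {1..m} \<and> (c, d) \<in> Low k - Out k \<and> entry_weight c d = l}"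

lemma entry_bound: "k \<in> {1..m} \<Longrightarrow> e \<in> Low k \<Longrightarrow> fst e < n \<and> snd e < n"
  using Low_bound by fastforce

lemma entry_add:
  assumes "X \<in> carrier M" "Y \<in> carrier M" "k \<in> {1..m}" "e \<in> Low k"
  shows "(X \<oplus>\<^bsub>M\<^esub> Y) k $$ e = X k $$ e + Y k $$ e"
proof -
  obtain c' d' where e: "e = (c', d')" by (cases e)
  then have n: "c' < n" "d' < n" using entry_bound[OF assms(3,4)] by auto
  have "(X \<oplus>\<^bsub>M\<^esub> Y) k = X k + Y k"
    unfolding mat_tuples_simps using assms(3) by (rule restrict_apply')
  then show ?thesis using n mat_tuples_dims(2,3)[OF assms(2,3)] by (simp add: e)
qed

lemma entry_smult:
  assumes "X \<in> carrier M" "k \<in> {1..m}" "e \<in> Low k"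
  shows "(a \<odot>\<^bsub>M\<^esub> X) k $$ e = a * X k $$ e"
proof -
  obtain c d where e: "e = (c, d)" by (cases e)
  then have n: "c < n" "d < n" using entry_bound[OF assms(2,3)] by auto
  have "(a \<odot>\<^bsub>M\<^esub> X) k = a \<cdot>\<^sub>m X k"
    unfolding mat_tuples_simps using assms(2) by (rule restrict_apply')
  then show ?thesis using n mat_tuples_dims(2,3)[OF assms(1,2)] by (simp add: e)
qed

lemma add_closed: "X \<in> carrier M \<Longrightarrow> Y \<in> carrier M \<Longrightarrow> X \<oplus>\<^bsub>M\<^esub> Y \<in> carrier M"
  using mat_tuples_dims[of X] mat_tuples_dims[of Y] by (auto simp: mat_tuples_simps)

lemma smult_closed: "X \<in> carrier M \<Longrightarrow> a \<odot>\<^bsub>M\<^esub> X \<in> carrier M"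
  using mat_tuples_dims[of X] by (auto simp: mat_tuples_simps)

lemmas carrier_closed = add_closed smult_closed
lemmas entry_simps = entry_add entry_smult

lemma V_carrier: "X \<in> V \<Longrightarrow> X \<in> carrier M" unfolding V_eq by simp

lemma V_entry_bound:
  assumes "k \<in> {1..m}" "e \<in> Out k"
  shows "e \<in> Low k" "k \<noteq> m \<Longrightarrow> Suc k \<in> {1..m} \<and> e \<in> Low (Suc k)"
  using assms Out_Low[of k] Out_Low_Suc[of k] by auto

lemma V_add_closed:
  assumes "X \<in> V" "Y \<in> V"
  shows "X \<oplus>\<^bsub>M\<^esub> Y \<in> V"
  using assms V_entry_bound unfolding V_eq by (auto simp: carrier_closed entry_simps)

lemma V_smult_closed:
  assumes "X \<in> V"
  shows "a \<odot>\<^bsub>M\<^esub> X \<in> V"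
  using assms V_entry_bound unfolding V_eq by (auto simp: carrier_closed entry_simps)

lemmas V_closed = V_add_closed V_smult_closed

lemma a_r_coset_eq_coset_of:
  assumes X: "X \<in> carrier M"
  shows "a_r_coset M W X = coset_of X"
proof -
  have "Y \<in> (\<lambda>h. h \<oplus>\<^bsub>M\<^esub> X) ` W" if Y: "Y \<in> coset_of X" for Y
  proof (rule image_eqI)
    have Yc: "Y \<in> carrier M" using Y by (simp add: coset_of_def)
    define h where "h = (\<lambda>k\<in>{1..m}. Y k - X k)"
    have hc: "h \<in> carrier M"
      using mat_tuples_dims[OF X] mat_tuples_dims[OF Yc] by (auto simp: h_def mat_tuples_simps)
    have "h k $$ e = 0" if "k \<in> {1..m}" "e \<in> Low k" for k e
      using that Y entry_bound[OF that] mat_tuples_dims[OF X that(1)] mat_tuples_dims[OF Yc that(1)]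
      by (cases e) (auto simp: h_def coset_of_def)
    then show "h \<in> W" unfolding W_eq using hc by simp
    show "Y = h \<oplus>\<^bsub>M\<^esub> X"
    proof
      fix k show "Y k = (h \<oplus>\<^bsub>M\<^esub> X) k"
      proof (cases "k \<in> {1..m}")
        case True
        then show ?thesis
          using mat_tuples_dims[OF X True] mat_tuples_dims[OF Yc True]
          by (auto simp: mat_tuples_simps h_def intro!: eq_matI)
      next
        case False
        then show ?thesis using Yc by (auto simp: mat_tuples_simps)
      qed
    qed
  qed
  moreover have "h \<oplus>\<^bsub>M\<^esub> X \<in> coset_of X" if "h \<in> W" for h
    using that X unfolding W_eq coset_of_def by (auto simp: carrier_closed entry_simps)
  ultimately show ?thesis unfolding a_r_coset_def' by auto
qed

lemma coset_of_eq_iff: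
  assumes "X \<in> carrier M" "Y \<in> carrier M"
  shows "coset_of X = coset_of Y \<longleftrightarrow> (\<forall>k\<in>{1..m}. \<forall>e\<in>Low k. X k $$ e = Y k $$ e)"
proof
  assume "coset_of X = coset_of Y"
  then have "X \<in> coset_of Y" using assms(1) unfolding coset_of_def by auto
  then show "\<forall>k\<in>{1..m}. \<forall>e\<in>Low k. X k $$ e = Y k $$ e" by (simp add: coset_of_def)
qed (auto simp: coset_of_def)

lemma tangent_space_simps:
  "carrier T = coset_of ` V"
  "\<zero>\<^bsub>T\<^esub> = W"
  "\<lbrakk>X \<in> carrier M; Y \<in> carrier M\<rbrakk> \<Longrightarrow> coset_of X \<oplus>\<^bsub>T\<^esub> coset_of Y = coset_of (X \<oplus>\<^bsub>M\<^esub> Y)"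
  "X \<in> carrier M \<Longrightarrow> c \<odot>\<^bsub>T\<^esub> coset_of X = coset_of (c \<odot>\<^bsub>M\<^esub> X)"
proof -
  have "a_r_coset (M\<lparr>carrier := V\<rparr>) W X = a_r_coset M W X" for X
    unfolding a_r_coset_def' by simp
  then have "carrier T = (\<lambda>X. a_r_coset M W X) ` V"
    unfolding tangent_space_def quot_module_def A_RCOSETS_def' by auto
  also have "\<dots> = coset_of ` V" by (rule image_cong) (auto simp: a_r_coset_eq_coset_of V_carrier)
  finally show "carrier T = coset_of ` V" .
  show "\<zero>\<^bsub>T\<^esub> = W" by (simp add: tangent_space_def quot_module_def)
  show "coset_of X \<oplus>\<^bsub>T\<^esub> coset_of Y = coset_of (X \<oplus>\<^bsub>M\<^esub> Y)" if X: "X \<in> carrier M" and Y: "Y \<in> carrier M"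
  proof -
    have "coset_of X \<oplus>\<^bsub>T\<^esub> coset_of Y = {X' \<oplus>\<^bsub>M\<^esub> Y' | X' Y'. X' \<in> coset_of X \<and> Y' \<in> coset_of Y}"
      by (auto simp: tangent_space_def quot_module_def set_add_def')
    also have "\<dots> = coset_of (X \<oplus>\<^bsub>M\<^esub> Y)"
    proof
      show "{X' \<oplus>\<^bsub>M\<^esub> Y' | X' Y'. X' \<in> coset_of X \<and> Y' \<in> coset_of Y} \<subseteq> coset_of (X \<oplus>\<^bsub>M\<^esub> Y)"
        using X Y by (auto simp: coset_of_def carrier_closed entry_simps)
      show "coset_of (X \<oplus>\<^bsub>M\<^esub> Y) \<subseteq> {X' \<oplus>\<^bsub>M\<^esub> Y' | X' Y'. X' \<in> coset_of X \<and> Y' \<in> coset_of Y}"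
      proof
        fix A assume A: "A \<in> coset_of (X \<oplus>\<^bsub>M\<^esub> Y)"
        have "coset_of (X \<oplus>\<^bsub>M\<^esub> Y) = a_r_coset M W (X \<oplus>\<^bsub>M\<^esub> Y)"
          by (rule a_r_coset_eq_coset_of[symmetric]) (simp add: carrier_closed X Y)
        then obtain h where h: "h \<in> W" "A = h \<oplus>\<^bsub>M\<^esub> (X \<oplus>\<^bsub>M\<^esub> Y)"
          using A unfolding a_r_coset_def' by auto
        have hc: "h \<in> carrier M" using h(1) unfolding W_eq by simp
        have "A = (h \<oplus>\<^bsub>M\<^esub> X) \<oplus>\<^bsub>M\<^esub> Y"
          unfolding h(2) using mat_tuples_dims[OF hc] mat_tuples_dims[OF X] mat_tuples_dims[OF Y]
          by (auto simp: mat_tuples_simps assoc_add_mat intro!: restrict_ext)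
        moreover have "h \<oplus>\<^bsub>M\<^esub> X \<in> coset_of X"
          unfolding a_r_coset_eq_coset_of[OF X, symmetric] a_r_coset_def' using h(1) by auto
        moreover have "Y \<in> coset_of Y" using Y by (simp add: coset_of_def)
        ultimately show "A \<in> {X' \<oplus>\<^bsub>M\<^esub> Y' | X' Y'. X' \<in> coset_of X \<and> Y' \<in> coset_of Y}" by blast
      qed
    qed
    finally show ?thesis .
  qed
  show "c \<odot>\<^bsub>T\<^esub> coset_of X = coset_of (c \<odot>\<^bsub>M\<^esub> X)" if X: "X \<in> carrier M"
  proof -
    have "c \<odot>\<^bsub>T\<^esub> coset_of X = (\<Union>X'\<in>coset_of X. a_r_coset M W (c \<odot>\<^bsub>M\<^esub> X'))"
      by (simp add: tangent_space_def quot_module_def)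
    also have "\<dots> = (\<Union>X'\<in>coset_of X. coset_of (c \<odot>\<^bsub>M\<^esub> X))"
    proof (rule SUP_cong)
      fix X' assume X': "X' \<in> coset_of X"
      then have X'c: "X' \<in> carrier M" by (simp add: coset_of_def)
      have "coset_of (c \<odot>\<^bsub>M\<^esub> X') = coset_of (c \<odot>\<^bsub>M\<^esub> X)"
        using X X' X'c by (subst coset_of_eq_iff) (auto simp: carrier_closed entry_simps coset_of_def)
      then show "a_r_coset M W (c \<odot>\<^bsub>M\<^esub> X') = coset_of (c \<odot>\<^bsub>M\<^esub> X)"
        by (simp add: a_r_coset_eq_coset_of carrier_closed X'c)
    qed simp
    also have "\<dots> = coset_of (c \<odot>\<^bsub>M\<^esub> X)" using X by (auto simp: coset_of_def)
    finally show ?thesis .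
  qed
qed

definition conj_tuple :: "complex mat \<Rightarrow> (nat \<Rightarrow> complex mat) \<Rightarrow> nat \<Rightarrow> complex mat" where
  "conj_tuple t X = (\<lambda>k\<in>{1..m}. t * X k * inv\<^bsub>GL n\<^esub> t)"

lemma conj_tuple:
  assumes "t \<in> torus n" "X \<in> carrier M"
  shows "conj_tuple t X \<in> carrier M"
    and "\<And>k c d. k \<in> {1..m} \<Longrightarrow> (c, d) \<in> Low k \<Longrightarrow>
      conj_tuple t X k $$ (c, d) = torus_char n (entry_weight c d) t * X k $$ (c, d)"
proof -
  have eq: "conj_tuple t X k = mat n n (\<lambda>(c, d). t $$ (c, c) * X k $$ (c, d) / t $$ (d, d))"
    if "k \<in> {1..m}" for k
    using torus_conj(1)[OF assms(1) mat_tuples_dims(1)[OF assms(2) that]] that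
    by (simp add: conj_tuple_def)
  then show "conj_tuple t X \<in> carrier M"
    by (auto simp: conj_tuple_def mat_tuples_simps)
  show "conj_tuple t X k $$ (c, d) = torus_char n (entry_weight c d) t * X k $$ (c, d)"
    if "k \<in> {1..m}" "(c, d) \<in> Low k" for k c d
    using eq[OF that(1)] entry_bound[OF that] by (simp add: torus_char_entry_weight[OF assms(1)])
qed

lemma torus_diff_eq: "torus_diff n m t A = conj_tuple t ` A"
  by (simp add: torus_diff_def conj_tuple_def[abs_def])

lemma torus_diff_coset:
  assumes t: "t \<in> torus n" and X: "X \<in> carrier M"
  shows "torus_diff n m t (coset_of X) = coset_of (conj_tuple t X)"
proof
  show "torus_diff n m t (coset_of X) \<subseteq> coset_of (conj_tuple t X)"
    using conj_tuple(1)[OF t] conj_tuple(2)[OF t] X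
    unfolding torus_diff_eq by (auto simp: coset_of_def)
  show "coset_of (conj_tuple t X) \<subseteq> torus_diff n m t (coset_of X)"
  proof
    fix Y assume Y: "Y \<in> coset_of (conj_tuple t X)"
    then have Yc: "Y \<in> carrier M" by (simp add: coset_of_def)
    note nz = torus_conj(2)[OF t zero_carrier_mat]
    define A where "A = (\<lambda>k\<in>{1..m}. mat n n (\<lambda>(c, d). Y k $$ (c, d) * t $$ (d, d) / t $$ (c, c)))"
    have Ac: "A \<in> carrier M" by (auto simp: A_def mat_tuples_simps)
    have "Y = conj_tuple t A"
    proof
      fix k show "Y k = conj_tuple t A k"
      proof (cases "k \<in> {1..m}")
        case True
        then show ?thesis
          using torus_conj(1)[OF t mat_tuples_dims(1)[OF Ac True]] mat_tuples_dims[OF Yc True]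
          by (auto simp: A_def conj_tuple_def nz intro!: eq_matI)
      next
        case False
        then show ?thesis using Yc by (auto simp: mat_tuples_simps conj_tuple_def)
      qed
    qed
    moreover have "A k $$ (c, d) = X k $$ (c, d)" if "k \<in> {1..m}" "(c, d) \<in> Low k" for k c d
    proof -
      have "Y k $$ (c, d) = torus_char n (entry_weight c d) t * X k $$ (c, d)"
        using Y that conj_tuple(2)[OF t X that] unfolding coset_of_def by auto
      then show ?thesis
        using that entry_bound[OF that] nz by (simp add: A_def torus_char_entry_weight[OF t])
    qed
    ultimately show "Y \<in> torus_diff n m t (coset_of X)"
      unfolding torus_diff_eq coset_of_def using Ac by auto
  qed
qed

text \<open>
The element \<open>t\<close> multiplies the class at position \<open>(c, d)\<close> by the character \<open>entry_weight c d\<close>.  If this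
character differs from \<open>l\<close>, some \<open>t\<close> separates the two and forces the entry to vanish in the quotient.
\<close>
lemma weight_space_eq:
  assumes l: "l \<in> weight_lattice n"
  shows "weight_space n m S x l =
    coset_of ` {X \<in> V. \<forall>k\<in>{1..m}. \<forall>(c, d)\<in>Low k. entry_weight c d \<noteq> l \<longrightarrow> X k $$ (c, d) = 0}"
proof -
  have iff: "(\<forall>t\<in>torus n. torus_diff n m t (coset_of X) = torus_char n l t \<odot>\<^bsub>T\<^esub> coset_of X) \<longleftrightarrow>
    (\<forall>k\<in>{1..m}. \<forall>(c, d)\<in>Low k. entry_weight c d \<noteq> l \<longrightarrow> X k $$ (c, d) = 0)" if X: "X \<in> V" for X
  proof -
    have Xc: "X \<in> carrier M" by (rule V_carrier[OF X])
    have "torus_diff n m t (coset_of X) = torus_char n l t \<odot>\<^bsub>T\<^esub> coset_of X \<longleftrightarrow>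
       (\<forall>k\<in>{1..m}. \<forall>(c, d)\<in>Low k.
          torus_char n (entry_weight c d) t * X k $$ (c, d) = torus_char n l t * X k $$ (c, d))"
      if t: "t \<in> torus n" for t
    proof -
      have "torus_diff n m t (coset_of X) = torus_char n l t \<odot>\<^bsub>T\<^esub> coset_of X \<longleftrightarrow>
         coset_of (conj_tuple t X) = coset_of (torus_char n l t \<odot>\<^bsub>M\<^esub> X)"
        by (simp add: torus_diff_coset[OF t Xc] tangent_space_simps(4) Xc)
      also have "\<dots> \<longleftrightarrow> (\<forall>k\<in>{1..m}. \<forall>e\<in>Low k. conj_tuple t X k $$ e = (torus_char n l t \<odot>\<^bsub>M\<^esub> X) k $$ e)"
        by (rule coset_of_eq_iff[OF conj_tuple(1)[OF t Xc] smult_closed[OF Xc]])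
      also have "\<dots> \<longleftrightarrow> (\<forall>k\<in>{1..m}. \<forall>(c, d)\<in>Low k.
          torus_char n (entry_weight c d) t * X k $$ (c, d) = torus_char n l t * X k $$ (c, d))"
        by (intro ball_cong refl) (auto simp: conj_tuple(2)[OF t Xc] entry_smult[OF Xc])
      finally show ?thesis .
    qed
    then have "(\<forall>t\<in>torus n. torus_diff n m t (coset_of X) = torus_char n l t \<odot>\<^bsub>T\<^esub> coset_of X) \<longleftrightarrow>
      (\<forall>t\<in>torus n. \<forall>k\<in>{1..m}. \<forall>(c, d)\<in>Low k.
          torus_char n (entry_weight c d) t * X k $$ (c, d) = torus_char n l t * X k $$ (c, d))"
      by (rule ball_cong[OF refl])
    also have "\<dots> \<longleftrightarrow>
      (\<forall>k\<in>{1..m}. \<forall>(c, d)\<in>Low k. \<forall>t\<in>torus n.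
          torus_char n (entry_weight c d) t = torus_char n l t \<or> X k $$ (c, d) = 0)"
      unfolding mult_cancel_right by blast
    also have "\<dots> \<longleftrightarrow> (\<forall>k\<in>{1..m}. \<forall>(c, d)\<in>Low k. entry_weight c d \<noteq> l \<longrightarrow> X k $$ (c, d) = 0)"
    proof -
      have "(\<forall>t\<in>torus n. torus_char n (entry_weight c d) t = torus_char n l t \<or> X k $$ (c, d) = 0) \<longleftrightarrow>
        (entry_weight c d \<noteq> l \<longrightarrow> X k $$ (c, d) = 0)" if "k \<in> {1..m}" "(c, d) \<in> Low k" for k c d
      proof (cases "entry_weight c d = l")
        case False
        have "entry_weight c d \<in> weight_lattice n"
          using entry_bound[OF that] by (intro entry_weight_in_lattice) auto
        then obtain t where "t \<in> torus n" "torus_char n (entry_weight c d) t \<noteq> torus_char n l t"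
          using torus_separates_characters l False by blast
        then show ?thesis using False by blast
      qed simp
      then show ?thesis by (intro ball_cong refl) (auto simp del: ball_simps)
    qed
    finally show ?thesis .
  qed
  have "weight_space n m S x l =
     coset_of ` {X \<in> V. \<forall>t\<in>torus n. torus_diff n m t (coset_of X) = torus_char n l t \<odot>\<^bsub>T\<^esub> coset_of X}"
    unfolding weight_space_def tangent_space_simps(1) by blast
  also have "{X \<in> V. \<forall>t\<in>torus n. torus_diff n m t (coset_of X) = torus_char n l t \<odot>\<^bsub>T\<^esub> coset_of X} =
    {X \<in> V. \<forall>k\<in>{1..m}. \<forall>(c, d)\<in>Low k. entry_weight c d \<noteq> l \<longrightarrow> X k $$ (c, d) = 0}"
    by (rule Collect_cong, rule conj_cong[OF refl], rule iff)
  finally show ?thesis .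
qed

text \<open>
Descending induction on the component: an entry at a position of \<open>Low k\<close> is either a free coordinate
or equal to the entry in the next component (or zero in the last one), and in the second case the
position belongs to \<open>Low (Suc k)\<close> again, so that the induction continues.
\<close>
lemma new_entries_determine:
  assumes X: "X \<in> V" and Y: "Y \<in> V"
    and off: "\<And>k c d. k \<in> {1..m} \<Longrightarrow> (c, d) \<in> Low k \<Longrightarrow> entry_weight c d \<noteq> l \<Longrightarrow> X k $$ (c, d) = Y k $$ (c, d)"
    and new: "\<And>k c d. (k, c, d) \<in> new_entries l \<Longrightarrow> X k $$ (c, d) = Y k $$ (c, d)"
  shows "coset_of X = coset_of Y"
proof -
  have *: "X k $$ (c, d) = Y k $$ (c, d)" if "k \<le> m" "1 \<le> k" "(c, d) \<in> Low k" for k c d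
    using that
  proof (induction rule: inc_induct)
    case base
    then show ?case
      using X Y off[of m c d] new[of m c d] unfolding V_eq new_entries_def
      by (cases "entry_weight c d = l"; cases "(c, d) \<in> Out m") auto
  next
    case (step k)
    then have k: "k \<in> {1..m}" "k \<in> {1..<m}" "k \<noteq> m" by auto
    show ?case
    proof (cases "(c, d) \<in> Out k")
      case True
      then have "X k $$ (c, d) = X (Suc k) $$ (c, d)" "Y k $$ (c, d) = Y (Suc k) $$ (c, d)"
        using X Y k unfolding V_eq by auto
      then show ?thesis using step Out_Low_Suc[OF k(2)] True by auto
    next
      case False
      then show ?thesis
        using off[of k c d] new[of k c d] k step by (auto simp: new_entries_def)
    qed
  qed
  show ?thesis by (subst coset_of_eq_iff) (use * X Y V_carrier in auto)
qed

text \<open>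
The vector dual to a free coordinate \<open>(k\<^sub>0, e\<^sub>0)\<close>.  The chain conditions propagate the value \<open>1\<close> downwards
from \<open>k\<^sub>0\<close>, and the value is set back to \<open>0\<close> at the next smaller component where the coordinate is free
again; this makes the family dual and not merely triangular.
\<close>
definition dual_tuple :: "nat \<times> nat \<times> nat \<Rightarrow> nat \<Rightarrow> complex mat" where
  "dual_tuple = (\<lambda>(k\<^sub>0, e\<^sub>0). \<lambda>k\<in>{1..m}. mat n n (\<lambda>e.
     if e = e\<^sub>0 \<and> k \<le> k\<^sub>0 \<and> (\<forall>k'\<in>{k..<k\<^sub>0}. e\<^sub>0 \<notin> Low k' - Out k') then 1 else 0))"

lemma dual_tuple:
  assumes e: "(k\<^sub>0, c\<^sub>0, d\<^sub>0) \<in> new_entries l"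
  shows "dual_tuple (k\<^sub>0, c\<^sub>0, d\<^sub>0) \<in> V"
    and "\<And>k c d. k \<in> {1..m} \<Longrightarrow> (c, d) \<in> Low k \<Longrightarrow> entry_weight c d \<noteq> l \<Longrightarrow>
      dual_tuple (k\<^sub>0, c\<^sub>0, d\<^sub>0) k $$ (c, d) = 0"
    and "\<And>k c d. (k, c, d) \<in> new_entries l \<Longrightarrow>
      dual_tuple (k\<^sub>0, c\<^sub>0, d\<^sub>0) k $$ (c, d) = (if (k, c, d) = (k\<^sub>0, c\<^sub>0, d\<^sub>0) then 1 else 0)"
proof -
  let ?D = "dual_tuple (k\<^sub>0, c\<^sub>0, d\<^sub>0)"
  let ?P = "\<lambda>k. k \<le> k\<^sub>0 \<and> (\<forall>k'\<in>{k..<k\<^sub>0}. (c\<^sub>0, d\<^sub>0) \<notin> Low k' - Out k')"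
  have k0: "k\<^sub>0 \<in> {1..m}" and e0: "(c\<^sub>0, d\<^sub>0) \<in> Low k\<^sub>0" "(c\<^sub>0, d\<^sub>0) \<notin> Out k\<^sub>0" and r0: "entry_weight c\<^sub>0 d\<^sub>0 = l"
    using e by (auto simp: new_entries_def)
  have D: "?D k $$ (c, d) = (if (c, d) = (c\<^sub>0, d\<^sub>0) \<and> ?P k then 1 else 0)"
    if "k \<in> {1..m}" "c < n" "d < n" for k c d
    using that by (simp add: dual_tuple_def)
  \<comment> \<open>At a position tied to the next component the membership criterion is the same for both.\<close>
  have P_step: "?P k \<longleftrightarrow> ?P (Suc k)" if "k \<noteq> k\<^sub>0" "(c\<^sub>0, d\<^sub>0) \<in> Out k" for k
  proof (cases "k < k\<^sub>0")
    case True
    then have "{k..<k\<^sub>0} = insert k {Suc k..<k\<^sub>0}" by auto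
    then show ?thesis using True that by auto
  qed (use that in auto)
  have Dc: "?D \<in> carrier M" by (auto simp: dual_tuple_def mat_tuples_simps)
  have D_Out: "?D k $$ (c, d) = (if k = m then 0 else ?D (Suc k) $$ (c, d))"
    if k: "k \<in> {1..m}" and cd: "(c, d) \<in> Out k" for k c d
  proof -
    have n: "c < n" "d < n" using k cd Out_Low[OF k] entry_bound[OF k] by auto
    show ?thesis
    proof (cases "(c, d) = (c\<^sub>0, d\<^sub>0)")
      case True
      then have kk: "k \<noteq> k\<^sub>0" using cd e0 by auto
      show ?thesis
      proof (cases "k = m")
        case True then show ?thesis using kk k0 k n by (simp add: D)
      next
        case False
        then have Sk: "Suc k \<in> {1..m}" using k by auto
        have "?P k \<longleftrightarrow> ?P (Suc k)" by (rule P_step[OF kk]) (use cd True in simp)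
        then show ?thesis using False unfolding D[OF k n] D[OF Sk n] by simp
      qed
    next
      case False
      have "?D (Suc k) $$ (c, d) = 0" if "k \<noteq> m"
        using that k n False by (subst D) auto
      moreover have "?D k $$ (c, d) = 0" using k n False by (subst D) auto
      ultimately show ?thesis by simp
    qed
  qed
  show "?D \<in> V" unfolding V_eq using Dc D_Out by auto
  show "?D k $$ (c, d) = 0" if "k \<in> {1..m}" "(c, d) \<in> Low k" "entry_weight c d \<noteq> l" for k c d
    using that r0 entry_bound[OF that(1,2)] by (subst D) auto
  show "?D k $$ (c, d) = (if (k, c, d) = (k\<^sub>0, c\<^sub>0, d\<^sub>0) then 1 else 0)"
    if "(k, c, d) \<in> new_entries l" for k c d
  proof -
    have k: "k \<in> {1..m}" and cd: "(c, d) \<in> Low k" "(c, d) \<notin> Out k"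
      using that by (auto simp: new_entries_def)
    have "?P k \<longleftrightarrow> k = k\<^sub>0" if "(c, d) = (c\<^sub>0, d\<^sub>0)" using that cd by fastforce
    then show ?thesis using entry_bound[OF k cd(1)] k by (subst D) auto
  qed
qed

lemma finite_new_entries: "finite (new_entries l)"
proof (rule finite_subset)
  show "new_entries l \<subseteq> {1..m} \<times> {..<n} \<times> {..<n}"
    using entry_bound by (fastforce simp: new_entries_def)
qed simp

text \<open>
The entries at the new positions are coordinates on the weight space: they are well defined on
cosets, separate them by \<open>new_entries_determine\<close>, and have \<open>dual_tuple\<close> as dual family.
\<close>
theorem weight_multiplicity_eq_card:
  assumes l: "l \<in> weight_lattice n"
  shows "weight_multiplicity n m S x l = card (new_entries l)"
proof -
  let ?A = "{X \<in> V. \<forall>k\<in>{1..m}. \<forall>(c, d)\<in>Low k. entry_weight c d \<noteq> l \<longrightarrow> X k $$ (c, d) = 0}"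
  define \<phi> where "\<phi> A = (\<lambda>(k, c, d). (SOME Y. Y \<in> A) k $$ (c, d))"
    for A :: "(nat \<Rightarrow> complex mat) set"
  let ?U = "T\<lparr>carrier := weight_space n m S x l\<rparr>"
  have C: "carrier ?U = coset_of ` ?A" by (simp add: weight_space_eq[OF l])
  have \<phi>: "\<phi> (coset_of X) (k, c, d) = X k $$ (c, d)"
    if X: "X \<in> carrier M" and k: "k \<in> {1..m}" "(c, d) \<in> Low k" for X k c d
  proof -
    have "X \<in> coset_of X" using X by (simp add: coset_of_def)
    then have "(SOME Y. Y \<in> coset_of X) \<in> coset_of X" by (rule someI[of "\<lambda>Y. Y \<in> coset_of X"])
    then show ?thesis using k unfolding \<phi>_def by (auto simp: coset_of_def)
  qed
  \<comment> \<open>The zero tuple, which represents the zero class.\<close>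
  define N where "N = (\<lambda>k\<in>{1..m}. 0\<^sub>m n n :: complex mat)"
  have N: "N k $$ e = 0" if "k \<in> {1..m}" "e \<in> Low k" for k e
    using entry_bound[OF that] that by (cases e) (simp add: N_def)
  have Nc: "N \<in> carrier M" by (simp add: N_def mat_tuples_simps)
  have zero: "N \<in> ?A" "coset_of N = W"
  proof -
    have "N k $$ e = (if k = m then 0 else N (Suc k) $$ e)" if "k \<in> {1..m}" "e \<in> Out k" for k e
      using V_entry_bound[OF that] that N by simp
    then show "N \<in> ?A" unfolding V_eq using Nc N by auto
    show "coset_of N = W" unfolding coset_of_def W_eq using N by auto
  qed
  have E: "k \<in> {1..m} \<and> (c, d) \<in> Low k" if "(k, c, d) \<in> new_entries l" for k c d
    using that by (auto simp: new_entries_def)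
  have add: "X \<oplus>\<^bsub>M\<^esub> Y \<in> ?A" if "X \<in> ?A" "Y \<in> ?A" for X Y
    using that V_add_closed[of X Y] V_carrier[of X] V_carrier[of Y] by (fastforce simp: entry_add)
  have smult: "a \<odot>\<^bsub>M\<^esub> X \<in> ?A" if "X \<in> ?A" for X a
    using that V_smult_closed[of X a] V_carrier[of X] by (fastforce simp: entry_smult)
  show ?thesis unfolding weight_multiplicity_def
  proof (rule vectorspace_dim_by_coordinates(2)[where b = "\<lambda>e. coset_of (dual_tuple e)" and \<phi> = \<phi>])
    show "finite (new_entries l)" by (rule finite_new_entries)
    have zU: "\<zero>\<^bsub>?U\<^esub> = coset_of N" by (simp add: tangent_space_simps zero)
    show "\<zero>\<^bsub>?U\<^esub> \<in> carrier ?U" unfolding zU C using zero(1) by (rule imageI)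
    show "\<phi> \<zero>\<^bsub>?U\<^esub> e = 0" if "e \<in> new_entries l" for e
    proof -
      obtain k c d where e: "e = (k, c, d)" by (cases e)
      show ?thesis unfolding zU e
        using E that N Nc unfolding e by (simp add: \<phi>)
    qed
    show "A \<oplus>\<^bsub>?U\<^esub> B \<in> carrier ?U" if AB: "A \<in> carrier ?U" "B \<in> carrier ?U" for A B
    proof -
      obtain X Y where "X \<in> ?A" "A = coset_of X" "Y \<in> ?A" "B = coset_of Y" using AB(1,2) unfolding C by blast
      then show ?thesis
        unfolding C using add[of X Y] V_carrier[of X] V_carrier[of Y] by (simp add: tangent_space_simps(3))
    qed
    show "a \<odot>\<^bsub>?U\<^esub> A \<in> carrier ?U" if AB: "A \<in> carrier ?U" for A a
    proof -
      obtain X where "X \<in> ?A" "A = coset_of X" using AB(1) unfolding C by blast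
      then show ?thesis
        unfolding C using smult[of X a] V_carrier[of X] by (simp add: tangent_space_simps(4))
    qed
    show "\<phi> (A \<oplus>\<^bsub>?U\<^esub> B) e = \<phi> A e + \<phi> B e"
      if AB: "A \<in> carrier ?U" "B \<in> carrier ?U" "e \<in> new_entries l" for A B e
    proof -
      obtain X Y where XY: "X \<in> ?A" "A = coset_of X" "Y \<in> ?A" "B = coset_of Y" using AB(1,2) unfolding C by blast
      then have "X \<in> carrier M" "Y \<in> carrier M" using V_carrier by auto
      then show ?thesis using XY AB(3) E
        by (cases e) (auto simp: tangent_space_simps(3) \<phi> carrier_closed entry_simps)
    qed
    show "\<phi> (a \<odot>\<^bsub>?U\<^esub> A) e = a * \<phi> A e"
      if AB: "A \<in> carrier ?U" "e \<in> new_entries l" for A a e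
    proof -
      obtain X where XY: "X \<in> ?A" "A = coset_of X" using AB(1) unfolding C by blast
      then have "X \<in> carrier M" using V_carrier by auto
      then show ?thesis using XY AB(2) E
        by (cases e) (auto simp: tangent_space_simps(4) \<phi> carrier_closed entry_simps)
    qed
    show "A = B" if AB: "A \<in> carrier ?U" "B \<in> carrier ?U" "\<And>e. e \<in> new_entries l \<Longrightarrow> \<phi> A e = \<phi> B e" for A B
    proof -
      obtain X Y where XY: "X \<in> ?A" "A = coset_of X" "Y \<in> ?A" "B = coset_of Y" using AB(1,2) unfolding C by blast
      then have c: "X \<in> carrier M" "Y \<in> carrier M" using V_carrier by auto
      show ?thesis unfolding XY
      proof (rule new_entries_determine)
        show "X k $$ (c, d) = Y k $$ (c, d)" if "(k, c, d) \<in> new_entries l" for k c d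
          using AB(3)[OF that] E[OF that] c XY by (simp add: \<phi>)
      qed (use XY in fastforce)+
    qed
    show "coset_of (dual_tuple e) \<in> carrier ?U" if "e \<in> new_entries l" for e
    proof -
      obtain k c d where e: "e = (k, c, d)" by (cases e)
      show ?thesis unfolding C using dual_tuple(1,2)[of k c d l] that unfolding e by blast
    qed
    show "\<phi> (coset_of (dual_tuple e)) e' = (if e' = e then 1 else 0)"
      if "e \<in> new_entries l" "e' \<in> new_entries l" for e e'
    proof -
      obtain k c d where e: "e = (k, c, d)" by (cases e)
      obtain k' c' d' where e': "e' = (k', c', d')" by (cases e')
      show ?thesis using that E[of k' c' d'] dual_tuple(1)[of k c d l] dual_tuple(3)[of k c d l k' c' d']
        unfolding e e' by (subst \<phi>) (auto simp: V_carrier)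
    qed
  qed
qed

theorem tangent_weights_eq:
  "tangent_weights n m S x = {l \<in> weight_lattice n. new_entries l \<noteq> {}}"
proof -
  have "(\<exists>A\<in>weight_space n m S x l. A \<noteq> \<zero>\<^bsub>T\<^esub>) \<longleftrightarrow> new_entries l \<noteq> {}"
    if l: "l \<in> weight_lattice n" for l
  proof
    assume "\<exists>A\<in>weight_space n m S x l. A \<noteq> \<zero>\<^bsub>T\<^esub>"
    then obtain X where X: "X \<in> V" "coset_of X \<noteq> W"
      "\<forall>k\<in>{1..m}. \<forall>(c, d)\<in>Low k. entry_weight c d \<noteq> l \<longrightarrow> X k $$ (c, d) = 0"
      unfolding weight_space_eq[OF l] tangent_space_simps by auto
    show "new_entries l \<noteq> {}"
    proof
      assume empty: "new_entries l = {}"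
      have Xc: "X \<in> carrier M" by (rule V_carrier[OF X(1)])
      have e0: "(0 \<odot>\<^bsub>M\<^esub> X) k $$ e = 0" if "k \<in> {1..m}" "e \<in> Low k" for k e
        using entry_smult[OF Xc that, of 0] by simp
      have "coset_of X = coset_of (0 \<odot>\<^bsub>M\<^esub> X)"
        by (rule new_entries_determine[where l = l]) (use X empty V_closed e0 in \<open>auto\<close>)
      also have "\<dots> = W" unfolding coset_of_def W_eq using e0 by auto
      finally show False using X(2) by simp
    qed
  next
    assume "new_entries l \<noteq> {}"
    then obtain k c d where e: "(k, c, d) \<in> new_entries l" by auto
    have k: "k \<in> {1..m}" "(c, d) \<in> Low k" using e by (auto simp: new_entries_def)
    have "dual_tuple (k, c, d) \<notin> W"
    proof
      assume "dual_tuple (k, c, d) \<in> W"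
      then have "dual_tuple (k, c, d) k $$ (c, d) = 0" using k unfolding W_eq by blast
      then show False using dual_tuple(3)[OF e e] by simp
    qed
    moreover have "dual_tuple (k, c, d) \<in> coset_of (dual_tuple (k, c, d))"
      using V_carrier dual_tuple(1)[OF e] by (simp add: coset_of_def)
    ultimately have "coset_of (dual_tuple (k, c, d)) \<noteq> \<zero>\<^bsub>T\<^esub>" unfolding tangent_space_simps by auto
    moreover have "coset_of (dual_tuple (k, c, d)) \<in> weight_space n m S x l"
      unfolding weight_space_eq[OF l] using dual_tuple(1,2)[OF e] by blast
    ultimately show "\<exists>A\<in>weight_space n m S x l. A \<noteq> \<zero>\<^bsub>T\<^esub>" by blast
  qed
  then show ?thesis unfolding tangent_weights_def by auto
qed

end

section \<open>Permutation matrices and coordinate flags\<close>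

lemma mat_mult_entry:
  assumes "X \<in> carrier_mat n n" "Y \<in> carrier_mat n n" "a < n" "b < n"
  shows "(X * Y) $$ (a, b) = (\<Sum>i<n. X $$ (a, i) * Y $$ (i, b))"
  using assms by (simp add: times_mat_def scalar_prod_def lessThan_atLeast0)

text \<open>
The matrices that preserve the span of the first \<open>k\<close> unit vectors for each \<open>k\<close> in \<open>K\<close>.  The choice
\<open>K = UNIV\<close> gives the upper triangular matrices, \<open>K = {p}\<close> a block triangular shape, and the complement
of \<open>{j}\<close> a minimal parabolic algebra.
\<close>
definition flag_alg :: "nat \<Rightarrow> nat set \<Rightarrow> complex mat set" where
  "flag_alg n K = {X \<in> carrier_mat n n. \<forall>k\<in>K. \<forall>a b. b < k \<longrightarrow> k \<le> a \<longrightarrow> a < n \<longrightarrow> X $$ (a, b) = 0}"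

text \<open>
In each product of the sum, either the row factor or the column factor is below the \<open>k\<close>-th step.
\<close>
lemma flag_alg_mult:
  assumes X: "X \<in> flag_alg n K" and Y: "Y \<in> flag_alg n K"
  shows "X * Y \<in> flag_alg n K"
proof -
  have c: "X \<in> carrier_mat n n" "Y \<in> carrier_mat n n" using X Y by (auto simp: flag_alg_def)
  have "(X * Y) $$ (a, b) = 0" if k: "k \<in> K" "b < k" "k \<le> a" "a < n" for k a b
  proof -
    have "X $$ (a, i) * Y $$ (i, b) = 0" if "i < n" for i
      using X Y k that by (cases "i < k") (auto simp: flag_alg_def)
    then have "(\<Sum>i<n. X $$ (a, i) * Y $$ (i, b)) = 0" by (intro sum.neutral) auto
    then show ?thesis using k by (subst mat_mult_entry[OF c]) auto
  qed
  then show ?thesis using c by (auto simp: flag_alg_def)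
qed

text \<open>
With diagonal blocks \<open>A\<close> and \<open>D\<close> of \<open>X\<close>, the determinant of \<open>X\<close> is the product of theirs, so \<open>A\<close> is
invertible.  A row \<open>y\<close> of the lower left block of \<open>Y\<close> satisfies \<open>y A = 0\<close> because \<open>Y X = 1\<close>, hence \<open>y = 0\<close>.
\<close>
lemma flag_alg_left_inverse:
  assumes X: "X \<in> flag_alg n K" and Y: "Y \<in> carrier_mat n n" and YX: "Y * X = 1\<^sub>m n"
  shows "Y \<in> flag_alg n K"
proof -
  have Xc: "X \<in> carrier_mat n n" using X by (simp add: flag_alg_def)
  have "Y $$ (a, b) = 0" if k: "k \<in> K" "b < k" "k \<le> a" "a < n" for k a b
  proof -
    define A where "A = mat k k (\<lambda>(i, j). X $$ (i, j))"
    define C where "C = mat k (n - k) (\<lambda>(i, j). X $$ (i, j + k))"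
    define D where "D = mat (n - k) (n - k) (\<lambda>(i, j). X $$ (i + k, j + k))"
    define y where "y = mat 1 k (\<lambda>(i, j). Y $$ (a, j))"
    have Ac: "A \<in> carrier_mat k k" and yc: "y \<in> carrier_mat 1 k" by (simp_all add: A_def y_def)
    have "X = four_block_mat A C (0\<^sub>m (n - k) k) D"
      using X k Xc by (intro eq_matI) (auto simp: A_def C_def D_def flag_alg_def)
    then have "det X = det A * det D"
      using det_four_block_mat_lower_left_zero[of A k C "n - k" _ D] by (simp add: A_def C_def D_def)
    moreover have "det Y * det X = 1" using det_mult[OF Y Xc] YX by simp
    ultimately have "det A \<noteq> 0" by auto
    then obtain A' where A': "A' \<in> carrier_mat k k" "A * A' = 1\<^sub>m k"
      using det_non_zero_imp_unit[OF Ac, of "()"] by (auto simp: Units_def ring_mat_simps)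
    have "(y * A) $$ (0, j) = 0" if j: "j < k" for j
    proof -
      have "(y * A) $$ (0, j) = (\<Sum>i<k. Y $$ (a, i) * X $$ (i, j))"
        using j by (simp add: times_mat_def scalar_prod_def y_def A_def lessThan_atLeast0)
      also have "\<dots> = (\<Sum>i<n. Y $$ (a, i) * X $$ (i, j))"
        using X k j by (intro sum.mono_neutral_left) (auto simp: flag_alg_def)
      also have "\<dots> = (Y * X) $$ (a, j)" using k j by (subst mat_mult_entry[OF Y Xc]) auto
      also have "\<dots> = 0" using k j by (simp add: YX)
      finally show ?thesis .
    qed
    then have "y * A = 0\<^sub>m 1 k" using Ac yc by (intro eq_matI) auto
    then have "y * (A * A') = 0\<^sub>m 1 k"
      unfolding assoc_mult_mat[OF yc Ac A'(1), symmetric] using A' by simp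
    then have "y = 0\<^sub>m 1 k" using yc A' by simp
    then show ?thesis using k by (metis y_def index_mat(1) index_zero_mat(1) less_one prod.simps(2))
  qed
  then show ?thesis using Y by (auto simp: flag_alg_def)
qed

definition parabolic :: "nat \<Rightarrow> nat set \<Rightarrow> complex mat set" where
  "parabolic n K = flag_alg n K \<inter> carrier (GL n)"

lemma subgroup_parabolic: "subgroup (parabolic n K) (GL n)"
proof -
  interpret G: group "GL n" by (rule group_GL)
  show ?thesis
  proof (rule G.subgroupI)
    show "parabolic n K \<subseteq> carrier (GL n)" by (auto simp: parabolic_def)
    have "1\<^sub>m n \<in> parabolic n K" by (auto simp: parabolic_def flag_alg_def GL_carrier)
    then show "parabolic n K \<noteq> {}" by auto
    show "inv\<^bsub>GL n\<^esub> g \<in> parabolic n K" if g: "g \<in> parabolic n K" for g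
    proof -
      have gc: "g \<in> carrier (GL n)" using g by (simp add: parabolic_def)
      have "inv\<^bsub>GL n\<^esub> g * g = 1\<^sub>m n" using G.l_inv[OF gc] by simp
      moreover have "inv\<^bsub>GL n\<^esub> g \<in> carrier (GL n)" using gc by simp
      ultimately show ?thesis
        using flag_alg_left_inverse[of g n K "inv\<^bsub>GL n\<^esub> g"] g
        by (auto simp: parabolic_def GL_carrier)
    qed
    show "g \<otimes>\<^bsub>GL n\<^esub> h \<in> parabolic n K" if "g \<in> parabolic n K" "h \<in> parabolic n K" for g h
      using that flag_alg_mult[of g n K h] G.m_closed[of g h] by (auto simp: parabolic_def)
  qed
qed

lemma parabolic_antimono: "K \<subseteq> L \<Longrightarrow> parabolic n L \<subseteq> parabolic n K"
  by (auto simp: parabolic_def flag_alg_def)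

lemma upper_borel_eq: "upper_borel n = parabolic n UNIV"
  unfolding upper_borel_def parabolic_def flag_alg_def upper_triangular_def
  by (auto simp: GL_carrier)

lemma square_mult_closed: "X \<in> carrier_mat n n \<Longrightarrow> Y \<in> carrier_mat n n \<Longrightarrow> X * Y \<in> carrier_mat n n"
  by (rule mult_carrier_mat)

lemma square_mult_assoc:
  "X \<in> carrier_mat n n \<Longrightarrow> Y \<in> carrier_mat n n \<Longrightarrow> Z \<in> carrier_mat n n \<Longrightarrow>
    X * Y * Z = X * (Y * Z)"
  by (rule assoc_mult_mat)

lemma permutes_index:
  assumes "\<sigma> permutes {1..n}" "a < n"
  shows "\<sigma> (Suc a) - 1 < n" "Suc (\<sigma> (Suc a) - 1) = \<sigma> (Suc a)" "1 \<le> \<sigma> (Suc a)" "\<sigma> (Suc a) \<le> n"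
  using permutes_in_image[OF assms(1), of "Suc a"] assms(2) by auto

lemma mult_perm_mat_entry:
  assumes "\<sigma> permutes {1..n}" "X \<in> carrier_mat n n" "a < n" "b < n"
  shows "(X * perm_mat n \<sigma>) $$ (a, b) = X $$ (a, \<sigma> (Suc b) - 1)"
proof -
  have "(X * perm_mat n \<sigma>) $$ (a, b) = (\<Sum>i<n. X $$ (a, i) * (perm_mat n \<sigma>) $$ (i, b))"
    using assms by (intro mat_mult_entry) (auto simp: perm_mat_def)
  also have "\<dots> = (\<Sum>i<n. if i = \<sigma> (Suc b) - 1 then X $$ (a, i) else 0)"
    using assms permutes_index[OF assms(1,4)] by (intro sum.cong) (auto simp: perm_mat_def)
  finally show ?thesis using permutes_index[OF assms(1,4)] by simp
qed

lemma inv_perm_mat_mult_entry: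
  assumes "\<sigma> permutes {1..n}" "X \<in> carrier_mat n n" "a < n" "b < n"
  shows "(perm_mat n (inv_into UNIV \<sigma>) * X) $$ (a, b) = X $$ (\<sigma> (Suc a) - 1, b)"
proof -
  have *: "Suc a = inv_into UNIV \<sigma> (Suc i) \<longleftrightarrow> i = \<sigma> (Suc a) - 1" for i
  proof -
    have "Suc a = inv_into UNIV \<sigma> (Suc i) \<longleftrightarrow> Suc i = \<sigma> (Suc a)"
      using permutes_inv_eq[OF assms(1), of "Suc i" "Suc a"] by metis
    then show ?thesis using permutes_index(2)[OF assms(1,3)] by linarith
  qed
  have "(perm_mat n (inv_into UNIV \<sigma>) * X) $$ (a, b) =
      (\<Sum>i<n. perm_mat n (inv_into UNIV \<sigma>) $$ (a, i) * X $$ (i, b))"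
    using assms by (intro mat_mult_entry) (auto simp: perm_mat_def)
  also have "\<dots> = (\<Sum>i<n. if i = \<sigma> (Suc a) - 1 then X $$ (i, b) else 0)"
    using assms by (intro sum.cong) (auto simp: perm_mat_def *)
  finally show ?thesis using permutes_index[OF assms(1,3)] by simp
qed

lemma perm_mat_mult:
  assumes "\<tau> permutes {1..n}"
  shows "perm_mat n \<sigma> * perm_mat n \<tau> = perm_mat n (\<sigma> \<circ> \<tau>)"
proof (rule eq_matI)
  fix a b assume "a < dim_row (perm_mat n (\<sigma> \<circ> \<tau>))" "b < dim_col (perm_mat n (\<sigma> \<circ> \<tau>))"
  then have ab: "a < n" "b < n" by (auto simp: perm_mat_def)
  have "(perm_mat n \<sigma> * perm_mat n \<tau>) $$ (a, b) = perm_mat n \<sigma> $$ (a, \<tau> (Suc b) - 1)"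
    by (rule mult_perm_mat_entry[OF assms _ ab]) (simp add: perm_mat_def)
  then show "(perm_mat n \<sigma> * perm_mat n \<tau>) $$ (a, b) = perm_mat n (\<sigma> \<circ> \<tau>) $$ (a, b)"
    using ab permutes_index[OF assms ab(2)] by (simp add: perm_mat_def)
qed (auto simp: perm_mat_def)

lemma perm_mat_carrier [simp]: "perm_mat n \<sigma> \<in> carrier_mat n n"
  by (simp add: perm_mat_def)

lemma perm_mat_id: "perm_mat n id = 1\<^sub>m n"
  by (rule eq_matI) (auto simp: perm_mat_def)

lemma perm_mat_inverse:
  assumes "\<sigma> permutes {1..n}"
  shows "perm_mat n \<sigma> * perm_mat n (inv_into UNIV \<sigma>) = 1\<^sub>m n"
    and "perm_mat n (inv_into UNIV \<sigma>) * perm_mat n \<sigma> = 1\<^sub>m n"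
  using perm_mat_mult[OF permutes_inv[OF assms], of \<sigma>] perm_mat_mult[OF assms, of "inv_into UNIV \<sigma>"]
  by (simp_all add: permutes_inv_o[OF assms] perm_mat_id)

lemma perm_mat_GL:
  assumes "\<sigma> permutes {1..n}"
  shows "perm_mat n \<sigma> \<in> carrier (GL n)"
proof -
  have "det (perm_mat n \<sigma>) * det (perm_mat n (inv_into UNIV \<sigma>)) = 1"
    using det_mult[of "perm_mat n \<sigma>" n "perm_mat n (inv_into UNIV \<sigma>)"]
    by (simp add: perm_mat_inverse[OF assms])
  then show ?thesis by (auto simp: GL_carrier)
qed

lemma perm_mat_parabolic:
  assumes \<sigma>: "\<sigma> permutes {1..n}" and K: "\<And>k i. k \<in> K \<Longrightarrow> i \<in> {1..k} \<Longrightarrow> i \<le> n \<Longrightarrow> \<sigma> i \<le> k"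
  shows "perm_mat n \<sigma> \<in> parabolic n K"
proof -
  have "perm_mat n \<sigma> $$ (a, b) = 0" if k: "k \<in> K" "b < k" "k \<le> a" "a < n" for k a b
    using K[OF k(1), of "Suc b"] k by (auto simp: perm_mat_def)
  then show ?thesis unfolding parabolic_def flag_alg_def using perm_mat_GL[OF \<sigma>] by simp
qed

text \<open>
The positions at which the matrices conjugated from \<open>flag_alg n K\<close> by the permutation matrix of \<open>\<sigma>\<close>
must vanish.
\<close>
definition excluded :: "nat \<Rightarrow> (nat \<Rightarrow> nat) \<Rightarrow> nat set \<Rightarrow> (nat \<times> nat) set" where
  "excluded n \<sigma> K = {(\<sigma> (Suc a) - 1, \<sigma> (Suc b) - 1) | a b. \<exists>k\<in>K. b < k \<and> k \<le> a \<and> a < n}"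

text \<open>
The conjugate $P_\sigma A P_\sigma^{-1}$ of \<open>A = flag_alg n K\<close>, written entrywise so that its linear
equations are visible; \<open>twisted_alg_iff\<close> gives the conjugation form.
\<close>
definition twisted_alg :: "nat \<Rightarrow> (nat \<Rightarrow> nat) \<Rightarrow> nat set \<Rightarrow> complex mat set" where
  "twisted_alg n \<sigma> K = {X \<in> carrier_mat n n. \<forall>e\<in>excluded n \<sigma> K. X $$ e = 0}"

lemma twisted_alg_iff:
  assumes \<sigma>: "\<sigma> permutes {1..n}" and X: "X \<in> carrier_mat n n"
  shows "X \<in> twisted_alg n \<sigma> K \<longleftrightarrow> perm_mat n (inv_into UNIV \<sigma>) * X * perm_mat n \<sigma> \<in> flag_alg n K"
proof -
  have e: "(perm_mat n (inv_into UNIV \<sigma>) * X * perm_mat n \<sigma>) $$ (a, b) = X $$ (\<sigma> (Suc a) - 1, \<sigma> (Suc b) - 1)"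
    if "a < n" "b < n" for a b
    using that permutes_index[OF \<sigma> that(2)]
    by (subst mult_perm_mat_entry[OF \<sigma> mult_carrier_mat[OF perm_mat_carrier X]])
       (auto simp: inv_perm_mat_mult_entry[OF \<sigma> X] simp del: index_mult_mat)
  have "X \<in> twisted_alg n \<sigma> K \<longleftrightarrow> (\<forall>k\<in>K. \<forall>a b. b < k \<longrightarrow> k \<le> a \<longrightarrow> a < n \<longrightarrow> X $$ (\<sigma> (Suc a) - 1, \<sigma> (Suc b) - 1) = 0)"
    using X unfolding twisted_alg_def excluded_def by blast
  also have "\<dots> \<longleftrightarrow> perm_mat n (inv_into UNIV \<sigma>) * X * perm_mat n \<sigma> \<in> flag_alg n K"
    using X e unfolding flag_alg_def
    by (auto simp del: index_mult_mat simp add: mult_carrier_mat[of _ n n _ n])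
  finally show ?thesis .
qed

lemma excluded_off_diagonal:
  assumes \<sigma>: "\<sigma> permutes {1..n}" and "(c, d) \<in> excluded n \<sigma> K"
  shows "c < n" "d < n" "c \<noteq> d"
proof -
  obtain a b where ab: "c = \<sigma> (Suc a) - 1" "d = \<sigma> (Suc b) - 1" "b < a" "a < n"
    using assms(2) unfolding excluded_def by auto
  then have "b < n" by simp
  note p = permutes_index[OF \<sigma> \<open>a < n\<close>] permutes_index[OF \<sigma> \<open>b < n\<close>]
  show "c < n" "d < n" using ab p by auto
  have "\<sigma> (Suc a) \<noteq> \<sigma> (Suc b)" using ab permutes_inj[OF \<sigma>] by (auto dest: injD)
  then show "c \<noteq> d" using ab p by auto
qed

lemma lcoset_eq_iff:
  assumes "group G" "subgroup P G" "g \<in> carrier G" "h \<in> carrier G"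
  shows "g <#\<^bsub>G\<^esub> P = h <#\<^bsub>G\<^esub> P \<longleftrightarrow> (\<exists>r\<in>P. h = g \<otimes>\<^bsub>G\<^esub> r)"
proof -
  interpret group G by fact
  interpret P: subgroup P G by fact
  show ?thesis
  proof
    assume "g <#\<^bsub>G\<^esub> P = h <#\<^bsub>G\<^esub> P"
    moreover have "h = h \<otimes>\<^bsub>G\<^esub> \<one>\<^bsub>G\<^esub>" using assms(4) by simp
    then have "h \<in> h <#\<^bsub>G\<^esub> P" unfolding l_coset_def using P.one_closed by auto
    ultimately show "\<exists>r\<in>P. h = g \<otimes>\<^bsub>G\<^esub> r" unfolding l_coset_def by auto
  next
    assume "\<exists>r\<in>P. h = g \<otimes>\<^bsub>G\<^esub> r"
    then obtain r where r: "r \<in> P" "h = g \<otimes>\<^bsub>G\<^esub> r" by auto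
    show "g <#\<^bsub>G\<^esub> P = h <#\<^bsub>G\<^esub> P"
    proof
      show "h <#\<^bsub>G\<^esub> P \<subseteq> g <#\<^bsub>G\<^esub> P"
        unfolding l_coset_def using r assms(3) by (auto simp: m_assoc)
      show "g <#\<^bsub>G\<^esub> P \<subseteq> h <#\<^bsub>G\<^esub> P"
      proof
        fix y assume "y \<in> g <#\<^bsub>G\<^esub> P"
        then obtain s where s: "s \<in> P" "y = g \<otimes>\<^bsub>G\<^esub> s" unfolding l_coset_def by auto
        moreover have "r \<otimes>\<^bsub>G\<^esub> (inv\<^bsub>G\<^esub> r \<otimes>\<^bsub>G\<^esub> s) = s"
          using r(1) s(1) by (simp add: m_assoc[symmetric])
        ultimately have "y = h \<otimes>\<^bsub>G\<^esub> (inv\<^bsub>G\<^esub> r \<otimes>\<^bsub>G\<^esub> s)"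
          using r assms(3) by (simp add: m_assoc)
        then show "y \<in> h <#\<^bsub>G\<^esub> P" unfolding l_coset_def using r s by blast
      qed
    qed
  qed
qed

text \<open>
The larger subgroup absorbs the smaller one, \<open>(g B) P = g P\<close>, so only cosets of \<open>P\<close> have to be compared.
\<close>
lemma lcoset_parabolic_eq_iff:
  assumes "group G" "subgroup B G" "subgroup P G" "B \<subseteq> P" "g \<in> carrier G" "h \<in> carrier G"
  shows "(g <#\<^bsub>G\<^esub> B) <#>\<^bsub>G\<^esub> P = (h <#\<^bsub>G\<^esub> B) <#>\<^bsub>G\<^esub> P \<longleftrightarrow> (\<exists>r\<in>P. h = g \<otimes>\<^bsub>G\<^esub> r)"
proof -
  interpret group G by fact
  interpret B: subgroup B G by fact
  interpret P: subgroup P G by fact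
  have collapse: "(g <#\<^bsub>G\<^esub> B) <#>\<^bsub>G\<^esub> P = g <#\<^bsub>G\<^esub> P" if g: "g \<in> carrier G" for g
  proof
    show "(g <#\<^bsub>G\<^esub> B) <#>\<^bsub>G\<^esub> P \<subseteq> g <#\<^bsub>G\<^esub> P"
    proof
      fix y assume "y \<in> (g <#\<^bsub>G\<^esub> B) <#>\<^bsub>G\<^esub> P"
      then obtain b r where "b \<in> B" "r \<in> P" "y = g \<otimes>\<^bsub>G\<^esub> b \<otimes>\<^bsub>G\<^esub> r"
        unfolding set_mult_def l_coset_def by auto
      moreover from this have "b \<otimes>\<^bsub>G\<^esub> r \<in> P" using assms(4) by auto
      ultimately show "y \<in> g <#\<^bsub>G\<^esub> P" using g unfolding l_coset_def by (auto simp: m_assoc)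
    qed
    show "g <#\<^bsub>G\<^esub> P \<subseteq> (g <#\<^bsub>G\<^esub> B) <#>\<^bsub>G\<^esub> P"
    proof
      fix y assume "y \<in> g <#\<^bsub>G\<^esub> P"
      then obtain r where "r \<in> P" "y = g \<otimes>\<^bsub>G\<^esub> \<one>\<^bsub>G\<^esub> \<otimes>\<^bsub>G\<^esub> r"
        unfolding l_coset_def using g by auto
      moreover have "g \<otimes>\<^bsub>G\<^esub> \<one>\<^bsub>G\<^esub> \<in> g <#\<^bsub>G\<^esub> B" unfolding l_coset_def using B.one_closed by blast
      ultimately show "y \<in> (g <#\<^bsub>G\<^esub> B) <#>\<^bsub>G\<^esub> P" unfolding set_mult_def by blast
    qed
  qed
  show ?thesis
    unfolding collapse[OF assms(5)] collapse[OF assms(6)] by (rule lcoset_eq_iff[OF assms(1,3,5,6)])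
qed

section \<open>Parabolic subgroups and the closed orbit\<close>

lemma perm_mat_simple_refl_parabolic:
  assumes "1 \<le> j" "j < n"
  shows "perm_mat n (simple_refl j) \<in> parabolic n (- {j})"
  by (rule perm_mat_parabolic[OF simple_refl_permutes[OF assms]])
     (auto simp: simple_refl_def Transposition.transpose_def)

text \<open>
The Bruhat decomposition of the invertible \<open>2\<close> by \<open>2\<close> matrices, embedded at rows and columns \<open>j\<close> and
\<open>j + 1\<close>: a matrix of the block shape that is not upper triangular becomes upper triangular after one
row operation and the exchange of two rows.
\<close>
lemma min_parabolic_eq:
  assumes j: "1 \<le> j" "j < n"
  shows "min_parabolic n j = parabolic n (- {j})"
proof
  let ?s = "perm_mat n (simple_refl j)"
  interpret G: group "GL n" by (rule group_GL)
  interpret P: subgroup "parabolic n (- {j})" "GL n" by (rule subgroup_parabolic)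
  note sP = perm_mat_simple_refl_parabolic[OF j]
  note sp = simple_refl_permutes[OF j]
  have BP: "upper_borel n \<subseteq> parabolic n (- {j})"
    unfolding upper_borel_eq by (rule parabolic_antimono) simp
  show "min_parabolic n j \<subseteq> parabolic n (- {j})"
    using BP sP P.m_closed unfolding min_parabolic_def set_mult_def l_coset_def by fastforce
  show "parabolic n (- {j}) \<subseteq> min_parabolic n j"
  proof
    fix g assume g: "g \<in> parabolic n (- {j})"
    have gc: "g \<in> carrier_mat n n" and gG: "g \<in> carrier (GL n)"
      using g by (auto simp: parabolic_def flag_alg_def)
    have low: "g $$ (a, b) = 0" if "b < a" "a < n" "a = j \<Longrightarrow> b = j - 1 \<Longrightarrow> False" for a b
    proof -
      define k where "k = (if a = j then j - 1 else a)"
      have "k \<in> - {j}" "b < k" "k \<le> a" using that j by (cases "b = j - 1"; auto simp: k_def)+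
      then show ?thesis using g that by (auto simp: parabolic_def flag_alg_def)
    qed
    show "g \<in> min_parabolic n j"
    proof (cases "g $$ (j, j - 1) = 0")
      case True
      then have "g $$ (a, b) = 0" if "b < a" "a < n" for a b using low[OF that] by blast
      then have "g \<in> upper_borel n" using gc gG by (auto simp: upper_borel_def)
      then show ?thesis by (simp add: min_parabolic_def)
    next
      case False
      \<comment> \<open>The row operation that clears the entry above the pivot in row \<open>j\<close>, so that the exchange
        of the two rows leaves no entry below the diagonal.\<close>
      define t where "t = g $$ (j - 1, j - 1) / g $$ (j, j - 1)"
      define E where "E = (\<lambda>t. mat n n (\<lambda>(a, b). if a = b then 1 else if a = j - 1 \<and> b = j then t else (0 :: complex)))"
      have Ec: "E t \<in> carrier_mat n n" for t by (simp add: E_def)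
      have E_mult: "(E t * X) $$ (a, b) = X $$ (a, b) + (if a = j - 1 then t * X $$ (j, b) else 0)"
        if "X \<in> carrier_mat n n" "a < n" "b < n" for t X a b
      proof -
        have "(E t * X) $$ (a, b) = (\<Sum>i<n. E t $$ (a, i) * X $$ (i, b))"
          by (rule mat_mult_entry[OF Ec that])
        also have "\<dots> = (\<Sum>i<n. (if i = a then X $$ (a, b) else 0) +
            (if i = j then (if a = j - 1 then t * X $$ (j, b) else 0) else 0))"
          using that j by (intro sum.cong) (auto simp: E_def)
        finally show ?thesis using that j by (simp add: sum.distrib)
      qed
      have EE: "E t * E (- t) = 1\<^sub>m n"
      proof (rule eq_matI)
        fix a b assume "a < dim_row (1\<^sub>m n :: complex mat)" "b < dim_col (1\<^sub>m n :: complex mat)"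
        then have ab: "a < n" "b < n" by auto
        show "(E t * E (- t)) $$ (a, b) = 1\<^sub>m n $$ (a, b)"
          unfolding E_mult[OF Ec ab] using ab j by (auto simp: E_def)
      qed (use Ec[of t] Ec[of "- t"] in auto)
      have EB: "E t \<in> upper_borel n"
      proof -
        have "det (E t) * det (E (- t)) = 1" using det_mult[OF Ec Ec, of t "- t"] EE by simp
        then have "det (E t) \<noteq> 0" by auto
        moreover have "upper_triangular (E t)" using j by (auto simp: E_def upper_triangular_def)
        ultimately show ?thesis using Ec by (simp add: upper_borel_def GL_carrier)
      qed
      define b where "b = ?s * (E (- t) * g)"
      have bc: "b \<in> carrier_mat n n" using Ec gc by (simp add: b_def square_mult_closed)
      have ss: "?s * ?s = 1\<^sub>m n"
        using perm_mat_mult[OF sp, of "simple_refl j"] by (simp add: simple_refl_involution perm_mat_id)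
      have eq: "E t * (?s * b) = g"
      proof -
        have "?s * b = E (- t) * g"
          using ss square_mult_closed[OF Ec gc] left_mult_one_mat[OF square_mult_closed[OF Ec gc]]
          by (simp add: b_def square_mult_assoc[where n = n, symmetric])
        then have "E t * (?s * b) = (E t * E (- t)) * g"
          using square_mult_assoc[OF Ec Ec gc] by simp
        then show ?thesis using EE gc by simp
      qed
      have "det b \<noteq> 0"
      proof
        assume "det b = 0"
        then have "det g = 0"
          unfolding eq[symmetric] using bc
          by (simp add: det_mult[OF Ec square_mult_closed] det_mult[of _ n])
        then show False using gG by (simp add: GL_carrier)
      qed
      moreover have "b $$ (a, c) = 0" if ac: "c < a" "a < n" for a c
      proof -
        have i: "simple_refl j (Suc a) - 1 < n" using permutes_index[OF sp ac(2)] by simp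
        have "b $$ (a, c) = (E (- t) * g) $$ (simple_refl j (Suc a) - 1, c)"
          using inv_perm_mat_mult_entry[OF sp, of "E (- t) * g" a c] Ec gc ac unfolding b_def inv_simple_refl
          by (simp add: mult_carrier_mat[of _ n n _ n])
        also have "\<dots> = g $$ (simple_refl j (Suc a) - 1, c) +
            (if simple_refl j (Suc a) - 1 = j - 1 then - t * g $$ (j, c) else 0)"
          using E_mult[OF gc i, of c] ac by simp
        also have "\<dots> = 0"
          using ac j low[of c "j - 1"] low[of c j] low[of c a] False
          by (cases "c = j - 1") (auto simp: simple_refl_def Transposition.transpose_def t_def)
        finally show ?thesis .
      qed
      ultimately have "b \<in> upper_borel n" using bc by (auto simp: upper_borel_def GL_carrier)
      then have "E t * (?s * b) \<in> upper_borel n <#>\<^bsub>GL n\<^esub> (?s <#\<^bsub>GL n\<^esub> upper_borel n)"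
        using EB unfolding set_mult_def l_coset_def by auto
      then show ?thesis unfolding eq min_parabolic_def by simp
    qed
  qed
qed

text \<open>
Only the inclusion of the coordinate subspace in the span needs an argument: with \<open>y = g\<^sup>-\<^sup>1 x\<close>, the vector
\<open>x = g y\<close> is a combination of the first \<open>p\<close> columns, because the inverse preserves the same flag and
so \<open>y\<close> has no entries beyond \<open>p\<close>.
\<close>
lemma span_columns_eq:
  assumes g: "g \<in> parabolic n {p}" and p: "p \<le> n"
  shows "flag_space n g p = {x \<in> carrier_vec n. \<forall>a. p \<le> a \<longrightarrow> a < n \<longrightarrow> x $ a = 0}" (is "_ = ?E")
proof -
  interpret V: vec_space "TYPE(complex)" n .
  interpret G: group "GL n" by (rule group_GL)
  have gc: "g \<in> carrier_mat n n" "g \<in> carrier (GL n)" using g by (auto simp: parabolic_def flag_alg_def)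
  have low: "g $$ (a, b) = 0" if "b < p" "p \<le> a" "a < n" for a b
    using g that by (auto simp: parabolic_def flag_alg_def)
  have cols: "col g ` {..<p} \<subseteq> carrier_vec n" using gc by (auto simp: carrier_matD)
  have sub: "col g ` {..<p} \<subseteq> ?E" using gc p low by auto
  have E: "submodule class_ring ?E V.V"
    by (rule V.module_axioms[THEN submodule.intro]) (auto simp: module_vec_def)
  interpret S: submodule class_ring "V.span (col g ` {..<p})" V.V
    by (rule V.span_is_submodule) (use cols in simp)
  show ?thesis unfolding flag_space_def
  proof
    show "V.span (col g ` {..<p}) \<subseteq> ?E" by (rule V.span_is_subset[OF sub E])
    show "?E \<subseteq> V.span (col g ` {..<p})"
    proof
      fix x assume x: "x \<in> ?E"
      define h where "h = inv\<^bsub>GL n\<^esub> g"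
      have h: "h \<in> parabolic n {p}" unfolding h_def using g by (rule subgroup.m_inv_closed[OF subgroup_parabolic])
      have hc: "h \<in> carrier_mat n n" using h by (auto simp: parabolic_def flag_alg_def)
      have gh: "g * h = 1\<^sub>m n" unfolding h_def using G.r_inv[OF gc(2)] by simp
      define y where "y = h *\<^sub>v x"
      have xc: "x \<in> carrier_vec n" and yc: "y \<in> carrier_vec n" using x hc by (auto simp: y_def)
      have gy: "g *\<^sub>v y = x" unfolding y_def using gc hc xc gh by (simp flip: assoc_mult_mat_vec)
      have y0: "y $ i = 0" if "p \<le> i" "i < n" for i
      proof -
        have "y $ i = (\<Sum>l<n. h $$ (i, l) * x $ l)"
          using that hc xc by (simp add: y_def scalar_prod_def lessThan_atLeast0)
        also have "\<dots> = 0"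
        proof (rule sum.neutral, rule ballI)
          fix l assume "l \<in> {..<n}"
          then show "h $$ (i, l) * x $ l = 0"
            using that h x by (cases "l < p") (auto simp: parabolic_def flag_alg_def)
        qed
        finally show ?thesis .
      qed
      have "r \<le> p \<Longrightarrow> vec n (\<lambda>a. \<Sum>l<r. y $ l * g $$ (a, l)) \<in> V.span (col g ` {..<p})" for r
      proof (induction r)
        case 0
        have "vec n (\<lambda>a. 0) = \<zero>\<^bsub>V.V\<^esub>" by (auto simp: module_vec_def)
        then show ?case using S.zero_closed by simp
      next
        case (Suc r)
        have "col g r \<in> V.span (col g ` {..<p})"
          using V.in_own_span[of "col g ` {..<p}"] cols Suc.prems by auto
        then have "vec n (\<lambda>a. \<Sum>l<r. y $ l * g $$ (a, l)) \<oplus>\<^bsub>V.V\<^esub> (y $ r \<odot>\<^bsub>V.V\<^esub> col g r) \<in> V.span (col g ` {..<p})"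
          using Suc by (intro S.m_closed S.smult_closed) auto
        moreover have "vec n (\<lambda>a. \<Sum>l<r. y $ l * g $$ (a, l)) \<oplus>\<^bsub>V.V\<^esub> (y $ r \<odot>\<^bsub>V.V\<^esub> col g r) =
            vec n (\<lambda>a. \<Sum>l<Suc r. y $ l * g $$ (a, l))"
          using gc Suc.prems p by (intro eq_vecI) (auto simp: module_vec_def)
        ultimately show ?case by simp
      qed
      moreover have "x = vec n (\<lambda>a. \<Sum>l<p. y $ l * g $$ (a, l))"
      proof (rule eq_vecI)
        fix a assume "a < dim_vec (vec n (\<lambda>a. \<Sum>l<p. y $ l * g $$ (a, l)))"
        then have a: "a < n" by simp
        have "x $ a = (\<Sum>l<n. g $$ (a, l) * y $ l)"
          using a gc yc unfolding gy[symmetric] by (simp add: scalar_prod_def lessThan_atLeast0)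
        also have "\<dots> = (\<Sum>l<p. g $$ (a, l) * y $ l)"
          using p y0 by (intro sum.mono_neutral_right) auto
        finally show "x $ a = vec n (\<lambda>a. \<Sum>l<p. y $ l * g $$ (a, l)) $ a"
          using a by (simp add: mult.commute)
      qed (use xc in simp)
      ultimately show "x \<in> V.span (col g ` {..<p})" by simp
    qed
  qed
qed

text \<open>
The standard subspace is the span of the first columns of the identity matrix, so both sides are
computed by \<open>span_columns_eq\<close>.
\<close>
lemma flag_space_eq_standard_iff:
  assumes g: "g \<in> carrier (GL n)" and p: "p \<le> n"
  shows "flag_space n g p = complex_span n (unit_vec n ` {..<p}) \<longleftrightarrow> g \<in> parabolic n {p}"
proof -
  interpret V: vec_space "TYPE(complex)" n .
  have gc: "g \<in> carrier_mat n n" using g by (simp add: GL_carrier)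
  have "complex_span n (unit_vec n ` {..<p}) = flag_space n (1\<^sub>m n) p"
    unfolding flag_space_def using p by (intro arg_cong[where f = "complex_span n"] image_cong) auto
  also have "\<dots> = {x \<in> carrier_vec n. \<forall>a. p \<le> a \<longrightarrow> a < n \<longrightarrow> x $ a = 0}"
    by (rule span_columns_eq[OF _ p]) (auto simp: parabolic_def flag_alg_def GL_carrier)
  finally have std: "complex_span n (unit_vec n ` {..<p}) =
    {x \<in> carrier_vec n. \<forall>a. p \<le> a \<longrightarrow> a < n \<longrightarrow> x $ a = 0}" .
  show ?thesis
  proof
    assume eq: "flag_space n g p = complex_span n (unit_vec n ` {..<p})"
    have "col g ` {..<p} \<subseteq> flag_space n g p"
      unfolding flag_space_def using gc by (intro V.in_own_span) (auto simp: carrier_matD)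
    then have *: "col g b $ a = 0" if "b < p" "p \<le> a" "a < n" for a b
      using that unfolding eq std by auto
    have "g $$ (a, b) = 0" if "b < p" "p \<le> a" "a < n" for a b
      using *[OF that] gc that by simp
    then show "g \<in> parabolic n {p}" using g gc by (auto simp: parabolic_def flag_alg_def)
  next
    assume "g \<in> parabolic n {p}"
    then show "flag_space n g p = complex_span n (unit_vec n ` {..<p})"
      unfolding std by (rule span_columns_eq[OF _ p])
  qed
qed

lemma lcoset_closed_orbit_iff:
  assumes g: "g \<in> carrier (GL (p + q))"
  shows "g <#\<^bsub>GL (p + q)\<^esub> upper_borel (p + q) \<in> closed_orbit p q \<longleftrightarrow> g \<in> parabolic (p + q) {p}"
proof -
  let ?n = "p + q"
  interpret G: group "GL ?n" by (rule group_GL)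
  interpret P: subgroup "parabolic ?n {p}" "GL ?n" by (rule subgroup_parabolic)
  have BP: "upper_borel ?n \<subseteq> parabolic ?n {p}" unfolding upper_borel_eq by (rule parabolic_antimono) simp
  have one: "1\<^sub>m ?n \<in> upper_borel ?n" by (auto simp: upper_borel_def GL_carrier)
  have co: "closed_orbit p q = {h <#\<^bsub>GL ?n\<^esub> upper_borel ?n | h. h \<in> parabolic ?n {p}}"
    unfolding closed_orbit_def using flag_space_eq_standard_iff[of _ ?n p] P.mem_carrier
    by (metis (no_types, lifting) le_add1)
  show ?thesis
  proof
    assume "g <#\<^bsub>GL ?n\<^esub> upper_borel ?n \<in> closed_orbit p q"
    then obtain h where h: "h \<in> parabolic ?n {p}" "g <#\<^bsub>GL ?n\<^esub> upper_borel ?n = h <#\<^bsub>GL ?n\<^esub> upper_borel ?n"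
      unfolding co by auto
    have "g * 1\<^sub>m ?n \<in> g <#\<^bsub>GL ?n\<^esub> upper_borel ?n" unfolding l_coset_def using one by auto
    then have "g \<in> h <#\<^bsub>GL ?n\<^esub> upper_borel ?n"
      using h(2) right_mult_one_mat[of g ?n ?n] g by (metis GL_carrier)
    then show "g \<in> parabolic ?n {p}" unfolding l_coset_def using h(1) BP P.m_closed by auto
  qed (auto simp: co)
qed

section \<open>Zariski tangent spaces of parabolic chains\<close>

definition mat_curve :: "nat \<Rightarrow> (complex \<Rightarrow> complex mat) \<Rightarrow> complex mat \<Rightarrow> bool" where
  "mat_curve n A A' \<longleftrightarrow> (\<forall>z. A z \<in> carrier_mat n n) \<and> A 0 = 1\<^sub>m n \<and> A' \<in> carrier_mat n n \<and>
     (\<forall>i<n. \<forall>j<n. ((\<lambda>z. A z $$ (i, j)) has_field_derivative A' $$ (i, j)) (at 0))"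

lemma mat_curve_line: "X \<in> carrier_mat n n \<Longrightarrow> mat_curve n (\<lambda>z. 1\<^sub>m n + z \<cdot>\<^sub>m X) X"
  unfolding mat_curve_def by (auto intro!: derivative_eq_intros)

text \<open>
The product rule at the identity, where the derivative of a product is the sum of the derivatives.
\<close>
lemma mat_curve_mult:
  assumes A: "mat_curve n A A'" and B: "mat_curve n B B'"
  shows "mat_curve n (\<lambda>z. A z * B z) (A' + B')"
proof -
  have c: "A z \<in> carrier_mat n n" "B z \<in> carrier_mat n n" "A' \<in> carrier_mat n n" "B' \<in> carrier_mat n n"
    for z
    using A B by (auto simp: mat_curve_def)
  have one: "A 0 = 1\<^sub>m n" "B 0 = 1\<^sub>m n"
    and dA: "\<And>i j. i < n \<Longrightarrow> j < n \<Longrightarrow> ((\<lambda>z. A z $$ (i, j)) has_field_derivative A' $$ (i, j)) (at 0)"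
    and dB: "\<And>i j. i < n \<Longrightarrow> j < n \<Longrightarrow> ((\<lambda>z. B z $$ (i, j)) has_field_derivative B' $$ (i, j)) (at 0)"
    using A B by (auto simp: mat_curve_def)
  have "((\<lambda>z. (A z * B z) $$ (i, j)) has_field_derivative (A' + B') $$ (i, j)) (at 0)"
    if ij: "i < n" "j < n" for i j
  proof -
    have "((\<lambda>z. \<Sum>l<n. A z $$ (i, l) * B z $$ (l, j)) has_field_derivative
        (\<Sum>l<n. A 0 $$ (i, l) * B' $$ (l, j) + A' $$ (i, l) * B 0 $$ (l, j))) (at 0)"
      by (intro DERIV_sum DERIV_mult' dA dB) (use ij in auto)
    moreover have "(\<Sum>l<n. A 0 $$ (i, l) * B' $$ (l, j) + A' $$ (i, l) * B 0 $$ (l, j)) =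
        (\<Sum>l<n. (if l = i then B' $$ (i, j) else 0) + (if l = j then A' $$ (i, j) else 0))"
      using ij by (intro sum.cong) (auto simp: one)
    ultimately show ?thesis
      using ij c by (simp add: mat_mult_entry[OF c(1,2) ij] sum.distrib add.commute del: index_mult_mat)
  qed
  then show ?thesis using c one by (simp add: mat_curve_def square_mult_closed)
qed

definition tuple_curve :: "nat \<Rightarrow> nat \<Rightarrow> (complex \<Rightarrow> nat \<Rightarrow> complex mat) \<Rightarrow> (nat \<Rightarrow> complex mat) \<Rightarrow> bool" where
  "tuple_curve n m c X \<longleftrightarrow> (\<forall>k\<in>{1..m}. mat_curve n (\<lambda>z. c z k) (X k))"

text \<open>
The derivative of a polynomial function along a curve depends only on the velocity of the curve.  This
is what allows straight lines, used in the definition of the tangent space, to be replaced by curves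
inside the set.
\<close>
lemma poly_fun_along_curve:
  assumes "f \<in> poly_funs n m"
  shows "\<exists>e d. \<forall>c. tuple_curve n m c X \<longrightarrow>
    f (c 0) = e \<and> ((\<lambda>z. f (c z)) has_field_derivative d) (at 0)"
  using assms
proof induction
  case (const a)
  show ?case by (intro exI[of _ a] exI[of _ 0]) simp
next
  case (coord k i j)
  then show ?case
    by (intro exI[of _ "1\<^sub>m n $$ (i, j)"] exI[of _ "X k $$ (i, j)"])
       (simp add: tuple_curve_def mat_curve_def)
next
  case (add f g)
  then obtain ef df eg dg where
    "\<And>c. tuple_curve n m c X \<Longrightarrow> f (c 0) = ef \<and> ((\<lambda>z. f (c z)) has_field_derivative df) (at 0)"
    "\<And>c. tuple_curve n m c X \<Longrightarrow> g (c 0) = eg \<and> ((\<lambda>z. g (c z)) has_field_derivative dg) (at 0)"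
    by blast
  then show ?case
    by (intro exI[of _ "ef + eg"] exI[of _ "df + dg"]) (auto intro!: DERIV_add)
next
  case (mult f g)
  then obtain ef df eg dg where fg:
    "\<And>c. tuple_curve n m c X \<Longrightarrow> f (c 0) = ef \<and> ((\<lambda>z. f (c z)) has_field_derivative df) (at 0)"
    "\<And>c. tuple_curve n m c X \<Longrightarrow> g (c 0) = eg \<and> ((\<lambda>z. g (c z)) has_field_derivative dg) (at 0)"
    by blast
  have "f (c 0) * g (c 0) = ef * eg \<and>
      ((\<lambda>z. f (c z) * g (c z)) has_field_derivative ef * dg + df * eg) (at 0)"
    if "tuple_curve n m c X" for c
  proof -
    from that have e: "f (c 0) = ef" "g (c 0) = eg"
      and d: "((\<lambda>z. f (c z)) has_field_derivative df) (at 0)" "((\<lambda>z. g (c z)) has_field_derivative dg) (at 0)"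
      using fg by blast+
    show ?thesis using DERIV_mult'[OF d] by (simp add: e)
  qed
  then show ?case by blast
qed

lemma poly_funs_sum:
  "(\<And>i. i \<in> I \<Longrightarrow> f i \<in> poly_funs n m) \<Longrightarrow> (\<lambda>X. \<Sum>i\<in>I. f i X) \<in> poly_funs n m"
  by (induction I rule: infinite_finite_induct) (auto intro: poly_funs.intros)

lemma poly_funs_prod:
  "(\<And>i. i \<in> I \<Longrightarrow> f i \<in> poly_funs n m) \<Longrightarrow> (\<lambda>X. \<Prod>i\<in>I. f i X) \<in> poly_funs n m"
  by (induction I rule: infinite_finite_induct) (auto intro: poly_funs.intros)

lemma poly_funs_det:
  assumes "\<And>i j. i < r \<Longrightarrow> j < r \<Longrightarrow> (\<lambda>X. f X i j) \<in> poly_funs n m"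
  shows "(\<lambda>X. det (mat r r (\<lambda>(i, j). f X i j))) \<in> poly_funs n m"
proof -
  have "(\<lambda>X. \<Sum>p\<in>{p. p permutes {0..<r}}. signof p * (\<Prod>i = 0..<r. f X i (p i))) \<in> poly_funs n m"
    using assms by (intro poly_funs_sum poly_funs.mult poly_funs.const poly_funs_prod) auto
  moreover have "det (mat r r (\<lambda>(i, j). f X i j)) =
      (\<Sum>p\<in>{p. p permutes {0..<r}}. signof p * (\<Prod>i = 0..<r. f X i (p i)))" for X
    unfolding det_def by (auto intro!: sum.cong prod.cong)
  ultimately show ?thesis by simp
qed

text \<open>
An entry of the adjugate as an explicit function of the entries of \<open>A\<close>.  The dimension is a parameter
here, whereas \<open>adj_mat\<close> reads it off its argument and so is no polynomial expression on all tuples.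
\<close>
definition adj_entry :: "nat \<Rightarrow> complex mat \<Rightarrow> nat \<Rightarrow> nat \<Rightarrow> complex" where
  "adj_entry n A i j = (-1) ^ (j + i) * det (mat (n - 1) (n - 1) (\<lambda>(a, b).
     A $$ (if a < j then a else Suc a, if b < i then b else Suc b)))"

lemma adj_entry:
  assumes "A \<in> carrier_mat n n" "i < n" "j < n"
  shows "adj_mat A $$ (i, j) = adj_entry n A i j"
  using assms by (simp add: adj_mat_def adj_entry_def cofactor_def mat_delete_def)

lemma poly_funs_adj_entry:
  assumes "k \<in> {1..m}" "i < n" "j < n"
  shows "(\<lambda>X. adj_entry n (X k) i j) \<in> poly_funs n m"
  unfolding adj_entry_def using assms
  by (intro poly_funs.mult poly_funs.const poly_funs_det poly_funs.coord) auto

lemma eventually_GL_along_curve: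
  assumes A: "mat_curve n A A'"
  shows "\<forall>\<^sub>F z in nhds 0. A z \<in> carrier (GL n)"
proof -
  have "(\<lambda>X. det (mat n n (\<lambda>(i, j). X 1 $$ (i, j)))) \<in> poly_funs n 1"
    by (intro poly_funs_det poly_funs.coord) auto
  from poly_fun_along_curve[OF this, of "\<lambda>_. A'"]
  obtain d where "((\<lambda>z. det (mat n n (\<lambda>(i, j). A z $$ (i, j)))) has_field_derivative d) (at 0)"
    using A by (force simp: tuple_curve_def)
  moreover have Ac: "A z \<in> carrier_mat n n" for z using A by (simp add: mat_curve_def)
  then have "mat n n (\<lambda>(i, j). A z $$ (i, j)) = A z" for z
    using carrier_matD[OF Ac] by (intro eq_matI) auto
  ultimately have "isCont (\<lambda>z. det (A z)) 0" by (auto dest: DERIV_isCont)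
  then have "((\<lambda>z. det (A z)) \<longlongrightarrow> det (A 0)) (nhds 0)"
    using tendsto_at_iff_tendsto_nhds[of "\<lambda>z. det (A z)" 0] by (simp add: isCont_def)
  moreover have "det (A 0) \<noteq> 0" using A by (simp add: mat_curve_def)
  ultimately have "\<forall>\<^sub>F z in nhds 0. det (A z) \<noteq> 0" by (rule tendsto_imp_eventually_ne)
  then show ?thesis by eventually_elim (simp add: GL_carrier Ac)
qed

definition line_tuple :: "nat \<Rightarrow> nat \<Rightarrow> (nat \<Rightarrow> complex mat) \<Rightarrow> complex \<Rightarrow> nat \<Rightarrow> complex mat" where
  "line_tuple n m X z = (\<lambda>k\<in>{1..m}. 1\<^sub>m n) \<oplus>\<^bsub>mat_tuples n m\<^esub> (z \<odot>\<^bsub>mat_tuples n m\<^esub> X)"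

lemma line_tuple_apply: "k \<in> {1..m} \<Longrightarrow> line_tuple n m X z k = 1\<^sub>m n + z \<cdot>\<^sub>m X k"
  by (simp add: line_tuple_def mat_tuples_simps)

lemma tuple_curve_line:
  assumes "X \<in> carrier (mat_tuples n m)"
  shows "tuple_curve n m (line_tuple n m X) X"
  unfolding tuple_curve_def
  using mat_curve_line[OF mat_tuples_dims(1)[OF assms]] by (simp add: line_tuple_apply)

lemma line_tuple_deriv:
  assumes "X \<in> carrier (mat_tuples n m)" "k \<in> {1..m}" "i < n" "j < n"
  shows "((\<lambda>z. line_tuple n m X z k $$ (i, j)) has_field_derivative X k $$ (i, j)) (at 0)"
  using tuple_curve_line[OF assms(1)] assms by (simp add: tuple_curve_def mat_curve_def)

text \<open>
A curve that stays in \<open>S\<close> near \<open>0\<close> has a tangent vector as velocity, because a polynomial that vanishes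
on \<open>S\<close> is constant along the curve.
\<close>
lemma zariski_tangentI:
  assumes X: "X \<in> carrier (mat_tuples n m)" and c: "tuple_curve n m c X"
    and S: "\<forall>\<^sub>F z in nhds 0. c z \<in> S"
  shows "X \<in> zariski_tangent n m S (\<lambda>k\<in>{1..m}. 1\<^sub>m n)"
  unfolding zariski_tangent_def
proof (intro CollectI conjI ballI impI X)
  fix f assume f: "f \<in> poly_funs n m" and 0: "\<forall>h\<in>S. f h = 0"
  obtain d where d: "\<And>c. tuple_curve n m c X \<Longrightarrow> ((\<lambda>z. f (c z)) has_field_derivative d) (at 0)"
    using poly_fun_along_curve[OF f, of X] by blast
  have "\<forall>\<^sub>F z in nhds 0. f (c z) = 0" using S by eventually_elim (use 0 in blast)
  then have "((\<lambda>z. f (c z)) has_field_derivative 0) (at 0)"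
    by (subst DERIV_cong_ev[OF refl _ refl, where g = "\<lambda>_. 0"]) auto
  then have "d = 0" using d[OF c] by (rule DERIV_unique[symmetric])
  then show "((\<lambda>z. f ((\<lambda>k\<in>{1..m}. 1\<^sub>m n) \<oplus>\<^bsub>mat_tuples n m\<^esub> z \<odot>\<^bsub>mat_tuples n m\<^esub> X))
      has_field_derivative 0) (at 0)"
    using d[OF tuple_curve_line[OF X]] unfolding line_tuple_def by simp
qed

lemma zariski_tangentD:
  assumes X: "X \<in> zariski_tangent n m S (\<lambda>k\<in>{1..m}. 1\<^sub>m n)"
    and f: "f \<in> poly_funs n m" "\<And>h. h \<in> S \<Longrightarrow> f h = 0"
    and d: "((\<lambda>z. f (line_tuple n m X z)) has_field_derivative d) (at 0)"
  shows "d = 0"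
  using X f d unfolding zariski_tangent_def line_tuple_def by (blast intro: DERIV_unique)

text \<open>
The set is an open part of a linear subspace, so straight lines stay inside it for small parameters.
\<close>
theorem zariski_tangent_stabilizer:
  assumes v: "\<And>k. k \<in> {1..m} \<Longrightarrow> v k permutes {1..n}"
  shows "zariski_tangent n m {h \<in> {1..m} \<rightarrow>\<^sub>E carrier (GL n). \<forall>k\<in>{1..m}. h k \<in> twisted_alg n (v k) (K k)}
      (\<lambda>k\<in>{1..m}. 1\<^sub>m n) =
    {X \<in> carrier (mat_tuples n m). \<forall>k\<in>{1..m}. \<forall>e\<in>excluded n (v k) (K k). X k $$ e = 0}"
    (is "zariski_tangent n m ?S ?one = ?W")
proof
  let ?l = "line_tuple n m"
  show "zariski_tangent n m ?S ?one \<subseteq> ?W"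
  proof
    fix X assume X: "X \<in> zariski_tangent n m ?S ?one"
    have Xc: "X \<in> carrier (mat_tuples n m)" using X by (simp add: zariski_tangent_def)
    have "X k $$ (c, d) = 0" if k: "k \<in> {1..m}" and cd: "(c, d) \<in> excluded n (v k) (K k)" for k c d
    proof (rule zariski_tangentD[OF X])
      note off = excluded_off_diagonal[OF v[OF k] cd]
      show "(\<lambda>h. h k $$ (c, d)) \<in> poly_funs n m" using k off by (intro poly_funs.coord)
      show "h k $$ (c, d) = 0" if "h \<in> ?S" for h using that k cd by (auto simp: twisted_alg_def)
      show "((\<lambda>z. ?l X z k $$ (c, d)) has_field_derivative X k $$ (c, d)) (at 0)"
        using line_tuple_deriv[OF Xc k] off by blast
    qed
    then show "X \<in> ?W" using Xc by auto
  qed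
  show "?W \<subseteq> zariski_tangent n m ?S ?one"
  proof
    fix X assume X: "X \<in> ?W"
    then have Xc: "X \<in> carrier (mat_tuples n m)" by simp
    show "X \<in> zariski_tangent n m ?S ?one"
    proof (rule zariski_tangentI[OF Xc tuple_curve_line[OF Xc]])
      have l: "?l X z k = 1\<^sub>m n + z \<cdot>\<^sub>m X k" if "k \<in> {1..m}" for k z
        using that by (rule line_tuple_apply)
      have pal: "?l X z k \<in> twisted_alg n (v k) (K k)" if k: "k \<in> {1..m}" for k z
      proof -
        have "(1\<^sub>m n + z \<cdot>\<^sub>m X k) $$ e = 0" if e: "e \<in> excluded n (v k) (K k)" for e
          using X k e excluded_off_diagonal[OF v[OF k], of "fst e" "snd e"] mat_tuples_dims[OF Xc k]
          by (cases e) auto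
        then show ?thesis unfolding l[OF k] using mat_tuples_dims[OF Xc k] by (simp add: twisted_alg_def)
      qed
      have "\<forall>k\<in>{1..m}. \<forall>\<^sub>F z in nhds 0. ?l X z k \<in> carrier (GL n)"
        using tuple_curve_line[OF Xc] eventually_GL_along_curve unfolding tuple_curve_def by blast
      then have "\<forall>\<^sub>F z in nhds 0. \<forall>k\<in>{1..m}. ?l X z k \<in> carrier (GL n)"
        by (intro eventually_ball_finite) auto
      then show "\<forall>\<^sub>F z in nhds 0. ?l X z \<in> ?S"
      proof eventually_elim
        case (elim z)
        have "?l X z \<in> extensional {1..m}" by (simp add: line_tuple_def mat_tuples_simps)
        then show ?case using elim pal by (auto simp: PiE_def)
      qed
    qed
  qed
qed

text \<open>
The shape of the preimage of the variety under the orbit map.  Counting the component after the last one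
as the identity puts the condition imposed by the closed orbit on the same footing as those imposed by
the letters of the word.
\<close>
definition chain_preimage :: "nat \<Rightarrow> nat \<Rightarrow> (nat \<Rightarrow> nat \<Rightarrow> nat) \<Rightarrow> (nat \<Rightarrow> nat set) \<Rightarrow> (nat \<Rightarrow> complex mat) set" where
  "chain_preimage n m v K = {h \<in> {1..m} \<rightarrow>\<^sub>E carrier (GL n).
     \<forall>k\<in>{1..m}. \<exists>r\<in>twisted_alg n (v k) (K k). h k = (if k = m then 1\<^sub>m n else h (Suc k)) * r}"

lemma chain_preimageD:
  assumes "h \<in> chain_preimage n m v K" "k \<in> {1..m}"
  shows "h k \<in> carrier_mat n n"
    and "\<exists>r\<in>twisted_alg n (v k) (K k). h k = (if k = m then 1\<^sub>m n else h (Suc k)) * r"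
proof -
  have "h k \<in> carrier (GL n)" using assms unfolding chain_preimage_def by (blast dest: PiE_mem)
  then show "h k \<in> carrier_mat n n" by (simp add: GL_carrier)
  show "\<exists>r\<in>twisted_alg n (v k) (K k). h k = (if k = m then 1\<^sub>m n else h (Suc k)) * r"
    using assms unfolding chain_preimage_def by blast
qed

fun desc_prod :: "(nat \<Rightarrow> complex mat) \<Rightarrow> nat \<Rightarrow> nat \<Rightarrow> complex mat" where
  "desc_prod A m 0 = A m"
| "desc_prod A m (Suc i) = desc_prod A m i * A (m - Suc i)"

text \<open>
For the first inclusion the condition that \<open>h\<^sub>k\<^sub>+\<^sub>1\<^sup>-\<^sup>1 h\<^sub>k\<close> has a vanishing entry is made polynomial by replacing
the inverse by the adjugate.  Along the line with direction \<open>X\<close>, writing \<open>D = X\<^sub>k - X\<^sub>k\<^sub>+\<^sub>1\<close>, one has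
\<open>adj(H) (H + z D) = det(H) + z adj(H) D\<close> for \<open>H = 1 + z X\<^sub>k\<^sub>+\<^sub>1\<close>.  The entry is off the diagonal, so the first
term drops out and the derivative at \<open>0\<close> is the entry of \<open>D\<close>; the adjugate never has to be
differentiated.  For the second inclusion the curve with components
$(1 + z D_m) \cdots (1 + z D_k)$ satisfies the chain conditions as soon as it consists of invertible
matrices.
\<close>
theorem zariski_tangent_chain_preimage:
  assumes v: "\<And>k. k \<in> {1..m} \<Longrightarrow> v k permutes {1..n}"
  shows "zariski_tangent n m (chain_preimage n m v K) (\<lambda>k\<in>{1..m}. 1\<^sub>m n) =
    {X \<in> carrier (mat_tuples n m). \<forall>k\<in>{1..m}. \<forall>e\<in>excluded n (v k) (K k).
       X k $$ e = (if k = m then 0 else X (Suc k) $$ e)}"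
    (is "zariski_tangent n m ?S ?one = ?V")
proof
  let ?l = "line_tuple n m"
  have l: "?l X z k = 1\<^sub>m n + z \<cdot>\<^sub>m X k" if "k \<in> {1..m}" for X k z
    using that by (rule line_tuple_apply)
  show "zariski_tangent n m ?S ?one \<subseteq> ?V"
  proof
    fix X assume X: "X \<in> zariski_tangent n m ?S ?one"
    have Xc: "X \<in> carrier (mat_tuples n m)" using X by (simp add: zariski_tangent_def)
    have "X k $$ (c, d) = (if k = m then 0 else X (Suc k) $$ (c, d))"
      if k: "k \<in> {1..m}" and cd: "(c, d) \<in> excluded n (v k) (K k)" for k c d
    proof -
      note off = excluded_off_diagonal[OF v[OF k] cd]
      show ?thesis
      proof (cases "k = m")
        case True
        have "X k $$ (c, d) = 0"
        proof (rule zariski_tangentD[OF X])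
          show "(\<lambda>h. h k $$ (c, d)) \<in> poly_funs n m" using k off by (intro poly_funs.coord)
          show "h k $$ (c, d) = 0" if h: "h \<in> ?S" for h
          proof -
            obtain r where "r \<in> twisted_alg n (v k) (K k)" "h k = 1\<^sub>m n * r"
              using chain_preimageD(2)[OF h k] True by auto
            then show ?thesis using cd by (auto simp: twisted_alg_def)
          qed
          show "((\<lambda>z. ?l X z k $$ (c, d)) has_field_derivative X k $$ (c, d)) (at 0)"
            using line_tuple_deriv[OF Xc k] off by blast
        qed
        then show ?thesis using True by simp
      next
        case False
        then have Sk: "Suc k \<in> {1..m}" using k by auto
        note Xk = mat_tuples_dims[OF Xc k] and XSk = mat_tuples_dims[OF Xc Sk]
        define D where "D = X k - X (Suc k)"
        have Dc: "D \<in> carrier_mat n n" using Xk XSk by (auto simp: D_def)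
        define g where "g = (\<lambda>h. \<Sum>i<n. adj_entry n (h (Suc k)) c i * D $$ (i, d))"
        have gp: "g \<in> poly_funs n m"
          unfolding g_def using Sk off
          by (intro poly_funs_sum poly_funs.mult poly_funs.const poly_funs_adj_entry) auto
        have "D $$ (c, d) = 0"
        proof (rule zariski_tangentD[OF X])
          let ?f = "\<lambda>h. \<Sum>i<n. adj_entry n (h (Suc k)) c i * h k $$ (i, d)"
          show "?f \<in> poly_funs n m"
            using Sk k off
            by (intro poly_funs_sum poly_funs.mult poly_funs_adj_entry poly_funs.coord) auto
          have f_eq: "?f h = (adj_mat (h (Suc k)) * h k) $$ (c, d)"
            if "h (Suc k) \<in> carrier_mat n n" "h k \<in> carrier_mat n n" for h
            using that off adj_mat(1)[OF that(1)]
            by (subst mat_mult_entry[of _ n]) (auto simp: adj_entry[OF that(1)])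
          show "?f h = 0" if h: "h \<in> ?S" for h
          proof -
            obtain r where r: "r \<in> twisted_alg n (v k) (K k)" "h k = h (Suc k) * r"
              using chain_preimageD(2)[OF h k] False by auto
            have hc: "h (Suc k) \<in> carrier_mat n n" "h k \<in> carrier_mat n n"
              using chain_preimageD(1)[OF h] k Sk by auto
            have rc: "r \<in> carrier_mat n n" using r(1) by (simp add: twisted_alg_def)
            have "?f h = (adj_mat (h (Suc k)) * h k) $$ (c, d)" by (rule f_eq[OF hc])
            also have "\<dots> = (adj_mat (h (Suc k)) * (h (Suc k) * r)) $$ (c, d)" by (simp only: r(2))
            also have "adj_mat (h (Suc k)) * (h (Suc k) * r) = (det (h (Suc k)) \<cdot>\<^sub>m 1\<^sub>m n) * r"
              using square_mult_assoc[OF adj_mat(1)[OF hc(1)] hc(1) rc] adj_mat(3)[OF hc(1)] by simp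
            also have "\<dots> = det (h (Suc k)) \<cdot>\<^sub>m r"
              using rc by (simp add: mult_smult_assoc_mat[of _ n n _ n])
            also have "\<dots> $$ (c, d) = 0" using r(1) rc cd off by (auto simp: twisted_alg_def)
            finally show ?thesis .
          qed
          obtain d' where d': "((\<lambda>z. g (?l X z)) has_field_derivative d') (at 0)"
            using poly_fun_along_curve[OF gp, of X] tuple_curve_line[OF Xc] by blast
          have expand: "?f (?l X z) = z * g (?l X z)" for z
          proof -
            define H where "H = ?l X z (Suc k)"
            have H: "H \<in> carrier_mat n n" "H = 1\<^sub>m n + z \<cdot>\<^sub>m X (Suc k)"
              unfolding H_def l[OF Sk] using XSk by auto
            have lk: "?l X z k = H + z \<cdot>\<^sub>m D"
              unfolding l[OF k] H(2) D_def using Xk XSk by (intro eq_matI) (auto simp: algebra_simps)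
            have "?f (?l X z) = (\<Sum>i<n. adj_entry n H c i * H $$ (i, d)) + z * g (?l X z)"
              unfolding g_def lk H_def[symmetric] using H Dc off
              by (simp add: algebra_simps sum.distrib sum_distrib_left)
            also have "(\<Sum>i<n. adj_entry n H c i * H $$ (i, d)) = (adj_mat H * H) $$ (c, d)"
              using H(1) off adj_mat(1)[OF H(1)]
              by (subst mat_mult_entry[of _ n]) (auto simp: adj_entry[OF H(1)])
            also have "\<dots> = 0" using off adj_mat(3)[OF H(1)] by simp
            finally show ?thesis by simp
          qed
          have l0: "?l X 0 (Suc k) = 1\<^sub>m n" unfolding l[OF Sk] using XSk by (intro eq_matI) auto
          have "g (?l X 0) = (adj_mat (1\<^sub>m n) * D) $$ (c, d)"
            unfolding g_def l0 using Dc off adj_mat(1)[OF one_carrier_mat]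
            by (subst mat_mult_entry[of _ n]) (auto simp: adj_entry[OF one_carrier_mat])
          also have "adj_mat (1\<^sub>m n :: complex mat) = 1\<^sub>m n"
            using adj_mat(1,2)[OF one_carrier_mat[of n, where 'a = complex]]
              left_mult_one_mat[of "adj_mat (1\<^sub>m n :: complex mat)" n n] by (auto intro!: eq_matI)
          finally have g0: "g (?l X 0) = D $$ (c, d)" using Dc by simp
          have "((\<lambda>z. z * g (?l X z)) has_field_derivative 0 * d' + 1 * g (?l X 0)) (at 0)"
            by (intro DERIV_mult' DERIV_ident d')
          then show "((\<lambda>z. ?f (?l X z)) has_field_derivative D $$ (c, d)) (at 0)"
            unfolding expand g0 by simp
        qed
        then show ?thesis using False Xk XSk off by (simp add: D_def)
      qed
    qed
    then show "X \<in> ?V" using Xc by auto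
  qed
  show "?V \<subseteq> zariski_tangent n m ?S ?one"
  proof
    fix X assume X: "X \<in> ?V"
    then have Xc: "X \<in> carrier (mat_tuples n m)" by simp
    define D where "D = (\<lambda>k. if k = m then X m else X k - X (Suc k))"
    have Dc: "D k \<in> carrier_mat n n" if "k \<in> {1..m}" for k
      using mat_tuples_dims[OF Xc] that by (auto simp: D_def)
    \<comment> \<open>The factors of the curve; each lies in the algebra of its step for every \<open>z\<close>.\<close>
    define A where "A = (\<lambda>z k. 1\<^sub>m n + z \<cdot>\<^sub>m D k)"
    have A: "mat_curve n (\<lambda>z. A z k) (D k)" if "k \<in> {1..m}" for k
      unfolding A_def by (rule mat_curve_line[OF Dc[OF that]])
    have Ap: "A z k \<in> twisted_alg n (v k) (K k)" if k: "k \<in> {1..m}" for z k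
    proof -
      have "A z k $$ (c, d) = 0" if e: "(c, d) \<in> excluded n (v k) (K k)" for c d
      proof -
        have "D k $$ (c, d) = 0"
          using X k e excluded_off_diagonal[OF v[OF k] e] mat_tuples_dims[OF Xc, of "Suc k"]
          by (auto simp: D_def)
        then show ?thesis
          using excluded_off_diagonal[OF v[OF k] e] Dc[OF k] by (simp add: A_def)
      qed
      then show ?thesis using Dc[OF k] by (auto simp: twisted_alg_def A_def)
    qed
    define c where "c = (\<lambda>z. \<lambda>k\<in>{1..m}. desc_prod (A z) m (m - k))"
    have curve: "i < m \<Longrightarrow> mat_curve n (\<lambda>z. desc_prod (A z) m i) (X (m - i))" for i
    proof (induction i)
      case 0
      then show ?case using A[of m] by (simp add: D_def)
    next
      case (Suc i)
      then have k: "m - Suc i \<in> {1..m}" and s: "Suc (m - Suc i) = m - i" by auto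
      have i: "m - i \<in> {1..m}" using Suc.prems by auto
      have "X (m - i) + D (m - Suc i) = X (m - Suc i)"
        using Suc.prems mat_tuples_dims[OF Xc i] mat_tuples_dims[OF Xc k]
        by (intro eq_matI) (auto simp: D_def s)
      then show ?case using mat_curve_mult[OF Suc.IH A[OF k]] Suc.prems by simp
    qed
    have cc: "tuple_curve n m c X"
      unfolding tuple_curve_def
    proof
      fix k assume k: "k \<in> {1..m}"
      then show "mat_curve n (\<lambda>z. c z k) (X k)" using curve[of "m - k"] by (simp add: c_def)
    qed
    show "X \<in> zariski_tangent n m ?S ?one"
    proof (rule zariski_tangentI[OF Xc cc])
      have "\<forall>k\<in>{1..m}. \<forall>\<^sub>F z in nhds 0. c z k \<in> carrier (GL n)"
        using cc eventually_GL_along_curve unfolding tuple_curve_def by blast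
      then have "\<forall>\<^sub>F z in nhds 0. \<forall>k\<in>{1..m}. c z k \<in> carrier (GL n)"
        by (intro eventually_ball_finite) auto
      then show "\<forall>\<^sub>F z in nhds 0. c z \<in> ?S"
      proof eventually_elim
        case (elim z)
        have "c z k = (if k = m then 1\<^sub>m n else c z (Suc k)) * A z k" if k: "k \<in> {1..m}" for k
        proof (cases "k = m")
          case True
          then show ?thesis
            using k Ap[OF k, of z] left_mult_one_mat[of "A z m" n n] by (simp add: c_def twisted_alg_def)
        next
          case False
          then have "m - k = Suc (m - Suc k)" "m - Suc (m - Suc k) = k" "Suc k \<in> {1..m}" using k by auto
          then show ?thesis using k False by (simp add: c_def)
        qed
        then have "\<forall>k\<in>{1..m}. \<exists>r\<in>twisted_alg n (v k) (K k). c z k = (if k = m then 1\<^sub>m n else c z (Suc k)) * r"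
          using Ap by blast
        moreover have "c z \<in> extensional {1..m}" by (simp add: c_def)
        ultimately show ?case using elim unfolding chain_preimage_def PiE_iff by blast
      qed
    qed
  qed
qed

section \<open>Inversions and reduced words\<close>

text \<open>
The pair \<open>(a, b)\<close> stands for the positive root $e_a - e_b$; it is an inversion of \<open>w\<close> if \<open>w\<^sup>-\<^sup>1\<close> makes this
root negative.
\<close>
definition inversions :: "(nat \<Rightarrow> nat) \<Rightarrow> (nat \<times> nat) set" where
  "inversions w = {(a, b). a < b \<and> inv_into UNIV w b < inv_into UNIV w a}"

lemma simple_refl_less:
  "a < b \<Longrightarrow> (a, b) \<noteq> (i, Suc i) \<Longrightarrow> simple_refl i a < simple_refl i b"
  by (auto simp: simple_refl_def Transposition.transpose_def)

text \<open>
A simple reflection permutes the positive roots other than its own simple root, so composing with it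
transports the inversions and adds or removes that simple root.
\<close>
lemma inversions_simple_refl_comp:
  assumes w: "bij w" and i: "(i, Suc i) \<notin> inversions w"
  shows "inversions (simple_refl i \<circ> w) =
      insert (i, Suc i) (map_prod (simple_refl i) (simple_refl i) ` inversions w)"
    and "(i, Suc i) \<notin> map_prod (simple_refl i) (simple_refl i) ` inversions w"
proof -
  let ?s = "simple_refl i" and ?v = "inv_into UNIV w"
  note inv = inv_simple_refl_comp[OF w, of i]
  have si: "?s i = Suc i" "?s (Suc i) = i" by (auto simp: simple_refl_def)
  have lt: "?v i < ?v (Suc i)"
  proof -
    have "?v i \<noteq> ?v (Suc i)"
      using bij_is_inj[OF bij_imp_bij_inv[OF w]] by (metis injD n_not_Suc_n)
    then show ?thesis using i by (simp add: inversions_def)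
  qed
  have iff: "(a, b) \<in> inversions (?s \<circ> w) \<longleftrightarrow> (?s a, ?s b) \<in> inversions w"
    if "(a, b) \<noteq> (i, Suc i)" "(a, b) \<noteq> (Suc i, i)" for a b
  proof -
    have "a < b \<longleftrightarrow> ?s a < ?s b"
    proof
      assume "?s a < ?s b"
      moreover have "(?s a, ?s b) \<noteq> (i, Suc i)"
        using that(2) by (metis prod.inject si simple_refl_twice)
      ultimately have "?s (?s a) < ?s (?s b)" by (rule simple_refl_less)
      then show "a < b" by (simp add: simple_refl_twice)
    qed (use that(1) simple_refl_less in blast)
    then show ?thesis by (simp add: inversions_def inv)
  qed
  have mem: "(a, b) \<in> map_prod ?s ?s ` A \<longleftrightarrow> (?s a, ?s b) \<in> A" for a b A
    by (force simp: simple_refl_twice image_iff)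
  show not: "(i, Suc i) \<notin> map_prod ?s ?s ` inversions w"
    unfolding mem si by (simp add: inversions_def)
  show "inversions (?s \<circ> w) = insert (i, Suc i) (map_prod ?s ?s ` inversions w)"
  proof -
    have "(a, b) \<in> inversions (?s \<circ> w) \<longleftrightarrow>
        (a, b) \<in> insert (i, Suc i) (map_prod ?s ?s ` inversions w)" for a b
    proof -
      consider "(a, b) = (i, Suc i)" | "(a, b) = (Suc i, i)" | "(a, b) \<noteq> (i, Suc i)" "(a, b) \<noteq> (Suc i, i)" by blast
      then show "(a, b) \<in> inversions (?s \<circ> w) \<longleftrightarrow>
          (a, b) \<in> insert (i, Suc i) (map_prod ?s ?s ` inversions w)"
      proof cases
        case 1
        then show ?thesis using lt by (simp add: inversions_def inv si)
      next
        case 2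
        then have "(?s a, ?s b) = (i, Suc i)" by (simp add: si)
        then show ?thesis using 2 i by (simp add: mem) (simp add: inversions_def)
      next
        case 3
        then show ?thesis using iff[OF 3] by (auto simp: mem)
      qed
    qed
    then show ?thesis by (intro equalityI subrelI) blast+
  qed
qed

lemma finite_inversions:
  assumes w: "w permutes {1..n}"
  shows "finite (inversions w)"
proof (rule finite_subset)
  have v: "inv_into UNIV w permutes {1..n}" by (rule permutes_inv[OF w])
  have "a \<in> {1..n} \<and> b \<in> {1..n}" if "(a, b) \<in> inversions w" for a b
  proof -
    have ab: "a < b" "inv_into UNIV w b < inv_into UNIV w a" using that by (auto simp: inversions_def)
    show ?thesis
      using ab permutes_in_image[OF v, of a] permutes_in_image[OF v, of b]
        permutes_not_in[OF v, of a] permutes_not_in[OF v, of b]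
      by (cases "a \<in> {1..n}"; cases "b \<in> {1..n}") auto
  qed
  then show "inversions w \<subseteq> {1..n} \<times> {1..n}" by auto
qed simp

lemma card_inversions_simple_refl_comp:
  assumes w: "w permutes {1..n}" and i: "(i, Suc i) \<notin> inversions w"
  shows "card (inversions (simple_refl i \<circ> w)) = Suc (card (inversions w))"
proof -
  have "inj (map_prod (simple_refl i) (simple_refl i))"
    using bij_is_inj[OF simple_refl_bij] by (simp add: prod.inj_map)
  then show ?thesis
    using inversions_simple_refl_comp(1)[OF permutes_bij[OF w] i] inversions_simple_refl_comp(2)[OF permutes_bij[OF w] i] finite_inversions[OF w]
    by (simp add: card_image inj_on_subset)
qed

lemma word_prod_Nil: "word_prod [] = id"
  by (simp add: word_prod_def)

lemma inversions_id: "inversions id = {}"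
proof -
  have "inv_into UNIV id = (id :: nat \<Rightarrow> nat)" by (rule inv_unique_comp) simp_all
  then show ?thesis unfolding inversions_def by simp
qed

lemma inversions_word_prod_Nil: "inversions (word_prod []) = {}"
  unfolding word_prod_Nil by (rule inversions_id)

lemma word_prod_Cons: "word_prod (i # ws) = simple_refl i \<circ> word_prod ws"
  by (simp add: word_prod_def)

lemma word_prod_permutes: "set ws \<subseteq> {1..n - 1} \<Longrightarrow> word_prod ws permutes {1..n}"
proof (induction ws)
  case Nil
  show ?case unfolding word_prod_Nil by (rule permutes_id)
next
  case (Cons i ws)
  then show ?case
    unfolding word_prod_Cons by (intro permutes_compose simple_refl_permutes) auto
qed

lemma descent_simple_refl_comp:
  assumes "bij w" "(i, Suc i) \<in> inversions w"
  shows "(i, Suc i) \<notin> inversions (simple_refl i \<circ> w)"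
proof
  assume "(i, Suc i) \<in> inversions (simple_refl i \<circ> w)"
  then show False
    using assms(2) inv_simple_refl_comp[OF assms(1), of i] by (simp add: inversions_def) (simp add: simple_refl_def)
qed

lemma card_inversions_le_length:
  "set ws \<subseteq> {1..n - 1} \<Longrightarrow> card (inversions (word_prod ws)) \<le> length ws"
proof (induction ws)
  case Nil
  then show ?case by (simp add: inversions_word_prod_Nil)
next
  case (Cons i ws)
  have p: "word_prod ws permutes {1..n}" "word_prod (i # ws) permutes {1..n}"
    by (rule word_prod_permutes, use Cons.prems in simp)+
  show ?case
  proof (cases "(i, Suc i) \<in> inversions (word_prod ws)")
    case False
    then show ?thesis
      using card_inversions_simple_refl_comp[OF p(1) False, folded word_prod_Cons] Cons by simp
  next
    case True
    then have "(i, Suc i) \<notin> inversions (word_prod (i # ws))"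
      unfolding word_prod_Cons using permutes_bij[OF p(1)] by (intro descent_simple_refl_comp)
    from card_inversions_simple_refl_comp[OF p(2) this]
    show ?thesis
      using Cons by (simp add: word_prod_Cons[unfolded comp_def] simple_refl_comp_cancel[unfolded comp_def] comp_def)
  qed
qed

text \<open>
Without descents the inverse of \<open>w\<close> is increasing on all natural numbers, and an increasing bijection of
the natural numbers is the identity.
\<close>
lemma permutes_without_descent:
  assumes w: "w permutes {1..n}" and d: "\<And>i. i \<in> {1..n - 1} \<Longrightarrow> (i, Suc i) \<notin> inversions w"
  shows "w = id"
proof -
  let ?v = "inv_into UNIV w"
  have v: "?v permutes {1..n}" by (rule permutes_inv[OF w])
  have "?v i < ?v (Suc i)" for i
  proof (cases "i \<in> {1..n - 1}")
    case True
    have "?v i \<noteq> ?v (Suc i)" using permutes_inj[OF v] by (metis injD n_not_Suc_n)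
    then show ?thesis using d[OF True] by (auto simp: inversions_def)
  next
    case False
    then show ?thesis
      using permutes_in_image[OF v, of i] permutes_in_image[OF v, of "Suc i"]
        permutes_not_in[OF v, of i] permutes_not_in[OF v, of "Suc i"]
      by (cases "i \<in> {1..n}"; cases "Suc i \<in> {1..n}") auto
  qed
  then have mono: "strict_mono ?v" by (simp add: strict_mono_Suc_iff)
  have "?v x = x" for x
  proof (induction x rule: less_induct)
    case (less x)
    obtain y where y: "x = ?v y" using permutes_surj[OF v] by (metis surjD)
    have "y \<le> x" "x \<le> ?v x" using strict_mono_imp_increasing[OF mono] unfolding y by auto
    then show ?case using less.IH[of y] y by (cases "y < x") auto
  qed
  then show "w = id" using w by (metis eq_id_iff permutes_inverses(1))
qed

text \<open>
Removing a descent lowers the number of inversions by one; the process stops at the identity.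
\<close>
lemma word_of_length_card_inversions:
  "w permutes {1..n} \<Longrightarrow> \<exists>ws. set ws \<subseteq> {1..n - 1} \<and> word_prod ws = w \<and> length ws = card (inversions w)"
proof (induction "card (inversions w)" arbitrary: w rule: less_induct)
  case less
  show ?case
  proof (cases "\<exists>i\<in>{1..n - 1}. (i, Suc i) \<in> inversions w")
    case False
    then have "w = id" using permutes_without_descent[OF less.prems] by blast
    then show ?thesis
      by (intro exI[of _ "[]"]) (auto simp: inversions_id word_prod_Nil)
  next
    case True
    then obtain i where i: "i \<in> {1..n - 1}" "(i, Suc i) \<in> inversions w" by blast
    have p: "simple_refl i \<circ> w permutes {1..n}"
      using i(1) by (intro permutes_compose[OF less.prems] simple_refl_permutes) auto
    have c: "card (inversions w) = Suc (card (inversions (simple_refl i \<circ> w)))"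
      using card_inversions_simple_refl_comp[OF p descent_simple_refl_comp[OF permutes_bij[OF less.prems] i(2)]]
      unfolding simple_refl_comp_cancel .
    then obtain ws where "set ws \<subseteq> {1..n - 1}" "word_prod ws = simple_refl i \<circ> w"
      "length ws = card (inversions (simple_refl i \<circ> w))"
      using less.hyps[OF _ p] by auto
    then show ?thesis
      using i c
      by (intro exI[of _ "i # ws"]) (auto simp: word_prod_Cons fun_eq_iff simple_refl_twice)
  qed
qed

text \<open>
Each letter changes the number of inversions by one.  For a word as short as possible every letter must
raise it, so at each step the simple root of the letter is added to the transported inversions, which
is how the list of roots of a word is built.
\<close>
lemma inversions_of_shortest_word:
  assumes "set ws \<subseteq> {1..n - 1}" "length ws = card (inversions (word_prod ws))"
  shows "inversions (word_prod ws) =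
    {(word_prod (take k ws) (ws ! k), word_prod (take k ws) (Suc (ws ! k))) | k. k < length ws}"
  using assms
proof (induction ws)
  case Nil
  then show ?case by (simp add: inversions_word_prod_Nil)
next
  case (Cons i ws)
  let ?R = "\<lambda>ws. {(word_prod (take k ws) (ws ! k), word_prod (take k ws) (Suc (ws ! k))) | k. k < length ws}"
  have p: "word_prod ws permutes {1..n}" "word_prod (i # ws) permutes {1..n}"
    by (rule word_prod_permutes, use Cons.prems in simp)+
  have le: "card (inversions (word_prod ws)) \<le> length ws"
    using Cons.prems by (intro card_inversions_le_length) auto
  have ni: "(i, Suc i) \<notin> inversions (word_prod ws)"
  proof
    assume "(i, Suc i) \<in> inversions (word_prod ws)"
    then have "(i, Suc i) \<notin> inversions (word_prod (i # ws))"
      unfolding word_prod_Cons using permutes_bij[OF p(1)] by (intro descent_simple_refl_comp)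
    from card_inversions_simple_refl_comp[OF p(2) this]
    show False using Cons.prems le
      by (simp add: word_prod_Cons simple_refl_comp_cancel[unfolded comp_def] comp_def)
  qed
  have "length ws = card (inversions (word_prod ws))"
    using card_inversions_simple_refl_comp[OF p(1) ni] Cons.prems
    by (simp add: word_prod_Cons comp_def)
  then have IH: "inversions (word_prod ws) = ?R ws" using Cons by simp
  have "?R (i # ws) = insert (i, Suc i) (map_prod (simple_refl i) (simple_refl i) ` ?R ws)"
  proof -
    have "?R (i # ws) = (\<lambda>k. (word_prod (take k (i # ws)) ((i # ws) ! k),
        word_prod (take k (i # ws)) (Suc ((i # ws) ! k)))) ` {..<Suc (length ws)}"
      by auto
    also have "\<dots> = insert (i, Suc i) (map_prod (simple_refl i) (simple_refl i) ` ?R ws)"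
      unfolding lessThan_Suc_eq_insert_0
      by (auto simp: image_image image_def word_prod_Cons) (auto simp: word_prod_def)
    finally show ?thesis .
  qed
  then show ?case
    unfolding word_prod_Cons inversions_simple_refl_comp(1)[OF permutes_bij[OF p(1)] ni] IH by simp
qed

text \<open>
By the bounds in both directions, the length of a reduced word is the number of inversions, whichever
reduced word is chosen.
\<close>
theorem inv_roots_eq_inversions:
  assumes w: "w permutes {1..n}"
  shows "inv_roots n w = (\<lambda>(a, b). root_diff a b) ` inversions w"
proof -
  define ws where "ws = (SOME ws. reduced_expression n w ws)"
  obtain ws' where ws': "set ws' \<subseteq> {1..n - 1}" "word_prod ws' = w" "length ws' = card (inversions w)"
    using word_of_length_card_inversions[OF w] by blast
  then have "reduced_expression n w ws'"
    unfolding reduced_expression_def by (metis card_inversions_le_length)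
  then have red: "reduced_expression n w ws" unfolding ws_def by (rule someI)
  then have ws: "set ws \<subseteq> {1..n - 1}" "word_prod ws = w" by (auto simp: reduced_expression_def)
  have "length ws \<le> length ws'" using red ws' unfolding reduced_expression_def by auto
  then have "length ws = card (inversions (word_prod ws))"
    using card_inversions_le_length[OF ws(1)] ws(2) ws'(3) by simp
  from inversions_of_shortest_word[OF ws(1) this] ws(2)
  have inv: "inversions w =
    {(word_prod (take k ws) (ws ! k), word_prod (take k ws) (Suc (ws ! k))) | k. k < length ws}" by simp
  have "bij (word_prod (take k ws))" for k
    using word_prod_permutes[of "take k ws" n] ws(1) set_take_subset[of k ws] by (meson permutes_bij subset_trans)
  then have "inv_roots n w = {root_diff (word_prod (take k ws) (ws ! k)) (word_prod (take k ws) (Suc (ws ! k))) | k. k < length ws}"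
    unfolding inv_roots_def Let_def ws_def[symmetric] by (simp add: simple_root_eq perm_act_root_diff)
  then show ?thesis unfolding inv by auto
qed

lemma block_reversal:
  assumes w: "w = one_line (rev [1..<p + 1] @ rev [p + 1..<p + q + 1])"
  shows "w permutes {1..p + q}"
    and "inversions w = {(a, b). 1 \<le> a \<and> a < b \<and> b \<le> p + q \<and> (b \<le> p \<or> p < a)}"
proof -
  have w_eq: "w i = (if 1 \<le> i \<and> i \<le> p then p + 1 - i else if p < i \<and> i \<le> p + q then 2 * p + q + 1 - i else i)" for i
    unfolding w one_line_def by (auto simp: nth_append rev_nth simp del: upt_Suc)
  have ww: "w (w i) = i" for i unfolding w_eq by auto
  have inv: "inv_into UNIV w = w" by (rule inv_unique_comp) (auto simp: ww)
  have "bij w" by (rule involuntory_imp_bij) (rule ww)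
  then show "w permutes {1..p + q}"
    unfolding permutes_def bij_iff by (auto simp: w_eq)
  show "inversions w = {(a, b). 1 \<le> a \<and> a < b \<and> b \<le> p + q \<and> (b \<le> p \<or> p < a)}"
  proof -
    have "a < b \<and> w b < w a \<longleftrightarrow> 1 \<le> a \<and> a < b \<and> b \<le> p + q \<and> (b \<le> p \<or> p < a)" for a b
      by (cases "1 \<le> a"; cases "a \<le> p"; cases "b \<le> p"; cases "b \<le> p + q") (simp add: w_eq; linarith)+
    then show ?thesis unfolding inversions_def inv by simp
  qed
qed

section \<open>The variety at a torus-fixed point\<close>

text \<open>
A form of the conjugation that is free of inverses, convenient for moving permutation matrices past
group elements.
\<close>
lemma twisted_alg_conj_iff:
  assumes \<sigma>: "\<sigma> permutes {1..n}" and X: "X \<in> carrier_mat n n"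
  shows "X \<in> twisted_alg n \<sigma> K \<longleftrightarrow> (\<exists>Y\<in>flag_alg n K. X * perm_mat n \<sigma> = perm_mat n \<sigma> * Y)"
proof
  let ?P = "perm_mat n \<sigma>" and ?P' = "perm_mat n (inv_into UNIV \<sigma>)"
  note PP = perm_mat_inverse[OF \<sigma>]
  note c = perm_mat_carrier[of n \<sigma>] perm_mat_carrier[of n "inv_into UNIV \<sigma>"]
  {
    assume "X \<in> twisted_alg n \<sigma> K"
    then have "?P' * X * ?P \<in> flag_alg n K" by (simp add: twisted_alg_iff[OF \<sigma> X])
    moreover have "?P * (?P' * X * ?P) = X * ?P"
    proof -
      have "?P * (?P' * X * ?P) = (?P * ?P') * X * ?P"
        using X c by (simp add: square_mult_assoc[where n = n] square_mult_closed)
      then show ?thesis using X by (simp add: PP)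
    qed
    ultimately show "\<exists>Y\<in>flag_alg n K. X * ?P = ?P * Y" by metis
  next
    assume "\<exists>Y\<in>flag_alg n K. X * ?P = ?P * Y"
    then obtain Y where Y: "Y \<in> flag_alg n K" "X * ?P = ?P * Y" by blast
    have Yc: "Y \<in> carrier_mat n n" using Y(1) by (simp add: flag_alg_def)
    have "?P' * X * ?P = ?P' * (?P * Y)" using square_mult_assoc[OF c(2) X c(1)] Y(2) by simp
    also have "\<dots> = Y" using square_mult_assoc[OF c(2) c(1) Yc] Yc by (simp add: PP)
    finally show "X \<in> twisted_alg n \<sigma> K" using Y(1) by (simp add: twisted_alg_iff[OF \<sigma> X])
  }
qed

text \<open>
The data of the fixed point.  Below, \<open>v k\<close> is the permutation of its \<open>k\<close>-th component and \<open>K k\<close> the set of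
flag steps preserved by the \<open>k\<close>-th parabolic: all steps but one for a letter of the word, and only the
\<open>p\<close>-th step for the closed orbit at the top.
\<close>
locale bem_fixed_point =
  fixes p q n :: nat and Q :: "nat list" and J :: "nat option list" and u :: "nat \<Rightarrow> nat"
  assumes n: "n = p + q"
    and Q: "set Q \<subseteq> {1..n - 1}"
    and J: "is_subword J Q"
    and u: "u permutes {1..n}"
    and u_flag: "perm_flag n u \<in> torus_fixed n (closed_orbit p q)"
begin

definition m where "m = length Q + 1"

definition v :: "nat \<Rightarrow> nat \<Rightarrow> nat" where "v k = u \<circ> subword_prod J k"

definition K :: "nat \<Rightarrow> nat set" where "K k = (if k = m then {p} else - {Q ! (k - 1)})"

lemma length_J: "length J = length Q"
  using J unfolding is_subword_def by (rule list_all2_lengthD)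

lemma letter:
  assumes "k \<in> {1..<m}"
  shows "1 \<le> Q ! (k - 1)" "Q ! (k - 1) < n" "J ! (k - 1) = None \<or> J ! (k - 1) = Some (Q ! (k - 1))"
proof -
  have k: "k - 1 < length Q" using assms by (auto simp: m_def)
  then have "Q ! (k - 1) \<in> {1..n - 1}" using Q nth_mem by blast
  then show "1 \<le> Q ! (k - 1)" "Q ! (k - 1) < n" by auto
  show "J ! (k - 1) = None \<or> J ! (k - 1) = Some (Q ! (k - 1))"
    using J k unfolding is_subword_def by (simp add: list_all2_conv_all_nth)
qed

lemma subword_prod_last: "subword_prod J m = id"
  by (simp add: subword_prod_def m_def length_J)

lemma subword_prod_step:
  assumes "k \<in> {1..<m}"
  shows "subword_prod J k = subword_prod J (Suc k) \<circ> opt_refl (J ! (k - 1))"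
proof -
  have "k - 1 < length J" "Suc (k - 1) = k" using assms by (auto simp: m_def length_J)
  then have "drop (k - 1) J = J ! (k - 1) # drop k J" using Cons_nth_drop_Suc by metis
  then show ?thesis by (simp add: subword_prod_def)
qed

lemma v_last: "v m = u"
  by (simp add: v_def subword_prod_last)

lemma v_step:
  assumes "k \<in> {1..<m}"
  shows "v k = v (Suc k) \<circ> opt_refl (J ! (k - 1))"
  unfolding v_def subword_prod_step[OF assms] by (simp add: comp_assoc)

lemma opt_refl_permutes:
  assumes "k \<in> {1..<m}"
  shows "opt_refl (J ! (k - 1)) permutes {1..n}"
  using letter(3)[OF assms] simple_refl_permutes[OF letter(1,2)[OF assms]] permutes_id[of "{1..n}"]
  by (auto simp: opt_refl_def)

lemma opt_refl_twice: "opt_refl \<beta> \<circ> opt_refl \<beta> = id"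
  by (cases \<beta>) (simp_all add: opt_refl_def simple_refl_involution)

lemma perm_mat_opt_refl:
  assumes "k \<in> {1..<m}"
  shows "perm_mat n (opt_refl (J ! (k - 1))) \<in> parabolic n (K k)"
proof -
  have "perm_mat n id \<in> parabolic n (K k)"
    using subgroup.one_closed[OF subgroup_parabolic] by (simp add: perm_mat_id)
  moreover have "perm_mat n (simple_refl (Q ! (k - 1))) \<in> parabolic n (K k)"
    using perm_mat_simple_refl_parabolic[OF letter(1,2)[OF assms]] assms by (simp add: K_def)
  ultimately show ?thesis using letter(3)[OF assms] by (auto simp: opt_refl_def)
qed

lemma subword_prod_permutes:
  assumes "k \<in> {1..m}"
  shows "subword_prod J k permutes {1..n}"
proof -
  have "k \<le> m" "1 \<le> k" using assms by auto
  then show ?thesis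
  proof (induction rule: inc_induct)
    case base
    show ?case unfolding subword_prod_last by (rule permutes_id)
  next
    case (step k)
    then have "k \<in> {1..<m}" by auto
    then show ?case
      unfolding subword_prod_step[OF \<open>k \<in> {1..<m}\<close>]
      using step.IH by (intro permutes_compose opt_refl_permutes) auto
  qed
qed

lemma v_permutes: "k \<in> {1..m} \<Longrightarrow> v k permutes {1..n}"
  unfolding v_def by (rule permutes_compose[OF subword_prod_permutes u])

text \<open>
This is where the assumption on \<open>u\<close> enters: the fixed point lies on the closed orbit, so \<open>u\<close> preserves the
first block.
\<close>
lemma perm_mat_u: "perm_mat n u \<in> parabolic n {p}"
  using u_flag lcoset_closed_orbit_iff[of "perm_mat n u" p q] perm_mat_GL[OF u]
  unfolding torus_fixed_def perm_flag_def n by auto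

lemma perm_mat_v_Suc:
  assumes "k \<in> {1..<m}"
  shows "perm_mat n (v (Suc k)) = perm_mat n (v k) * perm_mat n (opt_refl (J ! (k - 1)))"
proof -
  have "v (Suc k) = v k \<circ> opt_refl (J ! (k - 1))"
    unfolding v_step[OF assms] comp_assoc opt_refl_twice by simp
  then show ?thesis unfolding perm_mat_mult[OF opt_refl_permutes[OF assms]] by simp
qed

abbreviation "B \<equiv> upper_borel n"
abbreviation "x \<equiv> fixed_point n u J"

lemma translate_fixed_point:
  assumes h: "h k \<in> carrier (GL n)" and k: "k \<in> {1..m}"
  shows "translate n m h x k = (h k * perm_mat n (v k)) <#\<^bsub>GL n\<^esub> B"
proof -
  interpret group "GL n" by (rule group_GL)
  have "x k = perm_mat n (v k) <#\<^bsub>GL n\<^esub> B"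
    using k by (simp add: fixed_point_def perm_flag_def v_def m_def length_J)
  then show ?thesis
    using lcos_m_assoc[of B "h k" "perm_mat n (v k)"] h k perm_mat_GL[OF v_permutes[OF k]]
    by (simp add: translate_def upper_borel_def)
qed

text \<open>
The permutations of neighbouring components differ by a factor \<open>s\<close> that lies in the parabolic itself.
It can therefore be absorbed, and equality of the images modulo the parabolic becomes a condition on
\<open>h\<^sub>k\<close> and \<open>h\<^sub>k\<^sub>+\<^sub>1\<close> alone.
\<close>
lemma chain_step_iff:
  assumes h: "h k \<in> carrier (GL n)" "h (Suc k) \<in> carrier (GL n)" and k: "k \<in> {1..<m}"
  shows "translate n m h x (Suc k) <#>\<^bsub>GL n\<^esub> min_parabolic n (Q ! (k - 1)) =
      translate n m h x k <#>\<^bsub>GL n\<^esub> min_parabolic n (Q ! (k - 1)) \<longleftrightarrow>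
    (\<exists>r\<in>twisted_alg n (v k) (K k). h k = h (Suc k) * r)"
proof -
  interpret G: group "GL n" by (rule group_GL)
  interpret P: subgroup "parabolic n (K k)" "GL n" by (rule subgroup_parabolic)
  define s where "s = perm_mat n (opt_refl (J ! (k - 1)))"
  define V where "V = perm_mat n (v k)"
  define V' where "V' = perm_mat n (inv_into UNIV (v k))"
  have k1: "k \<in> {1..m}" "Suc k \<in> {1..m}" using k by auto
  note vk = v_permutes[OF k1(1)]
  have s: "s \<in> parabolic n (K k)" unfolding s_def by (rule perm_mat_opt_refl[OF k])
  have c: "V \<in> carrier_mat n n" "V' \<in> carrier_mat n n" "s \<in> carrier_mat n n"
    "h k \<in> carrier_mat n n" "h (Suc k) \<in> carrier_mat n n"
    using h by (simp_all add: V_def V'_def s_def GL_carrier)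
  have VV: "V * V' = 1\<^sub>m n" unfolding V_def V'_def by (rule perm_mat_inverse[OF vk])
  have Vs: "perm_mat n (v (Suc k)) = V * s"
    unfolding V_def s_def by (rule perm_mat_v_Suc[OF k])
  have ss: "s * s = 1\<^sub>m n"
    unfolding s_def perm_mat_mult[OF opt_refl_permutes[OF k]] opt_refl_twice by (rule perm_mat_id)
  have VG: "V \<in> carrier (GL n)" unfolding V_def by (rule perm_mat_GL[OF vk])
  have KQ: "min_parabolic n (Q ! (k - 1)) = parabolic n (K k)"
    using min_parabolic_eq[OF letter(1,2)[OF k]] k by (simp add: K_def)
  have "translate n m h x (Suc k) <#>\<^bsub>GL n\<^esub> min_parabolic n (Q ! (k - 1)) =
      translate n m h x k <#>\<^bsub>GL n\<^esub> min_parabolic n (Q ! (k - 1)) \<longleftrightarrow>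
    (\<exists>r\<in>parabolic n (K k). h k * V = h (Suc k) * (V * s) * r)"
  proof -
    have "subgroup B (GL n)" "B \<subseteq> parabolic n (K k)"
      unfolding upper_borel_eq by (rule subgroup_parabolic, rule parabolic_antimono) simp
    moreover have "h (Suc k) * (V * s) \<in> carrier (GL n)" "h k * V \<in> carrier (GL n)"
      using G.m_closed[OF h(2) G.m_closed[OF VG P.mem_carrier[OF s]]] G.m_closed[OF h(1) VG] by simp_all
    ultimately show ?thesis
      unfolding translate_fixed_point[where h = h, OF h(1) k1(1)]
        translate_fixed_point[where h = h, OF h(2) k1(2)] KQ Vs V_def[symmetric]
      using lcoset_parabolic_eq_iff[OF group_GL _ subgroup_parabolic] by simp
  qed
  also have "\<dots> \<longleftrightarrow> (\<exists>r\<in>twisted_alg n (v k) (K k). h k = h (Suc k) * r)"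
  proof
    assume "\<exists>r\<in>parabolic n (K k). h k * V = h (Suc k) * (V * s) * r"
    then obtain r where r: "r \<in> parabolic n (K k)" "h k * V = h (Suc k) * (V * s) * r" by blast
    define y where "y = s * r"
    have y: "y \<in> parabolic n (K k)" unfolding y_def using P.m_closed[OF s r(1)] by simp
    have rc: "r \<in> carrier_mat n n" "y \<in> carrier_mat n n"
      using r(1) y by (auto simp: parabolic_def flag_alg_def)
    define t where "t = V * y * V'"
    have tc: "t \<in> carrier_mat n n" unfolding t_def using c rc by (intro square_mult_closed)
    have tV: "t * V = V * y"
      using c rc perm_mat_inverse(2)[OF vk]
      by (simp add: t_def V_def V'_def square_mult_assoc[where n = n] square_mult_closed)
    have "t \<in> twisted_alg n (v k) (K k)"
      unfolding twisted_alg_conj_iff[OF vk tc] using tV y by (auto simp: V_def parabolic_def)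
    moreover have "h k = h (Suc k) * t"
    proof -
      have "h k = (h k * V) * V'" using c VV by (simp add: square_mult_assoc[where n = n])
      also have "\<dots> = h (Suc k) * t"
        unfolding r(2) t_def y_def using c rc
        by (simp add: square_mult_assoc[where n = n] square_mult_closed)
      finally show ?thesis .
    qed
    ultimately show "\<exists>r\<in>twisted_alg n (v k) (K k). h k = h (Suc k) * r" by blast
  next
    assume "\<exists>r\<in>twisted_alg n (v k) (K k). h k = h (Suc k) * r"
    then obtain t where t: "t \<in> twisted_alg n (v k) (K k)" "h k = h (Suc k) * t" by blast
    have tc: "t \<in> carrier_mat n n" using t(1) by (simp add: twisted_alg_def)
    obtain y where y: "y \<in> flag_alg n (K k)" "t * V = V * y"
      using t(1) unfolding twisted_alg_conj_iff[OF vk tc] V_def by blast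
    have yc: "y \<in> carrier_mat n n" using y(1) by (simp add: flag_alg_def)
    have hV: "h k * V = h (Suc k) * (V * y)"
      unfolding t(2) using c tc y(2) by (simp add: square_mult_assoc[where n = n])
    have "det y \<noteq> 0"
    proof
      assume "det y = 0"
      then have "det (h k * V) = 0"
        unfolding hV using c yc by (simp add: det_mult[of _ n] square_mult_closed)
      then show False using h VG c by (simp add: det_mult[of _ n] GL_carrier)
    qed
    then have "y \<in> parabolic n (K k)" using y(1) yc by (simp add: parabolic_def GL_carrier)
    then have "s * y \<in> parabolic n (K k)" using P.m_closed[OF s] by simp
    moreover have "h (Suc k) * (V * s) * (s * y) = h k * V"
    proof -
      have "h (Suc k) * (V * s) * (s * y) = h (Suc k) * (V * ((s * s) * y))"
        using c yc by (simp add: square_mult_assoc[where n = n] square_mult_closed)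
      then show ?thesis unfolding ss hV using yc by simp
    qed
    ultimately show "\<exists>r\<in>parabolic n (K k). h k * V = h (Suc k) * (V * s) * r" by metis
  qed
  finally show ?thesis .
qed

lemma closed_orbit_step_iff:
  assumes h: "h m \<in> carrier (GL n)"
  shows "translate n m h x m \<in> closed_orbit p q \<longleftrightarrow> h m \<in> twisted_alg n (v m) {p}"
proof -
  interpret G: group "GL n" by (rule group_GL)
  interpret P: subgroup "parabolic n {p}" "GL n" by (rule subgroup_parabolic)
  have m: "m \<in> {1..m}" by (simp add: m_def)
  have hc: "h m \<in> carrier_mat n n" using h by (simp add: GL_carrier)
  let ?U = "perm_mat n u"
  have UG: "?U \<in> carrier (GL n)" by (rule perm_mat_GL[OF u])
  have "translate n m h x m \<in> closed_orbit p q \<longleftrightarrow> h m * ?U \<in> parabolic n {p}"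
    unfolding translate_fixed_point[where h = h, OF h m] v_last
    using lcoset_closed_orbit_iff[of "h m * ?U" p q] G.m_closed[OF h UG] by (simp add: n)
  also have "\<dots> \<longleftrightarrow> h m \<in> twisted_alg n (v m) {p}"
  proof
    assume hU: "h m * ?U \<in> parabolic n {p}"
    have "inv\<^bsub>GL n\<^esub> ?U \<otimes>\<^bsub>GL n\<^esub> (h m * ?U) \<in> parabolic n {p}"
      using P.m_closed[OF P.m_inv_closed[OF perm_mat_u] hU] .
    moreover have "?U * (inv\<^bsub>GL n\<^esub> ?U \<otimes>\<^bsub>GL n\<^esub> (h m * ?U)) = h m * ?U"
      using G.m_assoc[OF UG G.inv_closed[OF UG] P.mem_carrier[OF hU]] G.r_inv[OF UG]
        P.mem_carrier[OF hU] left_mult_one_mat[of "h m * ?U" n n] by (simp add: GL_carrier)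
    ultimately show "h m \<in> twisted_alg n (v m) {p}"
      unfolding v_last twisted_alg_conj_iff[OF u hc] parabolic_def by (metis IntD1)
  next
    assume "h m \<in> twisted_alg n (v m) {p}"
    then obtain y where "y \<in> flag_alg n {p}" "h m * ?U = ?U * y"
      unfolding v_last twisted_alg_conj_iff[OF u hc] by blast
    then have "h m * ?U \<in> flag_alg n {p}"
      using flag_alg_mult[of ?U n "{p}" y] perm_mat_u by (simp add: parabolic_def)
    then show "h m * ?U \<in> parabolic n {p}" using G.m_closed[OF h UG] by (simp add: parabolic_def)
  qed
  finally show ?thesis .
qed

lemma orbit_preimage_BEM: "orbit_preimage n m (BEM n (closed_orbit p q) Q) x = chain_preimage n m v K"
proof -
  have "translate n m h x \<in> BEM n (closed_orbit p q) Q \<longleftrightarrow>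
     (\<forall>k\<in>{1..m}. \<exists>r\<in>twisted_alg n (v k) (K k). h k = (if k = m then 1\<^sub>m n else h (Suc k)) * r)"
    if h: "h \<in> {1..m} \<rightarrow>\<^sub>E carrier (GL n)" for h
  proof -
    interpret G: group "GL n" by (rule group_GL)
    have hk: "h k \<in> carrier (GL n)" if "k \<in> {1..m}" for k using h that by (rule PiE_mem)
    have m: "m \<in> {1..m}" "{1..length Q} = {1..<m}" "length Q + 1 = m" by (auto simp: m_def)
    have flag: "translate n m h x \<in> {1..m} \<rightarrow>\<^sub>E flag_var n"
    proof (rule PiE_I)
      fix k assume k: "k \<in> {1..m}"
      have "h k * perm_mat n (v k) \<in> carrier (GL n)"
        using G.m_closed[OF hk[OF k] perm_mat_GL[OF v_permutes[OF k]]] by simp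
      then show "translate n m h x k \<in> flag_var n"
        unfolding translate_fixed_point[where h = h, OF hk[OF k] k] flag_var_def LCOSETS_def by blast
    qed (auto simp: translate_def)
    have split: "{1..m} = insert m {1..<m}" by (auto simp: m_def)
    have "translate n m h x \<in> BEM n (closed_orbit p q) Q \<longleftrightarrow> translate n m h x m \<in> closed_orbit p q \<and>
      (\<forall>k\<in>{1..<m}. translate n m h x (Suc k) <#>\<^bsub>GL n\<^esub> min_parabolic n (Q ! (k - 1)) =
        translate n m h x k <#>\<^bsub>GL n\<^esub> min_parabolic n (Q ! (k - 1)))"
      using flag unfolding BEM_def m(2,3) by simp
    also have "\<dots> \<longleftrightarrow> h m \<in> twisted_alg n (v m) {p} \<and>
      (\<forall>k\<in>{1..<m}. \<exists>r\<in>twisted_alg n (v k) (K k). h k = h (Suc k) * r)"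
    proof (intro conj_cong ball_cong refl)
      show "translate n m h x m \<in> closed_orbit p q \<longleftrightarrow> h m \<in> twisted_alg n (v m) {p}"
        by (rule closed_orbit_step_iff[where h = h, OF hk[OF m(1)]])
      fix k assume k: "k \<in> {1..<m}"
      then show "translate n m h x (Suc k) <#>\<^bsub>GL n\<^esub> min_parabolic n (Q ! (k - 1)) =
        translate n m h x k <#>\<^bsub>GL n\<^esub> min_parabolic n (Q ! (k - 1)) \<longleftrightarrow>
        (\<exists>r\<in>twisted_alg n (v k) (K k). h k = h (Suc k) * r)"
        by (intro chain_step_iff hk) auto
    qed
    also have "h m \<in> twisted_alg n (v m) {p} \<longleftrightarrow> (\<exists>r\<in>twisted_alg n (v m) (K m). h m = 1\<^sub>m n * r)"
      by (auto simp: K_def twisted_alg_def)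
    finally show ?thesis unfolding split by auto
  qed
  then show ?thesis unfolding orbit_preimage_def chain_preimage_def by blast
qed

lemma orbit_preimage_point:
  "orbit_preimage n m {x} x =
    {h \<in> {1..m} \<rightarrow>\<^sub>E carrier (GL n). \<forall>k\<in>{1..m}. h k \<in> twisted_alg n (v k) UNIV}"
proof -
  have "translate n m h x = x \<longleftrightarrow> (\<forall>k\<in>{1..m}. h k \<in> twisted_alg n (v k) UNIV)"
    if h: "h \<in> {1..m} \<rightarrow>\<^sub>E carrier (GL n)" for h
  proof -
    interpret G: group "GL n" by (rule group_GL)
    have hk: "h k \<in> carrier (GL n)" if "k \<in> {1..m}" for k using h that by (rule PiE_mem)
    have "translate n m h x = x \<longleftrightarrow> (\<forall>k\<in>{1..m}. translate n m h x k = x k)"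
    proof
      assume eq: "\<forall>k\<in>{1..m}. translate n m h x k = x k"
      show "translate n m h x = x"
      proof
        fix k show "translate n m h x k = x k"
        proof (cases "k \<in> {1..m}")
          case False
          then show ?thesis by (auto simp: translate_def fixed_point_def m_def length_J)
        qed (use eq in blast)
      qed
    qed simp
    also have "\<dots> \<longleftrightarrow> (\<forall>k\<in>{1..m}. h k \<in> twisted_alg n (v k) UNIV)"
    proof (rule ball_cong[OF refl])
      fix k assume k: "k \<in> {1..m}"
      let ?V = "perm_mat n (v k)"
      have VG: "?V \<in> carrier (GL n)" by (rule perm_mat_GL[OF v_permutes[OF k]])
      have hc: "h k \<in> carrier_mat n n" using hk[OF k] by (simp add: GL_carrier)
      have xk: "x k = ?V <#\<^bsub>GL n\<^esub> B"
        using k by (simp add: fixed_point_def perm_flag_def v_def m_def length_J)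
      have hV: "h k * ?V \<in> carrier (GL n)" using G.m_closed[OF hk[OF k] VG] by simp
      have "translate n m h x k = x k \<longleftrightarrow> ?V <#\<^bsub>GL n\<^esub> B = (h k * ?V) <#\<^bsub>GL n\<^esub> B"
        unfolding translate_fixed_point[where h = h, OF hk[OF k] k] xk by (rule eq_commute)
      also have "\<dots> \<longleftrightarrow> (\<exists>r\<in>B. h k * ?V = ?V * r)"
        using lcoset_eq_iff[OF group_GL subgroup_parabolic VG hV] by (simp add: upper_borel_eq)
      also have "\<dots> \<longleftrightarrow> h k \<in> twisted_alg n (v k) UNIV"
        unfolding twisted_alg_conj_iff[OF v_permutes[OF k] hc]
      proof
        assume "\<exists>r\<in>flag_alg n UNIV. h k * ?V = ?V * r"
        then obtain r where r: "r \<in> flag_alg n UNIV" "h k * ?V = ?V * r" by blast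
        have rc: "r \<in> carrier_mat n n" using r(1) by (simp add: flag_alg_def)
        have "det r \<noteq> 0"
        proof
          assume "det r = 0"
          then have "det (h k * ?V) = 0" unfolding r(2) using rc by (simp add: det_mult[of _ n])
          then show False using hV by (simp add: GL_carrier)
        qed
        then show "\<exists>r\<in>B. h k * ?V = ?V * r"
          using r rc by (auto simp: upper_borel_eq parabolic_def GL_carrier)
      qed (auto simp: upper_borel_eq parabolic_def)
      finally show "translate n m h x k = x k \<longleftrightarrow> h k \<in> twisted_alg n (v k) UNIV" .
    qed
    finally show ?thesis .
  qed
  then show ?thesis unfolding orbit_preimage_def by blast
qed

text \<open>
The reflection that leads from one component to the next preserves every flag step in \<open>K k\<close>, so positions
below such a step remain below the diagonal after the change of component.
\<close>
lemma excluded_step: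
  assumes k: "k \<in> {1..<m}"
  shows "excluded n (v k) (K k) \<subseteq> excluded n (v (Suc k)) UNIV"
proof
  fix e assume "e \<in> excluded n (v k) (K k)"
  then obtain a b i where e: "e = (v k (Suc a) - 1, v k (Suc b) - 1)"
    and i: "i \<in> K k" "b < i" "i \<le> a" "a < n"
    unfolding excluded_def by blast
  let ?s = "opt_refl (J ! (k - 1))"
  have ij: "i \<noteq> Q ! (k - 1)" using i(1) k by (simp add: K_def)
  define a' where "a' = ?s (Suc a) - 1"
  define b' where "b' = ?s (Suc b) - 1"
  have "?s (Suc b) \<le> i" "i < ?s (Suc a)"
    using letter(3)[OF k] ij i
    by (auto simp: opt_refl_def simple_refl_def Transposition.transpose_def)
  moreover have s: "?s (Suc a) \<in> {1..n}" "?s (Suc b) \<in> {1..n}"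
    using permutes_in_image[OF opt_refl_permutes[OF k]] i by auto
  ultimately have ab: "b' < a'" "a' < n" "Suc a' = ?s (Suc a)" "Suc b' = ?s (Suc b)"
    by (auto simp: a'_def b'_def)
  then have "e = (v (Suc k) (Suc a') - 1, v (Suc k) (Suc b') - 1)"
    unfolding e v_step[OF k] by simp
  then show "e \<in> excluded n (v (Suc k)) UNIV"
    unfolding excluded_def using ab by blast
qed

sublocale entrywise_quotient n m "\<lambda>k. excluded n (v k) UNIV" "\<lambda>k. excluded n (v k) (K k)"
    "BEM n (closed_orbit p q) Q" x
proof
  show "excluded n (v k) UNIV \<subseteq> {..<n} \<times> {..<n}" if "k \<in> {1..m}" for k
    using excluded_off_diagonal[OF v_permutes[OF that]] by auto
  show "excluded n (v k) (K k) \<subseteq> excluded n (v k) UNIV" for k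
    by (auto simp: excluded_def)
  show "excluded n (v k) (K k) \<subseteq> excluded n (v (Suc k)) UNIV" if "k \<in> {1..<m}" for k
    by (rule excluded_step[OF that])
  show "preimage_tangent n m (BEM n (closed_orbit p q) Q) x =
    {X \<in> carrier (mat_tuples n m). \<forall>k\<in>{1..m}. \<forall>e\<in>excluded n (v k) (K k).
       X k $$ e = (if k = m then 0 else X (Suc k) $$ e)}"
    unfolding preimage_tangent_def orbit_preimage_BEM
    by (rule zariski_tangent_chain_preimage[OF v_permutes])
  show "preimage_tangent n m {x} x =
    {X \<in> carrier (mat_tuples n m). \<forall>k\<in>{1..m}. \<forall>e\<in>excluded n (v k) UNIV. X k $$ e = 0}"
    unfolding preimage_tangent_def orbit_preimage_point
    by (rule zariski_tangent_stabilizer[OF v_permutes])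
qed

definition new_at :: "nat \<Rightarrow> (nat \<times> nat) set" where
  "new_at k = excluded n (v k) UNIV - excluded n (v k) (K k)"

lemma excluded_mem_iff:
  assumes \<sigma>: "\<sigma> permutes {1..n}" and ab: "a \<in> {1..n}" "b \<in> {1..n}"
  shows "(\<sigma> a - 1, \<sigma> b - 1) \<in> excluded n \<sigma> L \<longleftrightarrow> (\<exists>i\<in>L. b \<le> i \<and> i < a)"
proof
  note inj = permutes_inj[OF \<sigma>]
  have im: "\<sigma> i \<ge> 1" if "i \<in> {1..n}" for i using permutes_in_image[OF \<sigma>, of i] that by auto
  assume "(\<sigma> a - 1, \<sigma> b - 1) \<in> excluded n \<sigma> L"
  then obtain a' b' i where *: "\<sigma> a - 1 = \<sigma> (Suc a') - 1" "\<sigma> b - 1 = \<sigma> (Suc b') - 1"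
    "i \<in> L" "b' < i" "i \<le> a'" "a' < n"
    unfolding excluded_def by blast
  have "\<sigma> a = \<sigma> (Suc a')" "\<sigma> b = \<sigma> (Suc b')"
    using * im[OF ab(1)] im[OF ab(2)] im[of "Suc a'"] im[of "Suc b'"] by auto
  then have "a = Suc a'" "b = Suc b'" using inj by (auto dest: injD)
  then show "\<exists>i\<in>L. b \<le> i \<and> i < a" using * by (intro bexI[of _ i]) auto
next
  assume "\<exists>i\<in>L. b \<le> i \<and> i < a"
  then obtain i where "i \<in> L" "b \<le> i" "i < a" by blast
  then have "i \<in> L" "b - 1 < i" "i \<le> a - 1" "a - 1 < n" "Suc (a - 1) = a" "Suc (b - 1) = b"
    using ab by auto
  then show "(\<sigma> a - 1, \<sigma> b - 1) \<in> excluded n \<sigma> L"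
    unfolding excluded_def by (intro CollectI exI[of _ "a - 1"] exI[of _ "b - 1"]) auto
qed

lemma excluded_UNIV_iff:
  assumes \<sigma>: "\<sigma> permutes {1..n}"
  shows "e \<in> excluded n \<sigma> UNIV \<longleftrightarrow> (\<exists>a b. 1 \<le> b \<and> b < a \<and> a \<le> n \<and> e = (\<sigma> a - 1, \<sigma> b - 1))"
proof
  assume "e \<in> excluded n \<sigma> UNIV"
  then obtain a b where "e = (\<sigma> (Suc a) - 1, \<sigma> (Suc b) - 1)" "b < a" "a < n"
    unfolding excluded_def by auto
  then show "\<exists>a b. 1 \<le> b \<and> b < a \<and> a \<le> n \<and> e = (\<sigma> a - 1, \<sigma> b - 1)"
    by (intro exI[of _ "Suc a"] exI[of _ "Suc b"]) auto
next
  assume "\<exists>a b. 1 \<le> b \<and> b < a \<and> a \<le> n \<and> e = (\<sigma> a - 1, \<sigma> b - 1)"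
  then show "e \<in> excluded n \<sigma> UNIV" using excluded_mem_iff[OF \<sigma>, of _ _ UNIV] by fastforce
qed

text \<open>
In terms of \<open>v k\<close>, the new positions are the negative roots that cross no flag step of \<open>K k\<close>.
\<close>
lemma new_at_eq:
  assumes k: "k \<in> {1..m}"
  shows "new_at k = {(v k a - 1, v k b - 1) | a b. 1 \<le> b \<and> b < a \<and> a \<le> n \<and> (\<forall>i\<in>K k. \<not> (b \<le> i \<and> i < a))}"
    (is "_ = ?R")
proof (rule subset_antisym; rule subsetI)
  note vk = v_permutes[OF k]
  fix e
  {
    assume "e \<in> new_at k"
    then obtain a b where ab: "1 \<le> b" "b < a" "a \<le> n" and e: "e = (v k a - 1, v k b - 1)" "e \<notin> excluded n (v k) (K k)"
      unfolding new_at_def using excluded_UNIV_iff[OF vk] by auto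
    then have "\<forall>i\<in>K k. \<not> (b \<le> i \<and> i < a)" using excluded_mem_iff[OF vk, of a b "K k"] by auto
    then show "e \<in> ?R"
      using ab e by blast
  next
    assume "e \<in> ?R"
    then obtain a b where ab: "1 \<le> b" "b < a" "a \<le> n" "\<forall>i\<in>K k. \<not> (b \<le> i \<and> i < a)"
      and e: "e = (v k a - 1, v k b - 1)" by blast
    have "e \<in> excluded n (v k) UNIV" using excluded_UNIV_iff[OF vk] ab e by blast
    moreover have "e \<notin> excluded n (v k) (K k)" using excluded_mem_iff[OF vk, of a b "K k"] ab e by auto
    ultimately show "e \<in> new_at k" unfolding new_at_def by simp
  }
qed

definition tangent_root :: "nat \<Rightarrow> nat \<Rightarrow> real" where
  "tangent_root k = perm_act u (perm_act (subword_prod J k) (- simple_root (Q ! (k - 1))))"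

lemma tangent_root_eq:
  assumes "k \<in> {1..m}"
  shows "tangent_root k = root_diff (v k (Suc (Q ! (k - 1)))) (v k (Q ! (k - 1)))"
  using permutes_bij[OF u] permutes_bij[OF subword_prod_permutes[OF assms]]
  by (simp add: tangent_root_def simple_root_eq uminus_root_diff perm_act_root_diff v_def)

text \<open>
The only negative root that crosses no step other than \<open>j\<close> is $-\alpha_j$.
\<close>
lemma new_at_letter:
  assumes k: "k \<in> {1..<m}"
  shows "{(c, d) \<in> new_at k. entry_weight c d = l} =
    (if tangent_root k = l then {(v k (Suc (Q ! (k - 1))) - 1, v k (Q ! (k - 1)) - 1)} else {})"
proof -
  let ?j = "Q ! (k - 1)"
  have k': "k \<in> {1..m}" using k by simp
  note j = letter(1,2)[OF k]
  have "(1 \<le> b \<and> b < a \<and> a \<le> n \<and> (\<forall>i\<in>K k. \<not> (b \<le> i \<and> i < a))) \<longleftrightarrow> a = Suc ?j \<and> b = ?j" for a b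
  proof
    assume *: "1 \<le> b \<and> b < a \<and> a \<le> n \<and> (\<forall>i\<in>K k. \<not> (b \<le> i \<and> i < a))"
    have K: "K k = - {?j}" using k by (simp add: K_def)
    have "b \<notin> K k" "a - 1 \<notin> K k" using * by auto
    then have "b = ?j" "a - 1 = ?j" unfolding K by simp_all
    then show "a = Suc ?j \<and> b = ?j" using * by auto
  qed (use j k in \<open>auto simp: K_def\<close>)
  then have new: "new_at k = {(v k (Suc ?j) - 1, v k ?j - 1)}" unfolding new_at_eq[OF k'] by auto
  have "v k (Suc ?j) \<in> {1..n}" "v k ?j \<in> {1..n}"
    using permutes_in_image[OF v_permutes[OF k']] j by auto
  then have "entry_weight (v k (Suc ?j) - 1) (v k ?j - 1) = tangent_root k"
    by (simp add: entry_weight_def tangent_root_eq[OF k'])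
  then show ?thesis unfolding new by auto
qed

text \<open>
A negative root that does not cross the step \<open>p\<close> joins two indices of the same block.  These are the
negatives of the inversions of \<open>w\<close>, and \<open>u\<close> acts on them injectively, so no weight occurs twice.
\<close>
lemma new_at_top:
  assumes w: "w = one_line (rev [1..<p + 1] @ rev [p + 1..<n + 1])"
  shows "card {(c, d) \<in> new_at m. entry_weight c d = l} =
    count (image_mset (perm_act u) (image_mset uminus (mset_set (inv_roots n w)))) l"
    and "finite (inv_roots n w)"
proof -
  have m: "m \<in> {1..m}" by (simp add: m_def)
  define I where "I = {(a, b). 1 \<le> a \<and> a < b \<and> b \<le> p + q \<and> (b \<le> p \<or> p < a)}"
  have I: "inversions w = I" and wp: "w permutes {1..n}"
    using block_reversal[of w p q] w unfolding n I_def by auto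
  have fin: "finite I" using finite_inversions[OF wp] I by simp
  have R: "inv_roots n w = (\<lambda>(a, b). root_diff a b) ` I"
    using inv_roots_eq_inversions[OF wp] I by simp
  then show finR: "finite (inv_roots n w)" using fin by simp
  have new: "new_at m = (\<lambda>(a, b). (u b - 1, u a - 1)) ` I"
  proof -
    have "1 \<le> b \<and> b < a \<and> a \<le> n \<and> (\<forall>i\<in>K m. \<not> (b \<le> i \<and> i < a)) \<longleftrightarrow> (b, a) \<in> I" for a b
      by (auto simp: K_def n I_def)
    then have "new_at m = {(u a - 1, u b - 1) | a b. (b, a) \<in> I}"
      unfolding new_at_eq[OF m] v_last by simp
    also have "\<dots> = (\<lambda>(a, b). (u b - 1, u a - 1)) ` I" by force
    finally show ?thesis .
  qed
  have u1: "Suc (u a - 1) = u a" "Suc (u b - 1) = u b" if "(a, b) \<in> I" for a b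
    using permutes_in_image[OF u, of a] permutes_in_image[OF u, of b] that by (auto simp: I_def n)
  let ?r = "\<lambda>(a, b). root_diff (u b) (u a)"
  have neq: "u b \<noteq> u a" if "(a, b) \<in> I" for a b
    using that permutes_inj[OF u] by (auto simp: I_def dest: injD)
  have injr: "inj_on ?r I"
    using neq permutes_inj[OF u] by (auto simp: inj_on_def root_diff_inject dest: injD)
  have inj1: "inj_on (\<lambda>(a, b). root_diff a b) I"
    by (auto simp: inj_on_def root_diff_inject I_def)
  have injn: "inj_on (\<lambda>(a, b). (u b - 1, u a - 1)) I"
  proof (rule inj_onI, clarify)
    fix a b a' b' assume "(a, b) \<in> I" "(a', b') \<in> I" "u b - 1 = u b' - 1" "u a - 1 = u a' - 1"
    then have "u b = u b'" "u a = u a'" using u1[of a b] u1[of a' b'] by auto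
    then show "a = a' \<and> b = b'" using permutes_inj[OF u] by (auto dest: injD)
  qed
  have "{(c, d) \<in> new_at m. entry_weight c d = l} = (\<lambda>(a, b). (u b - 1, u a - 1)) ` {e \<in> I. ?r e = l}"
  proof -
    have "entry_weight (u b - 1) (u a - 1) = root_diff (u b) (u a)" if "(a, b) \<in> I" for a b
      using u1[OF that] by (simp add: entry_weight_def)
    then show ?thesis unfolding new by force
  qed
  then have "card {(c, d) \<in> new_at m. entry_weight c d = l} = card {e \<in> I. ?r e = l}"
    using inj_on_subset[OF injn, of "{e \<in> I. ?r e = l}"] by (simp add: card_image)
  also have "\<dots> = count (image_mset ?r (mset_set I)) l"
    using fin by (simp add: count_image_mset vimage_def Int_def conj_commute)
  also have "image_mset ?r (mset_set I) =
      image_mset (perm_act u) (image_mset uminus (image_mset (\<lambda>(a, b). root_diff a b) (mset_set I)))"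
    using fin permutes_bij[OF u]
    by (auto simp: multiset.map_comp uminus_root_diff perm_act_root_diff intro!: image_mset_cong)
  also have "image_mset (\<lambda>(a, b). root_diff a b) (mset_set I) = mset_set (inv_roots n w)"
    unfolding R by (rule image_mset_mset_set[OF inj1])
  finally show "card {(c, d) \<in> new_at m. entry_weight c d = l} =
    count (image_mset (perm_act u) (image_mset uminus (mset_set (inv_roots n w)))) l" .
qed

lemma card_new_entries:
  assumes w: "w = one_line (rev [1..<p + 1] @ rev [p + 1..<n + 1])"
  shows "card (new_entries l) =
    count (image_mset (perm_act u)
      (image_mset uminus (mset_set (inv_roots n w)) +
        mset (map (\<lambda>i. perm_act (subword_prod J i) (- simple_root (Q ! (i - 1)))) [1..<length Q + 1]))) l"
proof -
  have "new_entries l = (SIGMA k:{1..m}. {(c, d) \<in> new_at k. entry_weight c d = l})"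
    by (auto simp: new_entries_def new_at_def)
  moreover have fin: "finite {(c, d) \<in> new_at k. entry_weight c d = l}" if "k \<in> {1..m}" for k
  proof (rule finite_subset)
    show "{(c, d) \<in> new_at k. entry_weight c d = l} \<subseteq> {..<n} \<times> {..<n}"
      using Low_bound[OF that] unfolding new_at_def by auto
  qed simp
  ultimately have "card (new_entries l) = (\<Sum>k\<in>{1..m}. card {(c, d) \<in> new_at k. entry_weight c d = l})"
    by (simp add: card_SigmaI)
  also have "{1..m} = insert m {1..<m}" by (auto simp: m_def)
  also have "(\<Sum>k\<in>insert m {1..<m}. card {(c, d) \<in> new_at k. entry_weight c d = l}) =
      card {(c, d) \<in> new_at m. entry_weight c d = l} + (\<Sum>k\<in>{1..<m}. card {(c, d) \<in> new_at k. entry_weight c d = l})"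
    by simp
  also have "(\<Sum>k\<in>{1..<m}. card {(c, d) \<in> new_at k. entry_weight c d = l}) = (\<Sum>k\<in>{1..<m}. if tangent_root k = l then 1 else 0)"
    by (rule sum.cong) (simp_all add: new_at_letter)
  also have "\<dots> = count (mset (map tangent_root [1..<m])) l"
  proof -
    have "count (mset (map tangent_root [1..<m])) l = count (image_mset tangent_root (mset_set {1..<m})) l"
      by (simp add: mset_upt)
    also have "\<dots> = (\<Sum>k\<in>{1..<m}. if tangent_root k = l then 1 else 0)"
      by (simp add: count_image_mset vimage_def Int_def sum.If_cases conj_commute)
    finally show ?thesis ..
  qed
  finally show ?thesis
    unfolding new_at_top(1)[OF w]
    by (simp add: m_def tangent_root_def[abs_def] image_mset.compositionality comp_def flip: mset_map)
qed

end

theorem theorem6p3: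
  fixes p q n :: nat and Q :: "nat list" and J :: "nat option list" and u w :: "nat \<Rightarrow> nat"
  assumes "p \<ge> 1" and "q \<ge> 1" and "n = p + q"
    and "set Q \<subseteq> {1..n - 1}"
    and "is_subword J Q"
    and "u permutes {1..n}"
    and "perm_flag n u \<in> torus_fixed n (closed_orbit p q)"
    and "w = one_line (rev [1..<p + 1] @ rev [p + 1..<n + 1])"
  shows "tangent_weights n (length Q + 1) (BEM n (closed_orbit p q) Q) (fixed_point n u J) =
           perm_act u ` (uminus ` inv_roots n w) \<union>
           perm_act u ` {perm_act (subword_prod J i) (- simple_root (Q ! (i - 1))) | i.
                           i \<in> {1..length Q}} \<and>
         (\<forall>l\<in>weight_lattice n.
           weight_multiplicity n (length Q + 1) (BEM n (closed_orbit p q) Q) (fixed_point n u J) l =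
           count (image_mset (perm_act u)
                   (image_mset uminus (mset_set (inv_roots n w)) +
                    mset (map (\<lambda>i. perm_act (subword_prod J i) (- simple_root (Q ! (i - 1))))
                              [1..<length Q + 1]))) l)"
proof -
  interpret F: bem_fixed_point p q n Q J u by unfold_locales (use assms in auto)
  note w = assms(8)
  define M where "M = image_mset (perm_act u)
                   (image_mset uminus (mset_set (inv_roots n w)) +
                    mset (map (\<lambda>i. perm_act (subword_prod J i) (- simple_root (Q ! (i - 1))))
                              [1..<length Q + 1]))"
  note m = F.m_def
  have set_M: "set_mset M = perm_act u ` (uminus ` inv_roots n w) \<union>
      perm_act u ` {perm_act (subword_prod J i) (- simple_root (Q ! (i - 1))) | i. i \<in> {1..length Q}}"
  proof -
    have "{perm_act (subword_prod J i) (- simple_root (Q ! (i - 1))) | i. i \<in> {1..length Q}} =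
        (\<lambda>i. perm_act (subword_prod J i) (- simple_root (Q ! (i - 1)))) ` {1..<length Q + 1}"
      by auto
    then show ?thesis
      unfolding M_def set_image_mset set_mset_union set_mset_mset set_map set_upt image_Un
        finite_set_mset_mset_set[OF F.new_at_top(2)[OF w]] by simp
  qed
  have new: "F.new_entries l \<noteq> {} \<longleftrightarrow> l \<in># M" for l
  proof -
    have "F.new_entries l \<noteq> {} \<longleftrightarrow> card (F.new_entries l) > 0"
      using F.finite_new_entries[of l] by (simp add: card_gt_0_iff)
    then show ?thesis unfolding F.card_new_entries[OF w, folded M_def] count_greater_zero_iff .
  qed
  have lattice: "l \<in> weight_lattice n" if "F.new_entries l \<noteq> {}" for l
  proof -
    obtain k c d where "(k, c, d) \<in> F.new_entries l" using \<open>F.new_entries l \<noteq> {}\<close> by auto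
    then have "k \<in> {1..F.m}" "(c, d) \<in> excluded n (F.v k) UNIV" "entry_weight c d = l"
      by (auto simp: F.new_entries_def)
    then show ?thesis using F.entry_bound[of k "(c, d)"] entry_weight_in_lattice[of c n d] by auto
  qed
  have "tangent_weights n F.m (BEM n (closed_orbit p q) Q) (fixed_point n u J) = set_mset M"
    unfolding F.tangent_weights_eq new using lattice unfolding new by blast
  moreover have "\<forall>l\<in>weight_lattice n.
      weight_multiplicity n F.m (BEM n (closed_orbit p q) Q) (fixed_point n u J) l = count M l"
    using F.weight_multiplicity_eq_card F.card_new_entries[OF w, folded M_def] by (intro ballI) (rule trans)
  ultimately show ?thesis unfolding set_M unfolding F.m_def M_def by (rule conjI)
qed

end
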